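(* Let $F$ be a field of positive characteristic $p$, let $G$ be a finite $p$-group, and let $n$ be a non-negative integer. Then the isomorphism types of the following groups are invariants of $FG$: (1) $G/\gamma(G)\Omega_n(\mathrm{Z}(G))$, (2) $\gamma(G)\Omega_n(\mathrm{Z}(G))/\gamma(G)$, (3) $\mathrm{Z}(G)\cap \mho_n(G)\gamma(G)$, (4) $\mathrm{Z}(G)/(\mathrm{Z}(G)\cap \mho_n(G)\gamma(G))$.
   Context: $FG$ is the group algebra. $\mathrm{Z}(G)$ and $\gamma(G)$ denote the center and the commutator subgroup of $G$. For a finite $p$-group $X$, $\Omega_n(X)=\langle g\in X \mid g^{p^n}=1\rangle$ and $\mho_n(X)=\langle g^{p^n}\mid g\in X\rangle$ (subgroups generated by the indicated elements). For a construction $\mathcal{P}$ assigning a group $\mathcal P(X)$ to each finite $p$-group $X$, "the isomorphism type of $\mathcal{P}(G)$ is an invariant of $FG$" means: for every finite $p$-group $H$ with $FG\cong FH$ as $F$-algebras, one has $\mathcal{P}(G)\cong\mathcal{P}(H)$. *)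

theory Defs
  imports "HOL-Algebra.Algebra" "HOL-Library.Poly_Mapping"
begin

text \<open>
  The group algebra \<open>FG\<close> over the field \<open>F = UNIV :: 'f set\<close>: the formal linear combinations of
  elements of \<open>G\<close>, with \<open>(\<Sum>x. a\<^sub>x x) (\<Sum>y. b\<^sub>y y) = (\<Sum>x y. a\<^sub>x b\<^sub>y (x y))\<close>.
\<close>

definition group_algebra ::
    "'f::field itself \<Rightarrow> ('g, 'm) monoid_scheme \<Rightarrow> ('f, 'g \<Rightarrow>\<^sub>0 'f) module" where
  "group_algebra F G =
    \<lparr>carrier = {a. Poly_Mapping.keys a \<subseteq> carrier G},
     monoid.mult = (\<lambda>a b. \<Sum>x\<in>Poly_Mapping.keys a. \<Sum>y\<in>Poly_Mapping.keys b.
       Poly_Mapping.single (x \<otimes>\<^bsub>G\<^esub> y) (Poly_Mapping.lookup a x * Poly_Mapping.lookup b y)),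
     one = Poly_Mapping.single \<one>\<^bsub>G\<^esub> 1,
     ring.zero = 0,
     ring.add = (+),
     smult = (\<lambda>c. Poly_Mapping.map ((*) c))\<rparr>"

text \<open>
  Isomorphisms of not necessarily commutative unital algebras over \<open>UNIV :: 'f set\<close>
  (the library's locale \<open>algebra\<close> is restricted to commutative ones).
\<close>

definition algebra_iso ::
    "('f::field, 'a, 'm) module_scheme \<Rightarrow> ('f, 'b, 'n) module_scheme \<Rightarrow> ('a \<Rightarrow> 'b) set" where
  "algebra_iso A B =
    {h \<in> ring_iso A B. \<forall>c. \<forall>a\<in>carrier A. h (c \<odot>\<^bsub>A\<^esub> a) = c \<odot>\<^bsub>B\<^esub> h a}"

definition algebra_isomorphic ::
    "('f::field, 'a, 'm) module_scheme \<Rightarrow> ('f, 'b, 'n) module_scheme \<Rightarrow> bool" where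
  "algebra_isomorphic A B \<longleftrightarrow> algebra_iso A B \<noteq> {}"

definition finite_p_group :: "nat \<Rightarrow> ('g, 'm) monoid_scheme \<Rightarrow> bool" where
  "finite_p_group p G \<longleftrightarrow> group G \<and> finite (carrier G) \<and> (\<exists>k. order G = p ^ k)"

definition center :: "('g, 'm) monoid_scheme \<Rightarrow> 'g set" where
  "center G = {z \<in> carrier G. \<forall>x\<in>carrier G. z \<otimes>\<^bsub>G\<^esub> x = x \<otimes>\<^bsub>G\<^esub> z}"

abbreviation commutator_subgroup :: "('g, 'm) monoid_scheme \<Rightarrow> 'g set" where
  "commutator_subgroup G \<equiv> derived G (carrier G)"

definition Omega :: "nat \<Rightarrow> nat \<Rightarrow> ('g, 'm) monoid_scheme \<Rightarrow> 'g set" where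
  "Omega p n K = generate K {g \<in> carrier K. g [^]\<^bsub>K\<^esub> (p ^ n) = \<one>\<^bsub>K\<^esub>}"

definition Agemo :: "nat \<Rightarrow> nat \<Rightarrow> ('g, 'm) monoid_scheme \<Rightarrow> 'g set" where
  "Agemo p n K = generate K {g [^]\<^bsub>K\<^esub> (p ^ n) | g. g \<in> carrier K}"

text \<open>The subgroups \<open>\<gamma>(G) \<Omega>\<^sub>n(Z(G))\<close> and \<open>Z(G) \<inter> \<mho>\<^sub>n(G) \<gamma>(G)\<close>.\<close>

definition commutator_Omega_center :: "nat \<Rightarrow> nat \<Rightarrow> ('g, 'm) monoid_scheme \<Rightarrow> 'g set" where
  "commutator_Omega_center p n G =
    commutator_subgroup G <#>\<^bsub>G\<^esub> Omega p n (G\<lparr>carrier := center G\<rparr>)"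

definition center_Agemo_commutator :: "nat \<Rightarrow> nat \<Rightarrow> ('g, 'm) monoid_scheme \<Rightarrow> 'g set" where
  "center_Agemo_commutator p n G =
    center G \<inter> (Agemo p n G <#>\<^bsub>G\<^esub> commutator_subgroup G)"

end

theory Submission
  imports Defs
begin

text \<open>
  All four groups are abelian \<open>p\<close>-groups, and a finite abelian \<open>p\<close>-group is determined up to
  isomorphism by the numbers of its solutions of \<open>x\<^bsup>p^m\<^esup> = 1\<close>, \<open>m \<ge> 0\<close>
  (\<open>comm_p_group_iso_if_card_pow_kernel_eq\<close>). Elementary counting with homomorphisms expresses
  these numbers through two families of numbers: the orders of the normal subgroups
  \<open>N(n,m,k) = \<gamma>(G) \<Omega>\<^sub>n(Z(G))\<^bsup>p^m\<^esup> G\<^bsup>p^k\<^esup>\<close> (\<open>mixed_power_subgroup\<close>) and the numbers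
  of \<open>p\<^sup>m\<close>-th powers in \<open>Z(G)\<close>. So it suffices that both families are determined by \<open>FG\<close>.

  Let \<open>h\<close> be an isomorphism from \<open>FG\<close> to \<open>FH\<close>. To see that
  \<open>|H/N(n,m,k)| \<le> |G/N(n,m,k)|\<close>, compose \<open>h\<close> with the projection of \<open>FH\<close> onto \<open>F[H/N(n,m,k)]\<close>.
  The images \<open>v g\<close> of the group elements span the target, whose dimension is \<open>|H/N(n,m,k)|\<close>,
  so the inequality follows once \<open>v\<close> is trivial on \<open>N(n,m,k) \<subseteq> G\<close>. As \<open>h\<close> has an inverse,
  the opposite inequality follows by symmetry.

  The map \<open>v\<close> is trivial on commutators because the target is commutative. On powers it is
  controlled by the Frobenius map: in the group algebra of an abelian group, the coefficient of
  \<open>a\<^bsup>p^n\<^esup>\<close> at \<open>c\<close> is the \<open>p\<^sup>n\<close>-th power of the sum of the coefficients of \<open>a\<close> over all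
  \<open>w\<close> with \<open>w\<^bsup>p^n\<^esup> = c\<close> (\<open>coef_frobenius_power\<close>). As \<open>H/N(n,m,k)\<close> is killed by \<open>p\<^sup>k\<close>,
  the image of \<open>x\<^bsup>p^k\<^esup>\<close> only depends on the augmentation of \<open>v x\<close>, which is 1.

  For \<open>z \<in> \<Omega>\<^sub>n(Z(G))\<close> one has to know how the central element \<open>h z\<close> of \<open>FH\<close> sees the center of
  \<open>H\<close>. The conjugacy class of a noncentral element has a size divisible by \<open>p\<close>, so the sum of a class
  function with values in \<open>F\<close> only involves the center (\<open>sum_class_function\<close>). Hence
  restricting the coefficients to \<open>Z(H)\<close> is a ring homomorphism from the center of \<open>FH\<close> to
  \<open>F[Z(H)]\<close> (\<open>central_part_mult\<close>), and the projection of a central element to a commutative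
  quotient of \<open>FH\<close> depends on that restriction only. The Frobenius formula in \<open>F[Z(H)]\<close> then relates
  the coefficients of \<open>h z\<close> on \<open>Z(H)\<close> to those of \<open>h (z\<^bsup>p^n\<^esup>)\<close> (\<open>coef_u_central_power\<close>). This
  gives the triviality of \<open>v\<close> on \<open>z\<^bsup>p^m\<^esup>\<close>, and also the invariance of the number of
  \<open>p\<^sup>m\<close>-th powers in the center.
\<close>

section \<open>Spanning sets and class functions\<close>

text \<open>
  The number \<open>|V|\<close> is the dimension of the space of functions on \<open>V\<close>, which
  is spanned by the \<open>\<phi> i\<close>, and there are at most \<open>|\<kappa> ` I|\<close> different ones among these.
\<close>

lemma card_le_spanning_functions:
  fixes \<phi> :: "'i \<Rightarrow> 'v \<Rightarrow> 'f::field" and \<kappa> :: "'i \<Rightarrow> 'k"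
  assumes fin: "finite V" "finite I"
    and factor: "\<And>i j v. \<lbrakk>i \<in> I; j \<in> I; \<kappa> i = \<kappa> j; v \<in> V\<rbrakk> \<Longrightarrow> \<phi> i v = \<phi> j v"
    and spanning: "\<And>v. v \<in> V \<Longrightarrow> \<exists>c. \<forall>w\<in>V. of_bool (w = v) = (\<Sum>i\<in>I. c i * \<phi> i w)"
  shows "card V \<le> card (\<kappa> ` I)"
proof -
  have lookup_scale: "Poly_Mapping.lookup (Poly_Mapping.map ((*) c) a) x = c * Poly_Mapping.lookup a x"
    for c and a :: "'v \<Rightarrow>\<^sub>0 'f" and x
    by (simp add: map.rep_eq when_def)
  interpret vs: vector_space "\<lambda>c (a :: 'v \<Rightarrow>\<^sub>0 'f). Poly_Mapping.map ((*) c) a"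
    by unfold_locales
      (auto simp: poly_mapping_eq_iff fun_eq_iff lookup_add lookup_scale algebra_simps)
  define \<psi> where "\<psi> i = (\<Sum>v\<in>V. Poly_Mapping.single v (\<phi> i v))" for i
  have lookup_\<psi>: "Poly_Mapping.lookup (\<psi> i) w = (if w \<in> V then \<phi> i w else 0)" for i w
    using fin(1) by (simp add: \<psi>_def lookup_sum lookup_single when_def sum.delta)
  let ?B = "(\<lambda>v. Poly_Mapping.single v (1::'f)) ` V"
  have "?B \<subseteq> vs.span (\<psi> ` I)"
  proof safe
    fix v assume v: "v \<in> V"
    obtain c where c: "\<forall>w\<in>V. of_bool (w = v) = (\<Sum>i\<in>I. c i * \<phi> i w)"
      using spanning[OF v] by blast
    have "Poly_Mapping.single v 1 = (\<Sum>i\<in>I. Poly_Mapping.map ((*) (c i)) (\<psi> i))"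
    proof (rule poly_mapping_eqI)
      fix w
      show "Poly_Mapping.lookup (Poly_Mapping.single v 1) w
        = Poly_Mapping.lookup (\<Sum>i\<in>I. Poly_Mapping.map ((*) (c i)) (\<psi> i)) w"
      proof (cases "w \<in> V")
        case True
        then show ?thesis
          using c by (auto simp: lookup_sum lookup_scale lookup_\<psi> when_def lookup_single
              of_bool_def intro!: sum.cong split: if_splits)
      next
        case False
        then show ?thesis
          using v by (auto simp: lookup_sum lookup_scale lookup_\<psi> when_def lookup_single)
      qed
    qed
    then show "Poly_Mapping.single v 1 \<in> vs.span (\<psi> ` I)"
      by (simp only:) (intro vs.span_sum vs.span_scale vs.span_base imageI)
  qed
  moreover have "vs.independent ?B"
  proof
    assume "vs.dependent ?B"
    then obtain t u where t: "finite t" "t \<subseteq> ?B" "(\<Sum>b\<in>t. Poly_Mapping.map ((*) (u b)) b) = 0"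
        and "\<exists>b\<in>t. u b \<noteq> 0"
      unfolding vs.dependent_explicit by blast
    then obtain v where v: "Poly_Mapping.single v 1 \<in> t" "u (Poly_Mapping.single v 1) \<noteq> 0"
      by blast
    have "0 = Poly_Mapping.lookup (\<Sum>b\<in>t. Poly_Mapping.map ((*) (u b)) b) v"
      by (simp add: t(3))
    also have "\<dots> = (\<Sum>b\<in>t. u b * Poly_Mapping.lookup b v)"
      by (simp add: lookup_sum lookup_scale)
    also have "\<dots> = (\<Sum>b\<in>t. if b = Poly_Mapping.single v 1 then u b else 0)"
    proof (rule sum.cong[OF refl])
      fix b assume "b \<in> t"
      then obtain w where "b = Poly_Mapping.single w 1" using t(2) by blast
      then show "u b * Poly_Mapping.lookup b v = (if b = Poly_Mapping.single v 1 then u b else 0)"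
        by (auto simp: lookup_single when_def) (metis lookup_single_eq lookup_single_not_eq one_neq_zero)
    qed
    also have "\<dots> = u (Poly_Mapping.single v 1)"
      using t(1) v(1) by (simp add: sum.delta)
    finally show False using v(2) by simp
  qed
  ultimately have "card ?B \<le> card (\<psi> ` I)"
    using vs.independent_span_bound[of "\<psi> ` I" ?B] fin by blast
  moreover have "card ?B = card V"
    by (rule card_image) (auto simp: inj_on_def, metis lookup_single_eq lookup_single_not_eq one_neq_zero)
  moreover have "card (\<psi> ` I) \<le> card (\<kappa> ` I)"
  proof -
    have "\<psi> i = \<psi> (inv_into I \<kappa> (\<kappa> i))" if "i \<in> I" for i
      using that factor[of i "inv_into I \<kappa> (\<kappa> i)"]
      by (auto simp: \<psi>_def f_inv_into_f inv_into_into intro!: sum.cong)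
    then have "\<psi> ` I \<subseteq> (\<lambda>k. \<psi> (inv_into I \<kappa> k)) ` \<kappa> ` I"
      by (auto simp: image_image)
    then have "card (\<psi> ` I) \<le> card ((\<lambda>k. \<psi> (inv_into I \<kappa> k)) ` \<kappa> ` I)"
      using fin(2) by (intro card_mono) auto
    also have "\<dots> \<le> card (\<kappa> ` I)"
      using fin(2) by (intro card_image_le) auto
    finally show ?thesis .
  qed
  ultimately show ?thesis by linarith
qed

text \<open>
  A conjugacy class of a noncentral element has \<open>p\<^sup>i\<close> elements with \<open>i > 0\<close>, so that it contributes
  a multiple of \<open>p\<close> to the sum.
\<close>

lemma (in group) sum_class_function:
  fixes f :: "'a \<Rightarrow> 'f::field"
  assumes ord: "order G = p ^ k" and p: "p = CHAR('f)" "p > 0"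
    and class_fun: "\<And>x g. \<lbrakk>x \<in> carrier G; g \<in> carrier G\<rbrakk> \<Longrightarrow> f (g \<otimes> x \<otimes> inv g) = f x"
  shows "(\<Sum>x\<in>carrier G. f x) = (\<Sum>x\<in>center G. f x)"
proof -
  have prime: "Factorial_Ring.prime p" using p prime_CHAR_semidom by blast
  have fin: "finite (carrier G)"
    using ord p(2) order_gt_0_iff_finite by auto
  interpret conj: group_action G "carrier G" "\<lambda>g. \<lambda>h\<in>carrier G. g \<otimes> h \<otimes> inv g"
    by (rule action_by_conjugation)
  let ?orbit = "orbit G (\<lambda>g. \<lambda>h\<in>carrier G. g \<otimes> h \<otimes> inv g)"
  let ?orbits = "orbits G (carrier G) (\<lambda>g. \<lambda>h\<in>carrier G. g \<otimes> h \<otimes> inv g)"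
  have orbit_eq: "?orbit x = (\<lambda>g. g \<otimes> x \<otimes> inv g) ` carrier G" if "x \<in> carrier G" for x
    using that by (auto simp: orbit_def)
  have orbit_sum: "sum f (?orbit x) = (\<Sum>y\<in>?orbit x. if y \<in> center G then f y else 0)"
    if x: "x \<in> carrier G" for x
  proof (cases "x \<in> center G")
    case True
    have "g \<otimes> x \<otimes> inv g = x" if "g \<in> carrier G" for g
    proof -
      have "g \<otimes> x = x \<otimes> g" using True that by (simp add: center_def)
      then show ?thesis using that x by (simp add: m_assoc)
    qed
    then have "?orbit x = (\<lambda>g. x) ` carrier G"
      unfolding orbit_eq[OF x] by (intro image_cong) auto
    then have "?orbit x = {x}"
      using one_closed by blast
    then show ?thesis using True by simp
  next
    case False
    obtain g where g: "g \<in> carrier G" "g \<otimes> x \<noteq> x \<otimes> g"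
      using False x by (auto simp: center_def)
    have noncentral: "y \<notin> center G" if y: "y \<in> ?orbit x" for y
    proof
      assume c: "y \<in> center G"
      obtain a where a: "a \<in> carrier G" "y = a \<otimes> x \<otimes> inv a"
        using y unfolding orbit_eq[OF x] by auto
      have yG: "y \<in> carrier G" and comm: "y \<otimes> a = a \<otimes> y"
        using c a(1) unfolding center_def by blast+
      have "y \<otimes> a = a \<otimes> x" using a x by (simp add: m_assoc)
      then have "a \<otimes> y = a \<otimes> x" using comm by simp
      then have "y = x" using l_cancel[OF _ yG x a(1)] by blast
      then show False using c False by simp
    qed
    have "x \<in> ?orbit x"
      using x unfolding orbit_eq[OF x] by (intro image_eqI[of _ _ \<one>]) auto
    moreover have "g \<otimes> x \<otimes> inv g \<in> ?orbit x"
      using g unfolding orbit_eq[OF x] by blast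
    moreover have "g \<otimes> x \<otimes> inv g \<noteq> x"
    proof
      assume "g \<otimes> x \<otimes> inv g = x"
      then have "x \<otimes> g = g \<otimes> x \<otimes> inv g \<otimes> g" by simp
      also have "\<dots> = g \<otimes> x" using g(1) x by (simp add: m_assoc)
      finally show False using g(2) by simp
    qed
    moreover have "finite (?orbit x)"
      using fin unfolding orbit_eq[OF x] by simp
    ultimately have "card (?orbit x) \<noteq> 1"
      by (auto simp: card_1_singleton_iff)
    have "card (?orbit x) dvd p ^ k"
      using conj.orbit_stabilizer_theorem[OF x] unfolding ord by (rule dvdI[OF sym])
    have "p dvd card (?orbit x)"
    proof -
      obtain j where j: "card (?orbit x) = p ^ j"
        using \<open>card (?orbit x) dvd p ^ k\<close> divides_primepow_nat[OF prime] by blast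
      with \<open>card (?orbit x) \<noteq> 1\<close> have "j > 0" by (cases j) auto
      then show ?thesis unfolding j by simp
    qed
    then have "of_nat (card (?orbit x)) = (0::'f)"
      using p(1) of_nat_eq_0_iff_char_dvd by blast
    moreover have "sum f (?orbit x) = (\<Sum>y\<in>?orbit x. f x)"
      using class_fun[OF x] unfolding orbit_eq[OF x] by (intro sum.cong) auto
    ultimately show ?thesis using noncentral by simp
  qed
  have "(\<Sum>x\<in>carrier G. f x) = (\<Sum>orb\<in>?orbits. \<Sum>x\<in>orb. f x)"
    using conj.disjoint_sum[OF fin, of f] by simp
  also have "\<dots> = (\<Sum>orb\<in>?orbits. \<Sum>x\<in>orb. if x \<in> center G then f x else 0)"
  proof (rule sum.cong[OF refl])
    fix orb assume "orb \<in> ?orbits"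
    then obtain x where "x \<in> carrier G" "orb = ?orbit x" unfolding orbits_def by blast
    then show "sum f orb = (\<Sum>x\<in>orb. if x \<in> center G then f x else 0)"
      using orbit_sum by simp
  qed
  also have "\<dots> = (\<Sum>x\<in>carrier G. if x \<in> center G then f x else 0)"
    using conj.disjoint_sum[OF fin, of "\<lambda>x. if x \<in> center G then f x else 0"] by simp
  also have "\<dots> = (\<Sum>x\<in>carrier G \<inter> center G. f x)"
    by (rule sum.inter_restrict[OF fin, symmetric])
  also have "carrier G \<inter> center G = center G"
    by (auto simp: center_def)
  finally show ?thesis .
qed

section \<open>The Frobenius map of a commutative ring\<close>

lemma (in cring) binomial:
  assumes a: "a \<in> carrier R" and b: "b \<in> carrier R"
  shows "(a \<oplus> b) [^] n = (\<Oplus>k\<in>{..n}. add_pow R (n choose k :: nat) (a [^] k \<otimes> b [^] (n - k)))"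
proof (induction n)
  case 0
  show ?case using a b by simp
next
  case (Suc n)
  let ?t = "\<lambda>k. a [^] k \<otimes> b [^] (Suc n - k)"
  let ?s = "\<lambda>k. add_pow R (n choose k :: nat) (a [^] k \<otimes> b [^] (n - k))"
  have closed: "?t \<in> {..m} \<rightarrow> carrier R" "?s \<in> {..m} \<rightarrow> carrier R" for m
    using a b by auto
  have times_b: "(a \<oplus> b) [^] n \<otimes> b = (\<Oplus>k\<in>{..Suc n}. add_pow R (n choose k :: nat) (?t k))"
  proof -
    have "(a \<oplus> b) [^] n \<otimes> b = (\<Oplus>k\<in>{..n}. ?s k \<otimes> b)"
      unfolding Suc.IH using b closed by (intro finsum_ldistr) auto
    also have "\<dots> = (\<Oplus>k\<in>{..n}. add_pow R (n choose k :: nat) (?t k))"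
      using a b by (intro finsum_cong') (auto simp: add_pow_ldistr m_assoc Suc_diff_le)
    also have "\<dots> = (\<Oplus>k\<in>{..Suc n}. add_pow R (n choose k :: nat) (?t k))"
      using a b by (subst finsum_Suc) (auto simp: binomial_eq_0)
    finally show ?thesis .
  qed
  have times_a: "(a \<oplus> b) [^] n \<otimes> a = (\<Oplus>k\<in>{..Suc n}. add_pow R (if k = 0 then 0 else n choose (k - 1) :: nat) (?t k))"
  proof -
    have "(a \<oplus> b) [^] n \<otimes> a = (\<Oplus>k\<in>{..n}. ?s k \<otimes> a)"
      unfolding Suc.IH using a closed by (intro finsum_ldistr) auto
    also have "\<dots> = (\<Oplus>k\<in>{..n}. add_pow R (n choose k :: nat) (?t (Suc k)))"
    proof (rule finsum_cong')
      fix k assume "k \<in> {..n}"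
      have "a [^] k \<otimes> b [^] (n - k) \<otimes> a = ?t (Suc k)"
        using a b by (simp add: m_ac)
      then show "?s k \<otimes> a = add_pow R (n choose k :: nat) (?t (Suc k))"
        using a b by (simp add: add_pow_ldistr)
    qed (use a b in auto)
    also have "\<dots> = (\<Oplus>k\<in>{..Suc n}. add_pow R (if k = 0 then 0 else n choose (k - 1) :: nat) (?t k))"
      using a b by (subst finsum_Suc2) auto
    finally show ?thesis .
  qed
  have "(a \<oplus> b) [^] Suc n = (a \<oplus> b) [^] n \<otimes> b \<oplus> (a \<oplus> b) [^] n \<otimes> a"
    using a b by (simp add: r_distr a_comm)
  also have "\<dots> = (\<Oplus>k\<in>{..Suc n}. add_pow R (n choose k :: nat) (?t k) \<oplus> add_pow R (if k = 0 then 0 else n choose (k - 1) :: nat) (?t k))"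
    unfolding times_a times_b using a b by (subst finsum_addf) auto
  also have "\<dots> = (\<Oplus>k\<in>{..Suc n}. add_pow R (Suc n choose k :: nat) (?t k))"
  proof (rule finsum_cong')
    fix k assume "k \<in> {..Suc n}"
    have "Suc n choose k = (n choose k) + (if k = 0 then 0 else n choose (k - 1))"
      by (cases k) auto
    then show "add_pow R (n choose k :: nat) (?t k) \<oplus> add_pow R (if k = 0 then 0 else n choose (k - 1) :: nat) (?t k) = add_pow R (Suc n choose k :: nat) (?t k)"
      using a b by (simp only:) (rule add.nat_pow_mult, auto)
  qed (use a b in auto)
  finally show ?case .
qed

text \<open>
  The freshman's dream: \<open>p\<close> divides the inner binomial coefficients in the expansion of the \<open>p\<close>-th
  power.
\<close>

lemma (in cring) add_power_prime_char:
  assumes p: "Factorial_Ring.prime p" and char: "\<And>x. x \<in> carrier R \<Longrightarrow> add_pow R (p :: nat) (x) = \<zero>"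
    and a: "a \<in> carrier R" and b: "b \<in> carrier R"
  shows "(a \<oplus> b) [^] (p ^ n) = a [^] (p ^ n) \<oplus> b [^] (p ^ n)"
proof -
  have step: "(a \<oplus> b) [^] p = a [^] p \<oplus> b [^] p" if a: "a \<in> carrier R" and b: "b \<in> carrier R" for a b
  proof -
    let ?s = "\<lambda>k. add_pow R (p choose k :: nat) (a [^] k \<otimes> b [^] (p - k))"
    have zero: "?s k = \<zero>" if "k \<in> {..p} - {0, p}" for k
    proof -
      have "p dvd (p choose k)" using that p by (intro dvd_choose_prime) auto
      then obtain m where m: "p choose k = p * m" by blast
      have "?s k = add_pow R (m :: nat) (add_pow R (p :: nat) (a [^] k \<otimes> b [^] (p - k)))"
        unfolding m using a b by (intro add.nat_pow_pow[symmetric]) auto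
      then show ?thesis using a b by (simp add: char)
    qed
    have "(a \<oplus> b) [^] p = (\<Oplus>k\<in>{..p}. ?s k)"
      by (rule binomial[OF a b])
    also have "\<dots> = (\<Oplus>k\<in>{0,p}. ?s k)"
      using a b zero by (intro add.finprod_mono_neutral_cong_right) auto
    also have "\<dots> = a [^] p \<oplus> b [^] p"
      using a b prime_gt_0_nat[OF p] by (simp add: a_comm)
    finally show ?thesis .
  qed
  show ?thesis
  proof (induction n)
    case (Suc n)
    have "(a \<oplus> b) [^] (p ^ Suc n) = ((a \<oplus> b) [^] (p ^ n)) [^] p"
      using a b by (simp add: nat_pow_pow mult.commute)
    also have "\<dots> = (a [^] (p ^ n)) [^] p \<oplus> (b [^] (p ^ n)) [^] p"
      using Suc a b by (simp add: step)
    also have "\<dots> = a [^] (p ^ Suc n) \<oplus> b [^] (p ^ Suc n)"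
      using a b by (simp add: nat_pow_pow mult.commute)
    finally show ?case .
  qed (use a b in simp)
qed

section \<open>Group algebras of finite groups\<close>

abbreviation coef :: "('g \<Rightarrow>\<^sub>0 'f::zero) \<Rightarrow> 'g \<Rightarrow> 'f" where
  "coef \<equiv> Poly_Mapping.lookup"

abbreviation basis_element :: "'g \<Rightarrow> ('g \<Rightarrow>\<^sub>0 'f::zero_neq_one)" where
  "basis_element g \<equiv> Poly_Mapping.single g 1"

lemma carrier_group_algebra:
  "a \<in> carrier (group_algebra F G) \<longleftrightarrow> (\<forall>x. x \<notin> carrier G \<longrightarrow> coef a x = 0)"
  by (auto simp: group_algebra_def in_keys_iff)

lemma single_in_group_algebra [simp]:
  "x \<in> carrier G \<Longrightarrow> Poly_Mapping.single x c \<in> carrier (group_algebra F G)"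
  by (auto simp: carrier_group_algebra lookup_single when_def)

lemma group_algebra_add [simp]: "a \<oplus>\<^bsub>group_algebra F G\<^esub> b = a + b"
  and group_algebra_zero [simp]: "\<zero>\<^bsub>group_algebra F G\<^esub> = 0"
  and group_algebra_one: "\<one>\<^bsub>group_algebra F G\<^esub> = Poly_Mapping.single \<one>\<^bsub>G\<^esub> 1"
  and coef_group_algebra_smult: "coef (c \<odot>\<^bsub>group_algebra F G\<^esub> a) x = c * coef a x"
  by (simp_all add: group_algebra_def map.rep_eq when_def)

lemma group_algebra_eqI:
  assumes "a \<in> carrier (group_algebra F G)" "b \<in> carrier (group_algebra F G)"
    and "\<And>x. x \<in> carrier G \<Longrightarrow> coef a x = coef b x"
  shows "a = b"
  using assms by (intro poly_mapping_eqI) (metis carrier_group_algebra)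

lemma group_algebra_mult:
  "a \<otimes>\<^bsub>group_algebra F G\<^esub> b = (\<Sum>x\<in>Poly_Mapping.keys a. \<Sum>y\<in>Poly_Mapping.keys b.
     Poly_Mapping.single (x \<otimes>\<^bsub>G\<^esub> y) (coef a x * coef b y))"
  by (simp add: group_algebra_def)

lemma single_mult_single:
  "Poly_Mapping.single x c \<otimes>\<^bsub>group_algebra F G\<^esub> Poly_Mapping.single y d
    = Poly_Mapping.single (x \<otimes>\<^bsub>G\<^esub> y) (c * d)"
  by (simp add: group_algebra_mult)

lemma (in group) group_algebra_mult_closed:
  assumes "a \<in> carrier (group_algebra F G)" "b \<in> carrier (group_algebra F G)"
  shows "a \<otimes>\<^bsub>group_algebra F G\<^esub> b \<in> carrier (group_algebra F G)"
proof -
  have "x \<otimes> y \<noteq> z" if "z \<notin> carrier G" "x \<in> Poly_Mapping.keys a" "y \<in> Poly_Mapping.keys b" for x y z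
    using that assms by (auto simp: group_algebra_def)
  then show ?thesis
    by (auto simp: carrier_group_algebra group_algebra_mult lookup_sum lookup_single
        intro!: sum.neutral)
qed

lemma (in group) coef_mult:
  assumes fin: "finite (carrier G)" and a: "a \<in> carrier (group_algebra F G)"
    and b: "b \<in> carrier (group_algebra F G)" and z: "z \<in> carrier G"
  shows "coef (a \<otimes>\<^bsub>group_algebra F G\<^esub> b) z = (\<Sum>x\<in>carrier G. coef a x * coef b (inv x \<otimes> z))"
proof -
  have keys: "Poly_Mapping.keys a \<subseteq> carrier G" "Poly_Mapping.keys b \<subseteq> carrier G"
    using a b by (auto simp: group_algebra_def)
  have inner: "(\<Sum>y\<in>Poly_Mapping.keys b. coef (Poly_Mapping.single (x \<otimes> y) (coef a x * coef b y)) z)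
      = coef a x * coef b (inv x \<otimes> z)" if x: "x \<in> carrier G" for x
  proof -
    have "(\<Sum>y\<in>Poly_Mapping.keys b. coef (Poly_Mapping.single (x \<otimes> y) (coef a x * coef b y)) z)
       = (\<Sum>y\<in>Poly_Mapping.keys b. if y = inv x \<otimes> z then coef a x * coef b y else 0)"
      using keys x z by (intro sum.cong) (auto simp: lookup_single when_def inv_solve_left m_assoc[symmetric])
    also have "\<dots> = coef a x * coef b (inv x \<otimes> z)"
      by (simp add: sum.delta in_keys_iff)
    finally show ?thesis .
  qed
  have "coef (a \<otimes>\<^bsub>group_algebra F G\<^esub> b) z
      = (\<Sum>x\<in>Poly_Mapping.keys a. coef a x * coef b (inv x \<otimes> z))"
    unfolding group_algebra_mult lookup_sum using inner keys by (intro sum.cong) auto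
  also have "\<dots> = (\<Sum>x\<in>carrier G. coef a x * coef b (inv x \<otimes> z))"
    using fin keys by (intro sum.mono_neutral_left) (auto simp: in_keys_iff)
  finally show ?thesis .
qed

lemma (in group) sum_translate:
  assumes "x \<in> carrier G"
  shows "(\<Sum>y\<in>carrier G. f (inv x \<otimes> y)) = (\<Sum>y\<in>carrier G. f y)"
  using assms
  by (intro sum.reindex_bij_witness[of _ "\<lambda>y. x \<otimes> y" "\<lambda>y. inv x \<otimes> y"])
    (auto simp: m_assoc[symmetric])

lemma (in group) ring_group_algebra:
  fixes F :: "'f::field itself"
  assumes fin: "finite (carrier G)"
  shows "ring (group_algebra F G)"
proof -
  let ?A = "group_algebra F G"
  note closed = group_algebra_mult_closed[where F = F]
  note coef_mult = coef_mult[OF fin, where F = F]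
  have add_closed: "a + b \<in> carrier ?A" if "a \<in> carrier ?A" "b \<in> carrier ?A" for a b
    using that by (auto simp: carrier_group_algebra lookup_add)
  have one: "basis_element \<one> \<in> carrier ?A"
    by simp
  show ?thesis
  proof (rule ringI)
    show "abelian_group ?A"
    proof (rule abelian_groupI)
      fix a assume a: "a \<in> carrier ?A"
      then have "- a \<in> carrier ?A"
        by (auto simp: carrier_group_algebra)
      then show "\<exists>b\<in>carrier ?A. b \<oplus>\<^bsub>?A\<^esub> a = \<zero>\<^bsub>?A\<^esub>"
        by (intro bexI[of _ "- a"]) auto
    qed (auto simp: add_closed add_ac, simp add: carrier_group_algebra)
  next
    show "monoid ?A"
    proof (rule monoidI)
      fix a b c assume abc: "a \<in> carrier ?A" "b \<in> carrier ?A" "c \<in> carrier ?A"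
      show "a \<otimes>\<^bsub>?A\<^esub> b \<otimes>\<^bsub>?A\<^esub> c = a \<otimes>\<^bsub>?A\<^esub> (b \<otimes>\<^bsub>?A\<^esub> c)"
      proof (rule group_algebra_eqI[where F = F and G = G])
        fix z assume z: "z \<in> carrier G"
        have "coef (a \<otimes>\<^bsub>?A\<^esub> b \<otimes>\<^bsub>?A\<^esub> c) z
            = (\<Sum>y\<in>carrier G. \<Sum>x\<in>carrier G. coef a x * coef b (inv x \<otimes> y) * coef c (inv y \<otimes> z))"
          using abc z closed by (simp add: coef_mult sum_distrib_right)
        also have "\<dots> = (\<Sum>x\<in>carrier G. \<Sum>y\<in>carrier G. coef a x * coef b (inv x \<otimes> y) * coef c (inv y \<otimes> z))"
          by (rule sum.swap)
        also have "\<dots> = (\<Sum>x\<in>carrier G. coef a x * coef (b \<otimes>\<^bsub>?A\<^esub> c) (inv x \<otimes> z))"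
        proof (rule sum.cong[OF refl])
          fix x assume x: "x \<in> carrier G"
          have "(\<Sum>y\<in>carrier G. coef b (inv x \<otimes> y) * coef c (inv y \<otimes> z))
             = (\<Sum>y\<in>carrier G. coef b (inv x \<otimes> y) * coef c (inv (inv x \<otimes> y) \<otimes> (inv x \<otimes> z)))"
          proof (rule sum.cong[OF refl])
            fix y assume y: "y \<in> carrier G"
            have "inv (inv x \<otimes> y) \<otimes> (inv x \<otimes> z) = inv y \<otimes> z"
              using x y z by (simp add: inv_mult_group m_assoc inv_solve_left) (simp add: m_assoc[symmetric])
            then show "coef b (inv x \<otimes> y) * coef c (inv y \<otimes> z)
              = coef b (inv x \<otimes> y) * coef c (inv (inv x \<otimes> y) \<otimes> (inv x \<otimes> z))" by simp
          qed
          also have "\<dots> = (\<Sum>y\<in>carrier G. coef b y * coef c (inv y \<otimes> (inv x \<otimes> z)))"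
            by (rule sum_translate[OF x, of "\<lambda>y. coef b y * coef c (inv y \<otimes> (inv x \<otimes> z))"])
          also have "\<dots> = coef (b \<otimes>\<^bsub>?A\<^esub> c) (inv x \<otimes> z)"
            using abc x z by (simp add: coef_mult)
          finally show "(\<Sum>y\<in>carrier G. coef a x * coef b (inv x \<otimes> y) * coef c (inv y \<otimes> z))
              = coef a x * coef (b \<otimes>\<^bsub>?A\<^esub> c) (inv x \<otimes> z)"
            by (simp only: sum_distrib_left[symmetric] mult.assoc)
        qed
        also have "\<dots> = coef (a \<otimes>\<^bsub>?A\<^esub> (b \<otimes>\<^bsub>?A\<^esub> c)) z"
          using abc z closed by (simp add: coef_mult)
        finally show "coef (a \<otimes>\<^bsub>?A\<^esub> b \<otimes>\<^bsub>?A\<^esub> c) z = coef (a \<otimes>\<^bsub>?A\<^esub> (b \<otimes>\<^bsub>?A\<^esub> c)) z" .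
      qed (use abc closed in auto)
    next
      fix a assume a: "a \<in> carrier ?A"
      show "\<one>\<^bsub>?A\<^esub> \<otimes>\<^bsub>?A\<^esub> a = a"
      proof (rule group_algebra_eqI[where F = F and G = G])
        fix z assume z: "z \<in> carrier G"
        have "(\<Sum>x\<in>carrier G. coef (basis_element \<one>) x * coef a (inv x \<otimes> z))
            = (\<Sum>x\<in>carrier G. if x = \<one> then coef a z else 0)"
          using z by (intro sum.cong) (auto simp: lookup_single)
        then show "coef (\<one>\<^bsub>?A\<^esub> \<otimes>\<^bsub>?A\<^esub> a) z = coef a z"
          using fin z by (simp add: group_algebra_one coef_mult[OF one a z])
      qed (use a closed one in \<open>auto simp: group_algebra_one\<close>)
      show "a \<otimes>\<^bsub>?A\<^esub> \<one>\<^bsub>?A\<^esub> = a"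
      proof (rule group_algebra_eqI[where F = F and G = G])
        fix z assume z: "z \<in> carrier G"
        have "(\<Sum>x\<in>carrier G. coef a x * coef (basis_element \<one>) (inv x \<otimes> z))
            = (\<Sum>x\<in>carrier G. if x = z then coef a z else 0)"
        proof (rule sum.cong[OF refl])
          fix x assume x: "x \<in> carrier G"
          have "\<one> = inv x \<otimes> z \<longleftrightarrow> x = z"
            using x z inv_solve_left[of \<one> x z] by auto
          then show "coef a x * coef (basis_element \<one>) (inv x \<otimes> z) = (if x = z then coef a z else 0)"
            by (auto simp: lookup_single when_def)
        qed
        then show "coef (a \<otimes>\<^bsub>?A\<^esub> \<one>\<^bsub>?A\<^esub>) z = coef a z"
          using fin z by (simp add: group_algebra_one coef_mult[OF a one z])
      qed (use a closed one in \<open>auto simp: group_algebra_one\<close>)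
    qed (use closed one in \<open>auto simp: group_algebra_one\<close>)
  next
    fix a b c assume abc: "a \<in> carrier ?A" "b \<in> carrier ?A" "c \<in> carrier ?A"
    show "(a \<oplus>\<^bsub>?A\<^esub> b) \<otimes>\<^bsub>?A\<^esub> c = a \<otimes>\<^bsub>?A\<^esub> c \<oplus>\<^bsub>?A\<^esub> b \<otimes>\<^bsub>?A\<^esub> c"
      using abc add_closed closed
      by (intro group_algebra_eqI[where F = F and G = G])
        (auto simp: coef_mult lookup_add distrib_right sum.distrib)
    show "c \<otimes>\<^bsub>?A\<^esub> (a \<oplus>\<^bsub>?A\<^esub> b) = c \<otimes>\<^bsub>?A\<^esub> a \<oplus>\<^bsub>?A\<^esub> c \<otimes>\<^bsub>?A\<^esub> b"
      using abc add_closed closed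
      by (intro group_algebra_eqI[where F = F and G = G])
        (auto simp: coef_mult lookup_add distrib_left sum.distrib)
  qed
qed

lemma (in comm_group) cring_group_algebra:
  fixes F :: "'f::field itself"
  assumes fin: "finite (carrier G)"
  shows "cring (group_algebra F G)"
proof -
  let ?A = "group_algebra F G"
  interpret ring ?A by (rule ring_group_algebra[OF fin])
  show ?thesis
  proof (unfold_locales)
    fix a b assume ab: "a \<in> carrier ?A" "b \<in> carrier ?A"
    show "a \<otimes>\<^bsub>?A\<^esub> b = b \<otimes>\<^bsub>?A\<^esub> a"
    proof (rule group_algebra_eqI[where F = F and G = G])
      fix z assume z: "z \<in> carrier G"
      have "(\<Sum>x\<in>carrier G. coef a x * coef b (inv x \<otimes> z)) = (\<Sum>x\<in>carrier G. coef b x * coef a (inv x \<otimes> z))"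
        using z by (intro sum.reindex_bij_witness[of _ "\<lambda>x. inv x \<otimes> z" "\<lambda>x. inv x \<otimes> z"])
          (auto simp: inv_mult m_ac inv_solve_left)
      then show "coef (a \<otimes>\<^bsub>?A\<^esub> b) z = coef (b \<otimes>\<^bsub>?A\<^esub> a) z"
        using coef_mult[OF fin ab(1) ab(2) z] coef_mult[OF fin ab(2) ab(1) z] by simp
    qed (use ab in auto)
  qed
qed

text \<open>The linear extension of a map on basis elements.\<close>

definition pushforward :: "('g \<Rightarrow> 'k) \<Rightarrow> ('g \<Rightarrow>\<^sub>0 'f::field) \<Rightarrow> ('k \<Rightarrow>\<^sub>0 'f)" where
  "pushforward f a = (\<Sum>x\<in>Poly_Mapping.keys a. Poly_Mapping.single (f x) (coef a x))"

lemma coef_pushforward: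
  assumes fin: "finite (carrier G)" and a: "a \<in> carrier (group_algebra F G)"
  shows "coef (pushforward f a) y = (\<Sum>x\<in>{x \<in> carrier G. f x = y}. coef a x)"
proof -
  have "coef (pushforward f a) y = (\<Sum>x\<in>Poly_Mapping.keys a. if f x = y then coef a x else 0)"
    by (auto simp: pushforward_def lookup_sum lookup_single when_def intro!: sum.cong)
  also have "\<dots> = (\<Sum>x\<in>carrier G. if f x = y then coef a x else 0)"
    using fin a by (intro sum.mono_neutral_left) (auto simp: group_algebra_def in_keys_iff)
  also have "\<dots> = (\<Sum>x\<in>{x \<in> carrier G. f x = y}. coef a x)"
    by (rule sum.inter_filter[OF fin, symmetric])
  finally show ?thesis .
qed

lemma pushforward_single: "pushforward f (Poly_Mapping.single x c) = Poly_Mapping.single (f x) c"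
  by (simp add: pushforward_def)

lemma (in group_hom) pushforward_closed:
  assumes "a \<in> carrier (group_algebra F G)"
  shows "pushforward h a \<in> carrier (group_algebra F H)"
  using assms
  by (auto simp: carrier_group_algebra pushforward_def lookup_sum lookup_single when_def in_keys_iff
      intro!: sum.neutral) (metis hom_closed)

lemma (in group_hom) pushforward_mult:
  fixes a b :: "'a \<Rightarrow>\<^sub>0 'f::field"
  assumes fin: "finite (carrier G)" "finite (carrier H)"
    and a: "a \<in> carrier (group_algebra F G)" and b: "b \<in> carrier (group_algebra F G)"
  shows "pushforward h (a \<otimes>\<^bsub>group_algebra F G\<^esub> b)
    = pushforward h a \<otimes>\<^bsub>group_algebra F H\<^esub> pushforward h b"
proof (rule group_algebra_eqI[where F = F and G = H])
  note ab = G.group_algebra_mult_closed[OF a b]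
  show "pushforward h (a \<otimes>\<^bsub>group_algebra F G\<^esub> b) \<in> carrier (group_algebra F H)"
    by (rule pushforward_closed[OF ab])
  show "pushforward h a \<otimes>\<^bsub>group_algebra F H\<^esub> pushforward h b \<in> carrier (group_algebra F H)"
    by (intro H.group_algebra_mult_closed pushforward_closed a b)
  fix y assume y: "y \<in> carrier H"
  have "coef (pushforward h (a \<otimes>\<^bsub>group_algebra F G\<^esub> b)) y
      = (\<Sum>z\<in>{z \<in> carrier G. h z = y}. \<Sum>x\<in>carrier G. coef a x * coef b (inv\<^bsub>G\<^esub> x \<otimes>\<^bsub>G\<^esub> z))"
    unfolding coef_pushforward[OF fin(1) ab] by (intro sum.cong) (auto simp: G.coef_mult[OF fin(1) a b])
  also have "\<dots> = (\<Sum>x\<in>carrier G. \<Sum>z\<in>{z \<in> carrier G. h z = y}. coef a x * coef b (inv\<^bsub>G\<^esub> x \<otimes>\<^bsub>G\<^esub> z))"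
    by (rule sum.swap)
  also have "\<dots> = (\<Sum>x\<in>carrier G. coef a x * coef (pushforward h b) (inv\<^bsub>H\<^esub> (h x) \<otimes>\<^bsub>H\<^esub> y))"
  proof (rule sum.cong[OF refl])
    fix x assume x: "x \<in> carrier G"
    have "(\<Sum>z\<in>{z \<in> carrier G. h z = y}. coef b (inv\<^bsub>G\<^esub> x \<otimes>\<^bsub>G\<^esub> z))
        = (\<Sum>w\<in>{w \<in> carrier G. h w = inv\<^bsub>H\<^esub> (h x) \<otimes>\<^bsub>H\<^esub> y}. coef b w)"
      using x y
      by (intro sum.reindex_bij_witness[of _ "\<lambda>w. x \<otimes>\<^bsub>G\<^esub> w" "\<lambda>z. inv\<^bsub>G\<^esub> x \<otimes>\<^bsub>G\<^esub> z"])
        (auto simp: G.m_assoc[symmetric] H.m_assoc[symmetric])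
    then show "(\<Sum>z\<in>{z \<in> carrier G. h z = y}. coef a x * coef b (inv\<^bsub>G\<^esub> x \<otimes>\<^bsub>G\<^esub> z))
        = coef a x * coef (pushforward h b) (inv\<^bsub>H\<^esub> (h x) \<otimes>\<^bsub>H\<^esub> y)"
      unfolding coef_pushforward[OF fin(1) b] by (simp only: sum_distrib_left[symmetric])
  qed
  also have "\<dots> = (\<Sum>u\<in>carrier H. \<Sum>x\<in>{x \<in> carrier G. h x = u}.
      coef a x * coef (pushforward h b) (inv\<^bsub>H\<^esub> (h x) \<otimes>\<^bsub>H\<^esub> y))"
    by (rule sum.group[symmetric]) (use fin in auto)
  also have "\<dots> = (\<Sum>u\<in>carrier H. coef (pushforward h a) u * coef (pushforward h b) (inv\<^bsub>H\<^esub> u \<otimes>\<^bsub>H\<^esub> y))"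
    unfolding coef_pushforward[OF fin(1) a] sum_distrib_right by (intro sum.cong) auto
  also have "\<dots> = coef (pushforward h a \<otimes>\<^bsub>group_algebra F H\<^esub> pushforward h b) y"
    by (rule H.coef_mult[OF fin(2) pushforward_closed[OF a] pushforward_closed[OF b] y, symmetric])
  finally show "coef (pushforward h (a \<otimes>\<^bsub>group_algebra F G\<^esub> b)) y
    = coef (pushforward h a \<otimes>\<^bsub>group_algebra F H\<^esub> pushforward h b) y" .
qed

lemma (in group) single_pow:
  fixes F :: "'f::field itself"
  assumes fin: "finite (carrier G)" and x: "x \<in> carrier G"
  shows "Poly_Mapping.single x c [^]\<^bsub>group_algebra F G\<^esub> (k::nat) = Poly_Mapping.single (x [^] k) (c ^ k)"
proof (induction k)
  case 0
  show ?case by (simp add: group_algebra_one)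
next
  case (Suc k)
  then show ?case using x by (simp add: single_mult_single mult.commute)
qed

lemma group_algebra_expansion:
  assumes "finite (carrier G)" and "a \<in> carrier (group_algebra F G)"
  shows "a = (\<Sum>x\<in>carrier G. Poly_Mapping.single x (coef a x))"
  using assms by (intro poly_mapping_eqI)
    (auto simp: lookup_sum lookup_single when_def carrier_group_algebra sum.delta)

text \<open>
  By the freshman's dream, \<open>(\<Sum>w. a\<^sub>w w)\<^bsup>q\<^esup> = (\<Sum>w. a\<^sub>w\<^bsup>q\<^esup> w\<^bsup>q\<^esup>)\<close> for \<open>q = p\<^sup>n\<close>; applying it
  once more, now in the field, collects the terms with the same \<open>w\<^bsup>q\<^esup>\<close>.
\<close>

lemma (in comm_group) coef_frobenius_power:
  fixes F :: "'f::field itself"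
  assumes fin: "finite (carrier G)" and p: "p = CHAR('f)" "p > 0"
    and a: "a \<in> carrier (group_algebra F G)"
  shows "coef (a [^]\<^bsub>group_algebra F G\<^esub> (p ^ n)) v
    = (\<Sum>w\<in>{w \<in> carrier G. w [^] (p ^ n) = v}. coef a w) ^ (p ^ n)"
proof -
  let ?A = "group_algebra F G"
  have prime: "Factorial_Ring.prime p" using p prime_CHAR_semidom by blast
  interpret A: cring ?A by (rule cring_group_algebra[OF fin])
  have "coef (add_pow ?A (k::nat) x) z = of_nat k * coef x z" for k x z
    by (induction k) (simp_all add: lookup_add algebra_simps)
  then have char: "add_pow ?A p x = \<zero>\<^bsub>?A\<^esub>" for x
    using p(1) by (intro poly_mapping_eqI) simp
  note frob = A.add_power_prime_char[OF prime char, of _ _ n, simplified]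
  have sum_closed: "(\<Sum>x\<in>S. Poly_Mapping.single x (coef a x)) \<in> carrier ?A" if "S \<subseteq> carrier G" for S
    using that by (auto simp: carrier_group_algebra lookup_sum lookup_single when_def intro!: sum.neutral)
  have pow_sum: "(\<Sum>x\<in>S. Poly_Mapping.single x (coef a x)) [^]\<^bsub>?A\<^esub> (p ^ n)
      = (\<Sum>x\<in>S. Poly_Mapping.single (x [^] (p ^ n)) (coef a x ^ (p ^ n)))"
    if "S \<subseteq> carrier G" for S
    using finite_subset[OF that fin] that
  proof (induction S rule: finite_induct)
    case empty
    have "0 [^]\<^bsub>?A\<^esub> (p ^ n) = (0 :: 'a \<Rightarrow>\<^sub>0 'f)"
      using A.nat_pow_zero[of "p ^ n"] p(2) by simp
    then show ?case by simp
  next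
    case (insert x S)
    then show ?case using sum_closed[of S] by (simp add: frob single_pow[OF fin])
  qed
  have "coef (a [^]\<^bsub>?A\<^esub> (p ^ n)) v
      = coef (\<Sum>x\<in>carrier G. Poly_Mapping.single (x [^] (p ^ n)) (coef a x ^ (p ^ n))) v"
    using pow_sum[OF subset_refl] group_algebra_expansion[OF fin a] by simp
  also have "\<dots> = (\<Sum>x\<in>carrier G. if x [^] (p ^ n) = v then coef a x ^ (p ^ n) else 0)"
    by (simp add: lookup_sum lookup_single when_def)
  also have "\<dots> = (\<Sum>w\<in>{w \<in> carrier G. w [^] (p ^ n) = v}. coef a w ^ (p ^ n))"
    by (rule sum.inter_filter[OF fin, symmetric])
  also have "\<dots> = (\<Sum>w\<in>{w \<in> carrier G. w [^] (p ^ n) = v}. coef a w) ^ (p ^ n)"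
    using prime p by (intro freshmans_dream_sum'[symmetric]) auto
  finally show ?thesis .
qed

section \<open>Central elements of group algebras\<close>

lemma (in group) coef_basis_mult:
  assumes fin: "finite (carrier G)" and y: "y \<in> carrier (group_algebra F G)"
    and g: "g \<in> carrier G" and z: "z \<in> carrier G"
  shows "coef (basis_element g \<otimes>\<^bsub>group_algebra F G\<^esub> y) z = coef y (inv g \<otimes> z)"
    and "coef (y \<otimes>\<^bsub>group_algebra F G\<^esub> basis_element g) z = coef y (z \<otimes> inv g)"
proof -
  have "(\<Sum>x\<in>carrier G. coef (basis_element g) x * coef y (inv x \<otimes> z))
      = (\<Sum>x\<in>carrier G. if x = g then coef y (inv g \<otimes> z) else 0)"
    by (intro sum.cong) (auto simp: lookup_single when_def)
  then show "coef (basis_element g \<otimes>\<^bsub>group_algebra F G\<^esub> y) z = coef y (inv g \<otimes> z)"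
    using fin g by (simp add: coef_mult[OF fin _ y z])
  have "(\<Sum>x\<in>carrier G. coef y x * coef (basis_element g) (inv x \<otimes> z))
      = (\<Sum>x\<in>carrier G. if x = z \<otimes> inv g then coef y (z \<otimes> inv g) else 0)"
  proof (intro sum.cong refl)
    fix x assume x: "x \<in> carrier G"
    have "g = inv x \<otimes> z \<longleftrightarrow> x = z \<otimes> inv g"
      using x g z by (metis inv_solve_left inv_solve_right)
    then show "coef y x * coef (basis_element g) (inv x \<otimes> z)
        = (if x = z \<otimes> inv g then coef y (z \<otimes> inv g) else 0)"
      by (auto simp: lookup_single when_def)
  qed
  then show "coef (y \<otimes>\<^bsub>group_algebra F G\<^esub> basis_element g) z = coef y (z \<otimes> inv g)"
    using fin g z by (simp add: coef_mult[OF fin y _ z])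
qed

lemma (in group) coef_central_class_function:
  assumes fin: "finite (carrier G)" and y: "y \<in> center (group_algebra F G)"
    and x: "x \<in> carrier G" and g: "g \<in> carrier G"
  shows "coef y (g \<otimes> x \<otimes> inv g) = coef y x"
proof -
  have y': "y \<in> carrier (group_algebra F G)"
    and "y \<otimes>\<^bsub>group_algebra F G\<^esub> basis_element g = basis_element g \<otimes>\<^bsub>group_algebra F G\<^esub> y"
    using y g by (auto simp: center_def)
  then have "coef y (g \<otimes> x \<otimes> inv g) = coef y (inv g \<otimes> (g \<otimes> x))"
    using coef_basis_mult[OF fin y' g, of "g \<otimes> x"] x g by simp
  then show ?thesis using x g by (simp add: m_assoc[symmetric])
qed

text \<open>
  The coefficient at a central element is a trace form: \<open>xy = z\<close> and \<open>yx = z\<close> are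
  equivalent when \<open>z\<close> is central.
\<close>

lemma (in group) coef_mult_commute_at_center:
  assumes fin: "finite (carrier G)" and a: "a \<in> carrier (group_algebra F G)"
    and b: "b \<in> carrier (group_algebra F G)" and z: "z \<in> center G"
  shows "coef (a \<otimes>\<^bsub>group_algebra F G\<^esub> b) z = coef (b \<otimes>\<^bsub>group_algebra F G\<^esub> a) z"
proof -
  have zG: "z \<in> carrier G" and comm: "\<And>x. x \<in> carrier G \<Longrightarrow> z \<otimes> x = x \<otimes> z"
    using z by (auto simp: center_def)
  have inv: "inv (inv x \<otimes> z) \<otimes> z = x" if x: "x \<in> carrier G" for x
  proof -
    have "inv (inv x \<otimes> z) \<otimes> z = inv z \<otimes> (x \<otimes> z)"
      using x zG by (simp add: inv_mult_group m_assoc)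
    also have "\<dots> = inv z \<otimes> (z \<otimes> x)" using comm[OF x] by simp
    also have "\<dots> = x" using x zG by (simp add: m_assoc[symmetric])
    finally show ?thesis .
  qed
  have "(\<Sum>x\<in>carrier G. coef a x * coef b (inv x \<otimes> z)) = (\<Sum>x\<in>carrier G. coef b x * coef a (inv x \<otimes> z))"
    using zG inv
    by (intro sum.reindex_bij_witness[of _ "\<lambda>x. inv x \<otimes> z" "\<lambda>x. inv x \<otimes> z"])
      (simp_all add: mult.commute)
  then show ?thesis
    by (simp add: coef_mult[OF fin a b zG] coef_mult[OF fin b a zG])
qed

lemma center_closed: "z \<in> center G \<Longrightarrow> z \<in> carrier G"
  and center_commute: "\<lbrakk>z \<in> center G; x \<in> carrier G\<rbrakk> \<Longrightarrow> z \<otimes>\<^bsub>G\<^esub> x = x \<otimes>\<^bsub>G\<^esub> z"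
  by (simp_all add: center_def)

lemma (in group) subgroup_center: "subgroup (center G) G"
proof (rule subgroupI)
  fix a assume a: "a \<in> center G"
  then show "inv a \<in> center G"
  proof -
    have "inv a \<otimes> x = x \<otimes> inv a" if x: "x \<in> carrier G" for x
    proof -
      have aG: "a \<in> carrier G" and "a \<otimes> x = x \<otimes> a" using a x by (auto simp: center_def)
      have "inv a \<otimes> x = inv a \<otimes> (x \<otimes> a) \<otimes> inv a" using aG x by (simp add: m_assoc)
      also have "\<dots> = inv a \<otimes> (a \<otimes> x) \<otimes> inv a" using \<open>a \<otimes> x = x \<otimes> a\<close> by simp
      also have "\<dots> = x \<otimes> inv a" using aG x by (simp add: m_assoc[symmetric])
      finally show ?thesis .
    qed
    moreover have "inv a \<in> carrier G" using a by (simp add: center_closed)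
    ultimately show ?thesis unfolding center_def by blast
  qed
next
  fix a b assume ab: "a \<in> center G" "b \<in> center G"
  have "a \<otimes> b \<otimes> x = x \<otimes> (a \<otimes> b)" if x: "x \<in> carrier G" for x
  proof -
    have G: "a \<in> carrier G" "b \<in> carrier G" and c: "a \<otimes> x = x \<otimes> a" "b \<otimes> x = x \<otimes> b"
      using ab x by (auto simp: center_def)
    have "a \<otimes> b \<otimes> x = a \<otimes> (b \<otimes> x)" using G x by (simp add: m_assoc)
    also have "\<dots> = a \<otimes> x \<otimes> b" using G x c(2) by (simp add: m_assoc)
    also have "\<dots> = x \<otimes> (a \<otimes> b)" using G x c(1) by (simp add: m_assoc)
    finally show ?thesis .
  qed
  moreover have "a \<otimes> b \<in> carrier G" using ab by (simp add: center_closed)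
  ultimately show "a \<otimes> b \<in> center G" unfolding center_def by blast
qed (auto simp: center_def)

lemma (in group) comm_group_center: "comm_group (G\<lparr>carrier := center G\<rparr>)"
proof (rule group.group_comm_groupI[OF subgroup_imp_group[OF subgroup_center]])
  fix x y assume "x \<in> carrier (G\<lparr>carrier := center G\<rparr>)" "y \<in> carrier (G\<lparr>carrier := center G\<rparr>)"
  then have "x \<otimes> y = y \<otimes> x" by (simp add: center_commute center_closed)
  then show "x \<otimes>\<^bsub>G\<lparr>carrier := center G\<rparr>\<^esub> y = y \<otimes>\<^bsub>G\<lparr>carrier := center G\<rparr>\<^esub> x" by simp
qed

text \<open>
  The restriction of the coefficients to the center of the group, seen as an element of the group
  algebra of the center.
\<close>

definition central_part :: "('g, 'm) monoid_scheme \<Rightarrow> ('g \<Rightarrow>\<^sub>0 'f::field) \<Rightarrow> ('g \<Rightarrow>\<^sub>0 'f)" where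
  "central_part G a = (\<Sum>x\<in>Poly_Mapping.keys a. if x \<in> center G then Poly_Mapping.single x (coef a x) else 0)"

lemma coef_central_part: "coef (central_part G a) x = (if x \<in> center G then coef a x else 0)"
proof -
  have "coef (central_part G a) x
      = (\<Sum>y\<in>Poly_Mapping.keys a. if y = x then (if x \<in> center G then coef a x else 0) else 0)"
    unfolding central_part_def lookup_sum
    by (intro sum.cong refl) (auto simp: lookup_single when_def)
  then show ?thesis by (simp add: in_keys_iff)
qed

lemma central_part_closed: "central_part G a \<in> carrier (group_algebra F (G\<lparr>carrier := center G\<rparr>))"
  by (auto simp: carrier_group_algebra coef_central_part)

text \<open>
  At a central \<open>z\<close> the coefficient of \<open>ab\<close> is the sum of \<open>a\<^sub>x b\<^bsub>y\<^esub>\<close> with \<open>y = x\<^sup>-\<^sup>1z\<close>. For central \<open>a\<close> and \<open>b\<close> this is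
  a class function of \<open>x\<close>, so only central \<open>x\<close> contribute.
\<close>

lemma (in group) central_part_mult:
  fixes F :: "'f::field itself"
  assumes ord: "order G = p ^ k" and p: "p = CHAR('f)" "p > 0"
    and a: "a \<in> center (group_algebra F G)" and b: "b \<in> center (group_algebra F G)"
  shows "central_part G (a \<otimes>\<^bsub>group_algebra F G\<^esub> b)
    = central_part G a \<otimes>\<^bsub>group_algebra F (G\<lparr>carrier := center G\<rparr>)\<^esub> central_part G b"
proof (rule group_algebra_eqI[where F = F])
  have fin: "finite (carrier G)"
    using ord p(2) order_gt_0_iff_finite by auto
  interpret Z: comm_group "G\<lparr>carrier := center G\<rparr>" by (rule comm_group_center)
  have finZ: "finite (carrier (G\<lparr>carrier := center G\<rparr>))"
    using fin by (auto simp: center_def)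
  show "central_part G (a \<otimes>\<^bsub>group_algebra F G\<^esub> b) \<in> carrier (group_algebra F (G\<lparr>carrier := center G\<rparr>))"
    by (rule central_part_closed)
  show "central_part G a \<otimes>\<^bsub>group_algebra F (G\<lparr>carrier := center G\<rparr>)\<^esub> central_part G b
      \<in> carrier (group_algebra F (G\<lparr>carrier := center G\<rparr>))"
    by (intro Z.group_algebra_mult_closed central_part_closed)
  fix z assume "z \<in> carrier (G\<lparr>carrier := center G\<rparr>)"
  then have z: "z \<in> center G" by simp
  then have zG: "z \<in> carrier G" by (simp add: center_def)
  have aA: "a \<in> carrier (group_algebra F G)" and bA: "b \<in> carrier (group_algebra F G)"
    using a b by (auto simp: center_def)
  have "coef (a \<otimes>\<^bsub>group_algebra F G\<^esub> b) z = (\<Sum>x\<in>carrier G. coef a x * coef b (inv x \<otimes> z))"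
    by (rule coef_mult[OF fin aA bA zG])
  also have "\<dots> = (\<Sum>x\<in>center G. coef a x * coef b (inv x \<otimes> z))"
  proof (rule sum_class_function[OF ord p])
    fix x g assume x: "x \<in> carrier G" and g: "g \<in> carrier G"
    have "inv (g \<otimes> x \<otimes> inv g) \<otimes> z = g \<otimes> inv x \<otimes> (inv g \<otimes> z)"
      using x g zG by (simp add: inv_mult_group m_assoc)
    also have "inv g \<otimes> z = z \<otimes> inv g"
      using z g by (simp add: center_def)
    finally have "inv (g \<otimes> x \<otimes> inv g) \<otimes> z = g \<otimes> (inv x \<otimes> z) \<otimes> inv g"
      using x g zG by (simp add: m_assoc)
    then show "coef a (g \<otimes> x \<otimes> inv g) * coef b (inv (g \<otimes> x \<otimes> inv g) \<otimes> z) = coef a x * coef b (inv x \<otimes> z)"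
      using coef_central_class_function[OF fin a x g]
        coef_central_class_function[OF fin b _ g, of "inv x \<otimes> z"] x zG by simp
  qed
  also have "\<dots> = (\<Sum>x\<in>center G. coef (central_part G a) x
      * coef (central_part G b) (inv\<^bsub>G\<lparr>carrier := center G\<rparr>\<^esub> x \<otimes> z))"
  proof (rule sum.cong[OF refl])
    fix x assume x: "x \<in> center G"
    then have "inv x \<otimes> z \<in> center G" "inv\<^bsub>G\<lparr>carrier := center G\<rparr>\<^esub> x = inv x"
      using z subgroup_center m_inv_consistent
      by (auto intro: subgroup.m_closed subgroup.m_inv_closed)
    then show "coef a x * coef b (inv x \<otimes> z) = coef (central_part G a) x
        * coef (central_part G b) (inv\<^bsub>G\<lparr>carrier := center G\<rparr>\<^esub> x \<otimes> z)"
      using x by (simp add: coef_central_part)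
  qed
  also have "\<dots> = coef (central_part G a \<otimes>\<^bsub>group_algebra F (G\<lparr>carrier := center G\<rparr>)\<^esub> central_part G b) z"
    using Z.coef_mult[OF finZ central_part_closed[of G a F] central_part_closed[of G b F], of z] z by simp
  finally show "coef (central_part G (a \<otimes>\<^bsub>group_algebra F G\<^esub> b)) z
    = coef (central_part G a \<otimes>\<^bsub>group_algebra F (G\<lparr>carrier := center G\<rparr>)\<^esub> central_part G b) z"
    using z by (simp add: coef_central_part)
qed

lemma (in group) pow_central:
  assumes "z \<in> center G"
  shows "z [^] (k::nat) \<in> center G"
  using assms subgroup_center by (induction k) (auto intro: subgroup.m_closed subgroup.one_closed)

lemma (in ring) pow_in_center:
  assumes "y \<in> center R"
  shows "y [^] (k::nat) \<in> center R"
proof (induction k)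
  case 0
  show ?case by (simp add: center_def)
next
  case (Suc k)
  have y: "y \<in> carrier R" "\<And>x. x \<in> carrier R \<Longrightarrow> y \<otimes> x = x \<otimes> y"
    and yk: "\<And>x. x \<in> carrier R \<Longrightarrow> y [^] k \<otimes> x = x \<otimes> y [^] k"
    using assms Suc by (auto simp: center_def)
  have "y [^] k \<otimes> y \<otimes> x = x \<otimes> (y [^] k \<otimes> y)" if x: "x \<in> carrier R" for x
  proof -
    have "y [^] k \<otimes> y \<otimes> x = y [^] k \<otimes> (x \<otimes> y)"
      using x y(1) by (simp add: m_assoc y(2)[OF x])
    also have "\<dots> = x \<otimes> (y [^] k \<otimes> y)"
      using x y(1) yk[OF x] by (simp add: m_assoc[symmetric])
    finally show ?thesis .
  qed
  moreover have "y [^] k \<otimes> y \<in> carrier R" using y(1) by simp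
  ultimately have "y [^] k \<otimes> y \<in> center R" unfolding center_def by blast
  then show ?case by simp
qed

lemma (in group) central_part_pow:
  fixes F :: "'f::field itself"
  assumes ord: "order G = p ^ k" and p: "p = CHAR('f)" "p > 0"
    and a: "a \<in> center (group_algebra F G)"
  shows "central_part G (a [^]\<^bsub>group_algebra F G\<^esub> j)
    = central_part G a [^]\<^bsub>group_algebra F (G\<lparr>carrier := center G\<rparr>)\<^esub> (j::nat)"
proof (induction j)
  case 0
  have "central_part G (basis_element \<one> :: 'a \<Rightarrow>\<^sub>0 'f) = basis_element \<one>"
    using subgroup.one_closed[OF subgroup_center]
    by (intro poly_mapping_eqI) (auto simp: coef_central_part lookup_single when_def)
  then show ?case by (simp add: group_algebra_one)
next
  case (Suc j)
  have fin: "finite (carrier G)"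
    using ord p(2) order_gt_0_iff_finite by auto
  interpret ring "group_algebra F G" by (rule ring_group_algebra[OF fin])
  show ?case using central_part_mult[OF ord p pow_in_center[OF a] a] Suc by simp
qed

section \<open>Normal subgroups with abelian quotient\<close>

text \<open>
  The subgroup \<open>\<gamma>(G) \<Omega>\<^sub>n(Z(G))\<^bsup>p^m\<^esup> G\<^bsup>p^k\<^esup>\<close>. The definition by generators
  reduces every inclusion into another subgroup to a check of three kinds of elements.
\<close>

definition mixed_power_subgroup :: "nat \<Rightarrow> nat \<Rightarrow> nat \<Rightarrow> nat \<Rightarrow> ('g, 'm) monoid_scheme \<Rightarrow> 'g set" where
  "mixed_power_subgroup p n m k G = generate G (derived G (carrier G)
     \<union> {z [^]\<^bsub>G\<^esub> (p ^ m) | z. z \<in> center G \<and> z [^]\<^bsub>G\<^esub> (p ^ n) = \<one>\<^bsub>G\<^esub>}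
     \<union> {x [^]\<^bsub>G\<^esub> (p ^ k) | x. x \<in> carrier G})"

lemma (in group) normal_if_derived_subset:
  assumes N: "subgroup N G" and "derived G (carrier G) \<subseteq> N"
  shows "N \<lhd> G"
proof (rule normal_invI[OF N])
  fix g h assume g: "g \<in> carrier G" and h: "h \<in> N"
  then have hG: "h \<in> carrier G" using N subgroup.mem_carrier by metis
  have "g \<otimes> h \<otimes> inv g \<otimes> inv h \<in> derived G (carrier G)"
    unfolding derived_def using g hG by (intro generate.incl) auto
  then have "g \<otimes> h \<otimes> inv g \<otimes> inv h \<otimes> h \<in> N"
    by (intro subgroup.m_closed[OF N] subsetD[OF assms(2)] h)
  moreover have "g \<otimes> h \<otimes> inv g \<otimes> inv h \<otimes> h = g \<otimes> h \<otimes> inv g"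
    using g hG by (simp add: m_assoc)
  ultimately show "g \<otimes> h \<otimes> inv g \<in> N" by simp
qed

lemma (in group) comm_group_factor_derived:
  assumes N: "subgroup N G" and der: "derived G (carrier G) \<subseteq> N"
  shows "comm_group (G Mod N)"
proof -
  interpret N: normal N G by (rule normal_if_derived_subset[OF assms])
  show ?thesis
  proof (rule group.group_comm_groupI[OF N.factorgroup_is_group])
    fix A B assume "A \<in> carrier (G Mod N)" "B \<in> carrier (G Mod N)"
    then obtain x y where x: "x \<in> carrier G" "A = N #> x" and y: "y \<in> carrier G" "B = N #> y"
      unfolding carrier_FactGroup by blast
    have "x \<otimes> y \<otimes> inv x \<otimes> inv y \<in> N"
      using der x y unfolding derived_def by (blast intro: generate.incl)
    then have "N #> (x \<otimes> y \<otimes> inv x \<otimes> inv y \<otimes> (y \<otimes> x)) = N #> (y \<otimes> x)"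
      using x y N.rcos_const[OF is_group]
      by (simp add: coset_mult_assoc[OF N.subset, symmetric] del: m_assoc)
    moreover have "x \<otimes> y \<otimes> inv x \<otimes> inv y \<otimes> (y \<otimes> x) = x \<otimes> y"
    proof -
      have "x \<otimes> y \<otimes> inv x \<otimes> inv y \<otimes> (y \<otimes> x) = x \<otimes> y \<otimes> inv x \<otimes> (inv y \<otimes> y) \<otimes> x"
        using x y by (simp only: m_assoc m_closed inv_closed)
      also have "\<dots> = x \<otimes> y \<otimes> (inv x \<otimes> x)" using x y by (simp add: m_assoc)
      finally show ?thesis using x y by simp
    qed
    ultimately show "A \<otimes>\<^bsub>G Mod N\<^esub> B = B \<otimes>\<^bsub>G Mod N\<^esub> A"
      using x y by (simp add: N.rcos_sum)
  qed
qed

lemma (in group) mixed_power_subgroup: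
  shows mixed_power_subgroup_subgroup: "subgroup (mixed_power_subgroup p n m k G) G"
    and derived_subset_mixed_power_subgroup: "derived G (carrier G) \<subseteq> mixed_power_subgroup p n m k G"
    and center_pow_in_mixed_power_subgroup:
      "\<lbrakk>z \<in> center G; z [^] (p ^ n) = \<one>\<rbrakk> \<Longrightarrow> z [^] (p ^ m) \<in> mixed_power_subgroup p n m k G"
    and pow_in_mixed_power_subgroup:
      "x \<in> carrier G \<Longrightarrow> x [^] (p ^ k) \<in> mixed_power_subgroup p n m k G"
proof -
  show "subgroup (mixed_power_subgroup p n m k G) G"
    unfolding mixed_power_subgroup_def
    using derived_in_carrier[of "carrier G"] center_closed[of _ G]
    by (intro generate_is_subgroup) auto
qed (auto simp: mixed_power_subgroup_def intro!: generate.incl)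

section \<open>Numbers preserved by isomorphisms of group algebras\<close>

lemma frobenius_inj:
  fixes x y :: "'f::field"
  assumes "p = CHAR('f)" "p > 0" "x ^ (p ^ n) = y ^ (p ^ n)"
  shows "x = y"
proof -
  have "Factorial_Ring.prime CHAR('f)" using assms prime_CHAR_semidom by blast
  then have "(x - y + y) ^ (p ^ n) = (x - y) ^ (p ^ n) + y ^ (p ^ n)"
    using assms(1) by (intro freshmans_dream') auto
  then show ?thesis using assms(3) by simp
qed

locale group_algebra_isomorphism = G: group G + H: group H
  for G :: "('g, 'm) monoid_scheme" (structure) and H :: "('h, 'n) monoid_scheme" (structure) +
  fixes p :: nat and h :: "('g \<Rightarrow>\<^sub>0 'f::field) \<Rightarrow> ('h \<Rightarrow>\<^sub>0 'f)"
  assumes p: "p = CHAR('f)" "p > 0"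
    and G: "finite_p_group p G" and H: "finite_p_group p H"
    and iso: "h \<in> algebra_iso (group_algebra TYPE('f) G) (group_algebra TYPE('f) H)"
begin

abbreviation "FG \<equiv> group_algebra TYPE('f) G"
abbreviation "FH \<equiv> group_algebra TYPE('f) H"

abbreviation u :: "'g \<Rightarrow> ('h \<Rightarrow>\<^sub>0 'f)" where "u g \<equiv> h (basis_element g)"

lemma finG: "finite (carrier G)" and finH: "finite (carrier H)"
  using G H by (auto simp: finite_p_group_def)

lemma h_ring_hom: "h \<in> ring_hom FG FH" and h_bij: "bij_betw h (carrier FG) (carrier FH)"
  using iso by (auto simp: algebra_iso_def ring_iso_def)

lemma h_closed: "a \<in> carrier FG \<Longrightarrow> h a \<in> carrier FH"
  by (rule ring_hom_closed[OF h_ring_hom])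

lemma u_closed: "g \<in> carrier G \<Longrightarrow> u g \<in> carrier FH"
  by (simp add: h_closed)

lemma u_one: "u \<one>\<^bsub>G\<^esub> = \<one>\<^bsub>FH\<^esub>"
  using ring_hom_one[OF h_ring_hom] by (simp add: group_algebra_one)

lemma u_mult: "\<lbrakk>x \<in> carrier G; y \<in> carrier G\<rbrakk> \<Longrightarrow> u (x \<otimes>\<^bsub>G\<^esub> y) = u x \<otimes>\<^bsub>FH\<^esub> u y"
  using ring_hom_mult[OF h_ring_hom, of "basis_element x" "basis_element y"]
  by (simp add: single_mult_single)

lemma u_pow: "x \<in> carrier G \<Longrightarrow> u (x [^]\<^bsub>G\<^esub> k) = u x [^]\<^bsub>FH\<^esub> (k::nat)"
  by (induction k) (simp_all add: u_one u_mult)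

lemma coef_h_expansion:
  assumes a: "a \<in> carrier FG"
  shows "coef (h a) w = (\<Sum>g\<in>carrier G. coef a g * coef (u g) w)"
proof -
  have "coef (h (\<Sum>g\<in>S. Poly_Mapping.single g (coef a g))) w = (\<Sum>g\<in>S. coef a g * coef (u g) w)"
    if "S \<subseteq> carrier G" for S
    using finite_subset[OF that finG] that
  proof (induction S rule: finite_induct)
    case empty
    interpret FG: ring FG by (rule G.ring_group_algebra[OF finG])
    interpret FH: ring FH by (rule H.ring_group_algebra[OF finH])
    have "h 0 = 0"
      using ring_hom_zero[OF h_ring_hom FG.ring_axioms FH.ring_axioms] by simp
    then show ?case by simp
  next
    case (insert x S)
    have sum: "(\<Sum>g\<in>S. Poly_Mapping.single g (coef a g)) \<in> carrier FG"
      using insert.prems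
      by (auto simp: carrier_group_algebra lookup_sum lookup_single when_def intro!: sum.neutral)
    have single: "Poly_Mapping.single x (coef a x) \<in> carrier FG"
      using insert.prems by simp
    have "Poly_Mapping.single x (coef a x) = coef a x \<odot>\<^bsub>FG\<^esub> basis_element x"
      by (intro poly_mapping_eqI) (simp add: coef_group_algebra_smult lookup_single when_def)
    then have "h (Poly_Mapping.single x (coef a x)) = coef a x \<odot>\<^bsub>FH\<^esub> u x"
      using iso insert.prems by (simp add: algebra_iso_def)
    then show ?case
      using insert ring_hom_add[OF h_ring_hom single sum]
      by (simp add: lookup_add coef_group_algebra_smult)
  qed
  from this[OF subset_refl] show ?thesis
    using group_algebra_expansion[OF finG a] by simp
qed

lemma basis_preimage:
  assumes "w \<in> carrier H"
  obtains a where "a \<in> carrier FG" "h a = basis_element w"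
proof -
  have "basis_element w \<in> h ` carrier FG"
    using assms bij_betw_imp_surj_on[OF h_bij] by simp
  then obtain a where "basis_element w = h a" "a \<in> carrier FG" by (rule imageE)
  then show ?thesis using that[of a] by simp
qed

lemma preimage_central:
  assumes a: "a \<in> carrier FG" and c: "h a \<in> center FH"
  shows "a \<in> center FG"
proof -
  have "a \<otimes>\<^bsub>FG\<^esub> b = b \<otimes>\<^bsub>FG\<^esub> a" if b: "b \<in> carrier FG" for b
  proof (rule inj_onD)
    show "inj_on h (carrier FG)" using h_bij by (rule bij_betw_imp_inj_on)
    show "h (a \<otimes>\<^bsub>FG\<^esub> b) = h (b \<otimes>\<^bsub>FG\<^esub> a)"
      using center_commute[OF c h_closed[OF b]] by (simp add: ring_hom_mult[OF h_ring_hom] a b)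
  qed (auto intro: G.group_algebra_mult_closed a b)
  then show ?thesis using a unfolding center_def by blast
qed

lemma u_central:
  assumes z: "z \<in> center G"
  shows "u z \<in> center FH"
proof -
  have zG: "z \<in> carrier G" using z by (rule center_closed)
  have central: "basis_element z \<otimes>\<^bsub>FG\<^esub> b = b \<otimes>\<^bsub>FG\<^esub> basis_element z" if b: "b \<in> carrier FG" for b
  proof (rule group_algebra_eqI[where F = "TYPE('f)" and G = G])
    fix x assume x: "x \<in> carrier G"
    have "inv\<^bsub>G\<^esub> z \<otimes>\<^bsub>G\<^esub> x = x \<otimes>\<^bsub>G\<^esub> inv\<^bsub>G\<^esub> z"
      using subgroup.m_inv_closed[OF G.subgroup_center z] x by (rule center_commute)
    then show "coef (basis_element z \<otimes>\<^bsub>FG\<^esub> b) x = coef (b \<otimes>\<^bsub>FG\<^esub> basis_element z) x"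
      by (simp add: G.coef_basis_mult[OF finG b zG x])
  qed (use zG b in \<open>auto intro: G.group_algebra_mult_closed\<close>)
  have "u z \<otimes>\<^bsub>FH\<^esub> c = c \<otimes>\<^bsub>FH\<^esub> u z" if "c \<in> carrier FH" for c
  proof -
    have "c \<in> h ` carrier FG"
      using that bij_betw_imp_surj_on[OF h_bij] by simp
    then obtain b where b: "c = h b" "b \<in> carrier FG" by (rule imageE)
    have zF: "basis_element z \<in> carrier FG" using zG by simp
    show ?thesis
      unfolding b(1) ring_hom_mult[OF h_ring_hom zF b(2), symmetric]
        ring_hom_mult[OF h_ring_hom b(2) zF, symmetric]
      by (rule arg_cong[OF central[OF b(2)]])
  qed
  then show ?thesis using u_closed[OF zG] unfolding center_def by blast
qed

text \<open>
  For central \<open>z\<close>, the Frobenius formula may be applied to the restriction of \<open>u z\<close> to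
  \<open>F[Z(H)]\<close>, because this restriction commutes with powers.
\<close>

lemma coef_u_central_power:
  assumes z: "z \<in> center G" and v: "v \<in> center H"
  shows "(\<Sum>w\<in>{w \<in> center H. w [^]\<^bsub>H\<^esub> (p ^ n) = v}. coef (u z) w) ^ (p ^ n)
    = coef (u (z [^]\<^bsub>G\<^esub> (p ^ n))) v"
proof -
  let ?Z = "H\<lparr>carrier := center H\<rparr>"
  interpret Z: comm_group ?Z by (rule H.comm_group_center)
  have finZ: "finite (carrier ?Z)"
    using finite_subset[OF _ finH, of "center H"] center_closed[of _ H] by auto
  obtain k where ord: "order H = p ^ k" using H by (auto simp: finite_p_group_def)
  have "coef (u (z [^]\<^bsub>G\<^esub> (p ^ n))) v = coef (central_part H (u z [^]\<^bsub>FH\<^esub> (p ^ n))) v"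
    using v center_closed[OF z] by (simp add: u_pow coef_central_part)
  also have "\<dots> = coef (central_part H (u z) [^]\<^bsub>group_algebra TYPE('f) ?Z\<^esub> (p ^ n)) v"
    by (simp add: H.central_part_pow[OF ord p u_central[OF z]])
  also have "\<dots> = (\<Sum>w\<in>{w \<in> carrier ?Z. w [^]\<^bsub>?Z\<^esub> (p ^ n) = v}. coef (central_part H (u z)) w) ^ (p ^ n)"
    by (rule Z.coef_frobenius_power[OF finZ p central_part_closed])
  also have "\<dots> = (\<Sum>w\<in>{w \<in> center H. w [^]\<^bsub>H\<^esub> (p ^ n) = v}. coef (u z) w) ^ (p ^ n)"
    by (auto simp: coef_central_part H.nat_pow_consistent[symmetric] intro!: arg_cong[of _ _ "\<lambda>x. x ^ _"] sum.cong)
  finally show ?thesis by simp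
qed

text \<open>
  Let \<open>\<theta>\<close> sum the central coefficients over the fibres of the \<open>p\<^sup>n\<close>-th power map of \<open>Z(H)\<close>. By
  \<open>coef_u_central_power\<close> and injectivity of the Frobenius map of the field, \<open>\<theta> (u z)\<close> only depends
  on \<open>z\<^bsup>p^n\<^esup>\<close>. A basis element of \<open>F[Z(H)]\<close> is the image of a central element of \<open>FG\<close>; there the
  trace property makes the summands class functions, so it is expanded in the \<open>u z\<close> with
  \<open>z \<in> Z(G)\<close> alone. Therefore the \<open>\<theta> (u z)\<close> span.
\<close>

lemma card_center_powers_le:
  "card ((\<lambda>w. w [^]\<^bsub>H\<^esub> (p ^ n)) ` center H) \<le> card ((\<lambda>z. z [^]\<^bsub>G\<^esub> (p ^ n)) ` center G)"
proof (rule card_le_spanning_functions)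
  let ?\<phi> = "\<lambda>z v. \<Sum>w\<in>{w \<in> center H. w [^]\<^bsub>H\<^esub> (p ^ n) = v}. coef (u z) w"
  have finZG: "finite (center G)" and finZH: "finite (center H)"
    using finite_subset[OF _ finG, of "center G"] finite_subset[OF _ finH, of "center H"]
      center_closed[of _ G] center_closed[of _ H] by auto
  then show "finite ((\<lambda>w. w [^]\<^bsub>H\<^esub> (p ^ n)) ` center H)" "finite (center G)" by auto
  fix v assume "v \<in> (\<lambda>w. w [^]\<^bsub>H\<^esub> (p ^ n)) ` center H"
  then obtain w0 where w0: "w0 \<in> center H" and v: "v = w0 [^]\<^bsub>H\<^esub> (p ^ n)" by blast
  then have vZ: "v \<in> center H" using H.pow_central by simp
  show "?\<phi> i v = ?\<phi> j v"
    if "i \<in> center G" "j \<in> center G" "i [^]\<^bsub>G\<^esub> (p ^ n) = j [^]\<^bsub>G\<^esub> (p ^ n)" for i j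
  proof (rule frobenius_inj[OF p])
    show "?\<phi> i v ^ (p ^ n) = ?\<phi> j v ^ (p ^ n)"
      by (simp only: coef_u_central_power[OF that(1) vZ] coef_u_central_power[OF that(2) vZ] that(3))
  qed
  obtain a where a: "a \<in> carrier FG" and ha: "h a = basis_element w0"
    using center_closed[OF w0] by (rule basis_preimage)
  have "basis_element w0 \<in> center FH"
  proof -
    have "basis_element w0 \<otimes>\<^bsub>FH\<^esub> c = c \<otimes>\<^bsub>FH\<^esub> basis_element w0" if c: "c \<in> carrier FH" for c
    proof (rule group_algebra_eqI[where F = "TYPE('f)" and G = H])
      fix x assume x: "x \<in> carrier H"
      have "inv\<^bsub>H\<^esub> w0 \<otimes>\<^bsub>H\<^esub> x = x \<otimes>\<^bsub>H\<^esub> inv\<^bsub>H\<^esub> w0"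
        using subgroup.m_inv_closed[OF H.subgroup_center w0] x by (rule center_commute)
      then show "coef (basis_element w0 \<otimes>\<^bsub>FH\<^esub> c) x = coef (c \<otimes>\<^bsub>FH\<^esub> basis_element w0) x"
        by (simp add: H.coef_basis_mult[OF finH c center_closed[OF w0] x])
    qed (use center_closed[OF w0] c in \<open>auto intro: H.group_algebra_mult_closed\<close>)
    then show ?thesis using center_closed[OF w0] unfolding center_def by auto
  qed
  then have ac: "a \<in> center FG" using preimage_central[OF a] ha by simp
  obtain k where ord: "order G = p ^ k" using G by (auto simp: finite_p_group_def)
  have expand: "coef (basis_element w0) w = (\<Sum>z\<in>center G. coef a z * coef (u z) w)" if w: "w \<in> center H" for w
  proof -
    have "coef (basis_element w0) w = (\<Sum>g\<in>carrier G. coef a g * coef (u g) w)"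
      using coef_h_expansion[OF a, of w] ha by simp
    also have "\<dots> = (\<Sum>z\<in>center G. coef a z * coef (u z) w)"
    proof (rule G.sum_class_function[OF ord p])
      fix x g assume x: "x \<in> carrier G" and g: "g \<in> carrier G"
      have "coef (u (g \<otimes>\<^bsub>G\<^esub> x \<otimes>\<^bsub>G\<^esub> inv\<^bsub>G\<^esub> g)) w = coef (u (g \<otimes>\<^bsub>G\<^esub> x) \<otimes>\<^bsub>FH\<^esub> u (inv\<^bsub>G\<^esub> g)) w"
        using x g by (simp add: u_mult)
      also have "\<dots> = coef (u (inv\<^bsub>G\<^esub> g) \<otimes>\<^bsub>FH\<^esub> u (g \<otimes>\<^bsub>G\<^esub> x)) w"
        using x g w by (intro H.coef_mult_commute_at_center[OF finH] u_closed) auto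
      also have "\<dots> = coef (u (inv\<^bsub>G\<^esub> g \<otimes>\<^bsub>G\<^esub> (g \<otimes>\<^bsub>G\<^esub> x))) w"
        using x g by (simp only: u_mult G.inv_closed G.m_closed)
      also have "\<dots> = coef (u x) w"
        using x g by (simp add: G.m_assoc[symmetric])
      finally show "coef a (g \<otimes>\<^bsub>G\<^esub> x \<otimes>\<^bsub>G\<^esub> inv\<^bsub>G\<^esub> g) * coef (u (g \<otimes>\<^bsub>G\<^esub> x \<otimes>\<^bsub>G\<^esub> inv\<^bsub>G\<^esub> g)) w = coef a x * coef (u x) w"
        using G.coef_central_class_function[OF finG ac x g] by simp
    qed
    finally show ?thesis .
  qed
  show "\<exists>c. \<forall>w\<in>(\<lambda>w. w [^]\<^bsub>H\<^esub> (p ^ n)) ` center H. of_bool (w = v) = (\<Sum>i\<in>center G. c i * ?\<phi> i w)"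
  proof (intro exI[of _ "coef a"] ballI)
    fix v'
    have "(\<Sum>z\<in>center G. coef a z * ?\<phi> z v')
        = (\<Sum>w\<in>{w \<in> center H. w [^]\<^bsub>H\<^esub> (p ^ n) = v'}. \<Sum>z\<in>center G. coef a z * coef (u z) w)"
      unfolding sum_distrib_left by (rule sum.swap)
    also have "\<dots> = (\<Sum>w\<in>{w \<in> center H. w [^]\<^bsub>H\<^esub> (p ^ n) = v'}. if w = w0 then 1 else 0)"
      by (intro sum.cong) (auto simp: expand[symmetric] lookup_single when_def)
    also have "\<dots> = of_bool (v' = v)"
      using finZH w0 v by (auto simp: sum.delta)
    finally show "of_bool (v' = v) = (\<Sum>z\<in>center G. coef a z * ?\<phi> z v')" by simp
  qed
qed

lemma card_carrier_le: "card (carrier H) \<le> card (carrier G)"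
proof -
  have "card (carrier H) \<le> card ((\<lambda>g. g) ` carrier G)"
  proof (rule card_le_spanning_functions[where \<phi> = "\<lambda>g. coef (u g)"])
    fix v assume "v \<in> carrier H"
    then obtain a where a: "a \<in> carrier FG" "h a = basis_element v"
      by (rule basis_preimage)
    then show "\<exists>c. \<forall>w\<in>carrier H. of_bool (w = v) = (\<Sum>g\<in>carrier G. c g * coef (u g) w)"
      by (intro exI[of _ "coef a"])
        (simp add: coef_h_expansion[OF a(1), symmetric] lookup_single when_def of_bool_def eq_commute)
  qed (auto simp: finG finH)
  then show ?thesis by simp
qed

text \<open>
  The map \<open>v\<close> below is the restriction to \<open>G\<close> of the algebra homomorphism from \<open>FG\<close> onto the
  commutative group algebra of \<open>H/N(n,m,k)\<close>, and \<open>T\<close> is its kernel, which is shown to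
  contain the generators of \<open>N(n,m,k)\<close> in \<open>G\<close>.
\<close>

lemma card_mixed_power_quotient_le:
  "card (carrier (H Mod mixed_power_subgroup p n m k H))
    \<le> card (carrier (G Mod mixed_power_subgroup p n m k G))"
proof -
  let ?N = "mixed_power_subgroup p n m k H"
  let ?K = "H Mod ?N"
  let ?FK = "group_algebra TYPE('f) ?K"
  interpret N: normal ?N H
    by (rule H.normal_if_derived_subset[OF H.mixed_power_subgroup_subgroup H.derived_subset_mixed_power_subgroup])
  interpret K: comm_group ?K
    by (rule H.comm_group_factor_derived[OF H.mixed_power_subgroup_subgroup H.derived_subset_mixed_power_subgroup])
  define q where "q = (\<lambda>x. ?N #>\<^bsub>H\<^esub> x)"
  interpret q: group_hom H ?K q
    unfolding q_def by unfold_locales (rule N.r_coset_hom_Mod)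
  have q_onto: "carrier ?K = q ` carrier H"
    unfolding q_def by (rule carrier_FactGroup)
  have finK: "finite (carrier ?K)" unfolding q_onto using finH by simp
  interpret FK: cring ?FK by (rule K.cring_group_algebra[OF finK])
  have q_one: "q x = \<one>\<^bsub>?K\<^esub>" if "x \<in> ?N" for x
    unfolding q_def using that N.rcos_const[OF H.is_group] by simp
  have q_pow: "q (x [^]\<^bsub>H\<^esub> (j::nat)) = q x [^]\<^bsub>?K\<^esub> j" if "x \<in> carrier H" for x j
    using that by (rule q.hom_nat_pow)
  define v where "v g = pushforward q (u g)" for g
  have v_closed: "v g \<in> carrier ?FK" if "g \<in> carrier G" for g
    unfolding v_def using u_closed[OF that] by (rule q.pushforward_closed)
  have v_mult: "v (x \<otimes>\<^bsub>G\<^esub> y) = v x \<otimes>\<^bsub>?FK\<^esub> v y" if "x \<in> carrier G" "y \<in> carrier G" for x y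
    unfolding v_def using that by (simp add: u_mult q.pushforward_mult[OF finH finK] u_closed)
  have v_one: "v \<one>\<^bsub>G\<^esub> = \<one>\<^bsub>?FK\<^esub>"
    unfolding v_def u_one by (simp only: group_algebra_one pushforward_single q.hom_one)
  have v_pow: "v (x [^]\<^bsub>G\<^esub> j) = v x [^]\<^bsub>?FK\<^esub> (j::nat)" if "x \<in> carrier G" for x j
    using that by (induction j) (simp_all add: v_one v_mult)
  define T where "T = {g \<in> carrier G. v g = \<one>\<^bsub>?FK\<^esub>}"
  have T_inv: "inv\<^bsub>G\<^esub> g \<in> T" if "g \<in> T" for g
  proof -
    have g: "g \<in> carrier G" "v g = \<one>\<^bsub>?FK\<^esub>" using that by (auto simp: T_def)
    have "v (inv\<^bsub>G\<^esub> g) = v (inv\<^bsub>G\<^esub> g) \<otimes>\<^bsub>?FK\<^esub> v g"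
      using g v_closed by simp
    also have "\<dots> = \<one>\<^bsub>?FK\<^esub>"
      using g v_mult[of "inv\<^bsub>G\<^esub> g" g] by (simp add: v_one)
    finally show ?thesis using g by (simp add: T_def)
  qed
  have T: "subgroup T G"
  proof (rule G.subgroupI)
    show "T \<noteq> {}" using v_one unfolding T_def by blast
  qed (auto simp: T_inv, auto simp: T_def v_mult)
  have T_derived: "derived G (carrier G) \<subseteq> T"
    unfolding derived_def
  proof (rule G.generate_subgroup_incl[OF _ T], safe)
    fix x y assume x: "x \<in> carrier G" and y: "y \<in> carrier G"
    have "v (x \<otimes>\<^bsub>G\<^esub> y \<otimes>\<^bsub>G\<^esub> inv\<^bsub>G\<^esub> x \<otimes>\<^bsub>G\<^esub> inv\<^bsub>G\<^esub> y)
        = v x \<otimes>\<^bsub>?FK\<^esub> v y \<otimes>\<^bsub>?FK\<^esub> v (inv\<^bsub>G\<^esub> x) \<otimes>\<^bsub>?FK\<^esub> v (inv\<^bsub>G\<^esub> y)"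
      using x y by (simp add: v_mult)
    also have "\<dots> = (v x \<otimes>\<^bsub>?FK\<^esub> v (inv\<^bsub>G\<^esub> x)) \<otimes>\<^bsub>?FK\<^esub> (v y \<otimes>\<^bsub>?FK\<^esub> v (inv\<^bsub>G\<^esub> y))"
      using x y v_closed by (simp add: FK.m_ac)
    also have "\<dots> = \<one>\<^bsub>?FK\<^esub>"
    proof -
      have "v g \<otimes>\<^bsub>?FK\<^esub> v (inv\<^bsub>G\<^esub> g) = \<one>\<^bsub>?FK\<^esub>" if "g \<in> carrier G" for g
        using that v_one by (simp add: v_mult[symmetric])
      then show ?thesis using x y by simp
    qed
    finally show "x \<otimes>\<^bsub>G\<^esub> y \<otimes>\<^bsub>G\<^esub> inv\<^bsub>G\<^esub> x \<otimes>\<^bsub>G\<^esub> inv\<^bsub>G\<^esub> y \<in> T"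
      using x y by (simp add: T_def)
  qed
  obtain e where e: "order G = p ^ e" using G by (auto simp: finite_p_group_def)
  obtain f where f: "order H = p ^ f" using H by (auto simp: finite_p_group_def)
  have T_powers: "x [^]\<^bsub>G\<^esub> (p ^ k) \<in> T" if x: "x \<in> carrier G" for x
  proof -
    have expK: "w [^]\<^bsub>?K\<^esub> (p ^ (e + f)) = \<one>\<^bsub>?K\<^esub>" "w [^]\<^bsub>?K\<^esub> (p ^ k) = \<one>\<^bsub>?K\<^esub>" if "w \<in> carrier ?K" for w
    proof -
      have "w \<in> q ` carrier H" using that unfolding q_onto .
      then obtain y where "w = q y" "y \<in> carrier H" by (rule imageE)
      then have y: "y \<in> carrier H" "w = q y" by simp_all
      have "y [^]\<^bsub>H\<^esub> (p ^ (f + e)) = \<one>\<^bsub>H\<^esub>"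
        using H.pow_order_eq_1[OF y(1)] y(1) by (simp add: f power_add H.nat_pow_pow[symmetric])
      then show "w [^]\<^bsub>?K\<^esub> (p ^ (e + f)) = \<one>\<^bsub>?K\<^esub>"
        using y q_pow[OF y(1), of "p ^ (f + e)"] by (simp only: add.commute q.hom_one)
      show "w [^]\<^bsub>?K\<^esub> (p ^ k) = \<one>\<^bsub>?K\<^esub>"
        using y q_pow[OF y(1), of "p ^ k"] q_one[OF H.pow_in_mixed_power_subgroup[OF y(1)]] by simp
    qed
    have "x [^]\<^bsub>G\<^esub> (p ^ (e + f)) = \<one>\<^bsub>G\<^esub>"
      using G.pow_order_eq_1[OF x] x by (simp add: e power_add G.nat_pow_pow[symmetric])
    \<comment> \<open>The exponent \<open>p\<^bsup>e+f\<^esup>\<close> kills both \<open>G\<close> and \<open>H\<close>; the corresponding Frobenius power of \<open>v x\<close>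
      is the power of its augmentation.\<close>
    then have "v x [^]\<^bsub>?FK\<^esub> (p ^ (e + f)) = \<one>\<^bsub>?FK\<^esub>"
      using v_pow[OF x, of "p ^ (e + f)"] v_one by simp
    then have "(\<Sum>w\<in>{w \<in> carrier ?K. w [^]\<^bsub>?K\<^esub> (p ^ (e + f)) = \<one>\<^bsub>?K\<^esub>}. coef (v x) w) ^ (p ^ (e + f))
        = coef \<one>\<^bsub>?FK\<^esub> \<one>\<^bsub>?K\<^esub>"
      using K.coef_frobenius_power[OF finK p v_closed[OF x], of "e + f" "\<one>\<^bsub>?K\<^esub>"] by simp
    moreover have "{w \<in> carrier ?K. w [^]\<^bsub>?K\<^esub> (p ^ (e + f)) = \<one>\<^bsub>?K\<^esub>} = carrier ?K"
      using expK(1) by blast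
    ultimately have "(\<Sum>w\<in>carrier ?K. coef (v x) w) ^ (p ^ (e + f)) = 1 ^ (p ^ (e + f))"
      by (simp only: group_algebra_one lookup_single_eq power_one)
    then have aug: "(\<Sum>w\<in>carrier ?K. coef (v x) w) = 1"
      by (rule frobenius_inj[OF p])
    have "v x [^]\<^bsub>?FK\<^esub> (p ^ k) = \<one>\<^bsub>?FK\<^esub>"
    proof (rule poly_mapping_eqI)
      fix c
      have "coef (v x [^]\<^bsub>?FK\<^esub> (p ^ k)) c
          = (\<Sum>w\<in>{w \<in> carrier ?K. w [^]\<^bsub>?K\<^esub> (p ^ k) = c}. coef (v x) w) ^ (p ^ k)"
        by (rule K.coef_frobenius_power[OF finK p v_closed[OF x]])
      also have "{w \<in> carrier ?K. w [^]\<^bsub>?K\<^esub> (p ^ k) = c} = (if c = \<one>\<^bsub>?K\<^esub> then carrier ?K else {})"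
        using expK(2) by auto
      also have "(\<Sum>w\<in>\<dots>. coef (v x) w) ^ (p ^ k) = coef \<one>\<^bsub>?FK\<^esub> c"
        unfolding group_algebra_one using aug p(2) by (auto simp: lookup_single when_def)
      finally show "coef (v x [^]\<^bsub>?FK\<^esub> (p ^ k)) c = coef \<one>\<^bsub>?FK\<^esub> c" .
    qed
    then show ?thesis using x by (simp add: T_def v_pow)
  qed
  have T_central: "z [^]\<^bsub>G\<^esub> (p ^ m) \<in> T" if z: "z \<in> center G" and zn: "z [^]\<^bsub>G\<^esub> (p ^ n) = \<one>\<^bsub>G\<^esub>" for z
  proof -
    have zG: "z \<in> carrier G" using z by (rule center_closed)
    have finZ: "finite (center H)"
      using finite_subset[OF _ finH, of "center H"] center_closed[of _ H] by auto
    \<comment> \<open>Since \<open>z\<^bsup>p^n\<^esup> = 1\<close>, the central coefficients of \<open>u z\<close> look like those of the identity after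
      summation over the fibres of the \<open>p\<^sup>n\<close>-th power map. These fibres are the cosets of
      \<open>\<Omega>\<^sub>n(Z(H))\<close>, on which \<open>x \<mapsto> q x\<^bsup>p^m\<^esup>\<close> is constant.\<close>
    have fibre_sum: "(\<Sum>w\<in>{w \<in> center H. w [^]\<^bsub>H\<^esub> (p ^ n) = c}. coef (u z) w) = of_bool (c = \<one>\<^bsub>H\<^esub>)"
      if "c \<in> center H" for c
    proof (rule frobenius_inj[OF p])
      show "(\<Sum>w\<in>{w \<in> center H. w [^]\<^bsub>H\<^esub> (p ^ n) = c}. coef (u z) w) ^ (p ^ n) = of_bool (c = \<one>\<^bsub>H\<^esub>) ^ (p ^ n)"
        using coef_u_central_power[OF z that, of n] p(2)
        by (auto simp: zn u_one group_algebra_one lookup_single when_def)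
    qed
    have "v z [^]\<^bsub>?FK\<^esub> (p ^ m) = \<one>\<^bsub>?FK\<^esub>"
    proof (rule group_algebra_eqI[where F = "TYPE('f)" and G = ?K])
      show "v z [^]\<^bsub>?FK\<^esub> (p ^ m) \<in> carrier ?FK" using v_closed[OF zG] by simp
      show "\<one>\<^bsub>?FK\<^esub> \<in> carrier ?FK" by simp
      fix c
      let ?P = "\<lambda>x. q x [^]\<^bsub>?K\<^esub> (p ^ m) = c"
      let ?rep = "inv_into (center H) (\<lambda>w. w [^]\<^bsub>H\<^esub> (p ^ n))"
      have P_fibre: "?P x \<longleftrightarrow> ?P y"
        if "x \<in> center H" "y \<in> center H" "x [^]\<^bsub>H\<^esub> (p ^ n) = y [^]\<^bsub>H\<^esub> (p ^ n)" for x y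
      proof -
        have xy: "x \<in> carrier H" "y \<in> carrier H" using that(1,2)[THEN center_closed] .
        define t where "t = x \<otimes>\<^bsub>H\<^esub> inv\<^bsub>H\<^esub> y"
        have t: "t \<in> center H"
          unfolding t_def using that(1,2) H.subgroup_center
          by (intro subgroup.m_closed subgroup.m_inv_closed) auto
        then have tH: "t \<in> carrier H" by (rule center_closed)
        have x: "x = t \<otimes>\<^bsub>H\<^esub> y" unfolding t_def using xy by (simp add: H.m_assoc)
        have pow: "x [^]\<^bsub>H\<^esub> (j::nat) = t [^]\<^bsub>H\<^esub> j \<otimes>\<^bsub>H\<^esub> y [^]\<^bsub>H\<^esub> j" for j
          unfolding x using center_commute[OF t xy(2)] tH xy(2) by (rule H.pow_mult_distrib)
        have "t [^]\<^bsub>H\<^esub> (p ^ n) = \<one>\<^bsub>H\<^esub>"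
          using pow[of "p ^ n"] that(3) tH xy by simp
        then have qt: "q (t [^]\<^bsub>H\<^esub> (p ^ m)) = \<one>\<^bsub>?K\<^esub>"
          using t by (intro q_one H.center_pow_in_mixed_power_subgroup)
        have "q (x [^]\<^bsub>H\<^esub> (p ^ m)) = \<one>\<^bsub>?K\<^esub> \<otimes>\<^bsub>?K\<^esub> q (y [^]\<^bsub>H\<^esub> (p ^ m))"
          unfolding pow qt[symmetric] using tH xy by (intro q.hom_mult H.nat_pow_closed)
        also have "\<dots> = q (y [^]\<^bsub>H\<^esub> (p ^ m))"
          using xy by (intro K.l_one q.hom_closed H.nat_pow_closed)
        finally have "q (x [^]\<^bsub>H\<^esub> (p ^ m)) = q (y [^]\<^bsub>H\<^esub> (p ^ m))" .
        then show ?thesis using xy by (simp only: q_pow)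
      qed
      have "(\<Sum>d\<in>{d \<in> carrier ?K. d [^]\<^bsub>?K\<^esub> (p ^ m) = c}. coef (v z) d)
          = (\<Sum>d\<in>{d \<in> carrier ?K. d [^]\<^bsub>?K\<^esub> (p ^ m) = c}. \<Sum>x\<in>{x \<in> carrier H. q x = d}. if ?P x then coef (u z) x else 0)"
        unfolding v_def coef_pushforward[OF finH u_closed[OF zG]] by (intro sum.cong refl) auto
      also have "\<dots> = (\<Sum>d\<in>carrier ?K. \<Sum>x\<in>{x \<in> carrier H. q x = d}. if ?P x then coef (u z) x else 0)"
        using finK by (intro sum.mono_neutral_left) (auto intro!: sum.neutral)
      also have "\<dots> = (\<Sum>x\<in>carrier H. if ?P x then coef (u z) x else 0)"
        by (rule sum.group) (use finH finK in auto)
      also have "\<dots> = (\<Sum>x\<in>center H. if ?P x then coef (u z) x else 0)"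
      proof (rule H.sum_class_function[OF f p])
        fix x g assume x: "x \<in> carrier H" and g: "g \<in> carrier H"
        have "q (g \<otimes>\<^bsub>H\<^esub> x \<otimes>\<^bsub>H\<^esub> inv\<^bsub>H\<^esub> g) = q g \<otimes>\<^bsub>?K\<^esub> q x \<otimes>\<^bsub>?K\<^esub> inv\<^bsub>?K\<^esub> q g"
          using x g by (simp del: mult_FactGroup)
        also have "\<dots> = q x"
          using q.hom_closed[OF x] q.hom_closed[OF g] K.m_comm[of "q g" "q x"] by (simp add: K.m_assoc del: mult_FactGroup one_FactGroup)
        finally show "(if ?P (g \<otimes>\<^bsub>H\<^esub> x \<otimes>\<^bsub>H\<^esub> inv\<^bsub>H\<^esub> g) then coef (u z) (g \<otimes>\<^bsub>H\<^esub> x \<otimes>\<^bsub>H\<^esub> inv\<^bsub>H\<^esub> g) else 0)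
            = (if ?P x then coef (u z) x else 0)"
          using H.coef_central_class_function[OF finH u_central[OF z] x g] by simp
      qed
      also have "\<dots> = (\<Sum>y\<in>(\<lambda>w. w [^]\<^bsub>H\<^esub> (p ^ n)) ` center H.
          \<Sum>x\<in>{x \<in> center H. x [^]\<^bsub>H\<^esub> (p ^ n) = y}. if ?P x then coef (u z) x else 0)"
        by (rule sum.image_gen[OF finZ])
      also have "\<dots> = (\<Sum>y\<in>(\<lambda>w. w [^]\<^bsub>H\<^esub> (p ^ n)) ` center H. if y = \<one>\<^bsub>H\<^esub> then of_bool (?P \<one>\<^bsub>H\<^esub>) else 0)"
      proof (rule sum.cong[OF refl])
        fix y assume "y \<in> (\<lambda>w. w [^]\<^bsub>H\<^esub> (p ^ n)) ` center H"
        then obtain x0 where x0: "x0 \<in> center H" "y = x0 [^]\<^bsub>H\<^esub> (p ^ n)" by blast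
        have y: "y \<in> center H" using x0 H.pow_central by simp
        have "(\<Sum>x\<in>{x \<in> center H. x [^]\<^bsub>H\<^esub> (p ^ n) = y}. if ?P x then coef (u z) x else 0)
            = (\<Sum>x\<in>{x \<in> center H. x [^]\<^bsub>H\<^esub> (p ^ n) = y}. if ?P x0 then coef (u z) x else 0)"
          using P_fibre[OF _ x0(1)] x0(2) by (intro sum.cong refl) auto
        also have "\<dots> = (if ?P x0 then of_bool (y = \<one>\<^bsub>H\<^esub>) else 0)"
          using fibre_sum[OF y] by auto
        also have "\<dots> = (if y = \<one>\<^bsub>H\<^esub> then of_bool (?P \<one>\<^bsub>H\<^esub>) else 0)"
          using P_fibre[OF x0(1) subgroup.one_closed[OF H.subgroup_center]] x0(2) by auto
        finally show "(\<Sum>x\<in>{x \<in> center H. x [^]\<^bsub>H\<^esub> (p ^ n) = y}. if ?P x then coef (u z) x else 0)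
            = (if y = \<one>\<^bsub>H\<^esub> then of_bool (?P \<one>\<^bsub>H\<^esub>) else 0)" .
      qed
      also have "\<dots> = of_bool (?P \<one>\<^bsub>H\<^esub>)"
      proof -
        have "\<one>\<^bsub>H\<^esub> \<in> (\<lambda>w. w [^]\<^bsub>H\<^esub> (p ^ n)) ` center H"
          using subgroup.one_closed[OF H.subgroup_center] by (intro image_eqI[of _ _ "\<one>\<^bsub>H\<^esub>"]) auto
        then show ?thesis using finZ by (simp add: sum.delta)
      qed
      also have "\<dots> = of_bool (c = \<one>\<^bsub>?K\<^esub>)"
        by (simp only: q.hom_one K.nat_pow_one eq_commute)
      finally have "(\<Sum>d\<in>{d \<in> carrier ?K. d [^]\<^bsub>?K\<^esub> (p ^ m) = c}. coef (v z) d) = of_bool (c = \<one>\<^bsub>?K\<^esub>)" .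
      then show "coef (v z [^]\<^bsub>?FK\<^esub> (p ^ m)) c = coef \<one>\<^bsub>?FK\<^esub> c"
        unfolding K.coef_frobenius_power[OF finK p v_closed[OF zG]] group_algebra_one
        using p(2) by (auto simp: lookup_single when_def)
    qed
    then show ?thesis using zG by (simp add: T_def v_pow)
  qed
  let ?M = "mixed_power_subgroup p n m k G"
  have M: "subgroup ?M G" by (rule G.mixed_power_subgroup_subgroup)
  have MT: "?M \<subseteq> T"
    unfolding mixed_power_subgroup_def
    using T_derived T_powers T_central by (intro G.generate_subgroup_incl[OF _ T]) auto
  have "card (carrier ?K) \<le> card ((\<lambda>g. ?M #>\<^bsub>G\<^esub> g) ` carrier G)"
  proof (rule card_le_spanning_functions[where \<phi> = "\<lambda>g. coef (v g)"])
    fix i j w assume i: "i \<in> carrier G" and j: "j \<in> carrier G" and "?M #>\<^bsub>G\<^esub> i = ?M #>\<^bsub>G\<^esub> j"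
    then have "i \<in> ?M #>\<^bsub>G\<^esub> j"
      using G.rcos_self[OF i M] by simp
    then obtain t where t: "t \<in> ?M" "i = t \<otimes>\<^bsub>G\<^esub> j" unfolding r_coset_def by blast
    then have tG: "t \<in> carrier G" and "v t = \<one>\<^bsub>?FK\<^esub>" using MT by (auto simp: T_def)
    then show "coef (v i) w = coef (v j) w"
      using v_mult[OF tG j] v_closed[OF j] t by simp
  next
    fix d assume "d \<in> carrier ?K"
    then have "d \<in> q ` carrier H" unfolding q_onto .
    then obtain y where "d = q y" "y \<in> carrier H" by (rule imageE)
    then have y: "y \<in> carrier H" "d = q y" by simp_all
    obtain a where a: "a \<in> carrier FG" and ha: "h a = basis_element y"
      using y(1) by (rule basis_preimage)
    show "\<exists>c. \<forall>w\<in>carrier ?K. of_bool (w = d) = (\<Sum>g\<in>carrier G. c g * coef (v g) w)"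
    proof (intro exI[of _ "coef a"] ballI)
      fix w
      have "of_bool (w = d) = coef (pushforward q (h a)) w"
        unfolding ha pushforward_single by (auto simp: y lookup_single when_def)
      also have "\<dots> = (\<Sum>x\<in>{x \<in> carrier H. q x = w}. \<Sum>g\<in>carrier G. coef a g * coef (u g) x)"
        by (simp only: coef_pushforward[OF finH h_closed[OF a]] coef_h_expansion[OF a])
      also have "\<dots> = (\<Sum>g\<in>carrier G. \<Sum>x\<in>{x \<in> carrier H. q x = w}. coef a g * coef (u g) x)"
        by (rule sum.swap)
      also have "\<dots> = (\<Sum>g\<in>carrier G. coef a g * coef (v g) w)"
        unfolding v_def by (intro sum.cong refl) (simp add: coef_pushforward[OF finH u_closed] sum_distrib_left)
      finally show "of_bool (w = d) = (\<Sum>g\<in>carrier G. coef a g * coef (v g) w)" .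
    qed
  qed (auto simp: finG finK)
  then show ?thesis by (simp add: carrier_FactGroup)
qed

end

section \<open>Classification of finite abelian \<open>p\<close>-groups by torsion\<close>

definition pow_kernel :: "nat \<Rightarrow> ('g, 'm) monoid_scheme \<Rightarrow> 'g set" where
  "pow_kernel q A = {x \<in> carrier A. x [^]\<^bsub>A\<^esub> q = \<one>\<^bsub>A\<^esub>}"

lemma card_pow_kernel_iso:
  assumes "group A" "group B" and "A \<cong> B"
  shows "card (pow_kernel q A) = card (pow_kernel q B)"
proof -
  obtain f where f: "f \<in> iso A B" using assms(3) by (auto simp: is_iso_def)
  interpret f: group_hom A B f
    using assms f by (simp add: group_hom_def group_hom_axioms_def iso_def)
  have bij: "bij_betw f (carrier A) (carrier B)" using f by (simp add: iso_def)
  have "f ` pow_kernel q A = pow_kernel q B"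
  proof safe
    fix x assume "x \<in> pow_kernel q A"
    then show "f x \<in> pow_kernel q B"
      by (auto simp: pow_kernel_def simp flip: f.hom_nat_pow)
  next
    fix y assume y: "y \<in> pow_kernel q B"
    then have "y \<in> f ` carrier A"
      using bij_betw_imp_surj_on[OF bij] by (simp add: pow_kernel_def)
    then obtain x where x: "y = f x" "x \<in> carrier A" by (rule imageE)
    have "f (x [^]\<^bsub>A\<^esub> q) = f \<one>\<^bsub>A\<^esub>"
      using x y by (simp add: pow_kernel_def f.hom_nat_pow)
    then have "x [^]\<^bsub>A\<^esub> q = \<one>\<^bsub>A\<^esub>"
      using inj_onD[OF bij_betw_imp_inj_on[OF bij]] x(2) by simp
    then show "y \<in> f ` pow_kernel q A" using x by (simp add: pow_kernel_def)
  qed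
  moreover have "inj_on f (pow_kernel q A)"
    using bij_betw_imp_inj_on[OF bij] by (rule inj_on_subset) (auto simp: pow_kernel_def)
  ultimately show ?thesis by (metis card_image)
qed

lemma iso_cyclic_subgroups:
  assumes "group A" "group B" and a: "a \<in> carrier A" and b: "b \<in> carrier B"
    and ord: "group.ord A a = group.ord B b"
  shows "A\<lparr>carrier := generate A {a}\<rparr> \<cong> B\<lparr>carrier := generate B {b}\<rparr>"
proof -
  interpret A: group A by fact
  interpret B: group B by fact
  define f where "f x = b [^]\<^bsub>B\<^esub> (SOME k::int. x = a [^]\<^bsub>A\<^esub> k)" for x
  have f: "f (a [^]\<^bsub>A\<^esub> k) = b [^]\<^bsub>B\<^esub> k" for k :: int
  proof -
    have "a [^]\<^bsub>A\<^esub> k = a [^]\<^bsub>A\<^esub> (SOME j::int. a [^]\<^bsub>A\<^esub> k = a [^]\<^bsub>A\<^esub> j)"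
      by (rule someI[of "\<lambda>j. a [^]\<^bsub>A\<^esub> k = a [^]\<^bsub>A\<^esub> j" k]) simp
    then show ?thesis
      unfolding f_def A.int_pow_eq[OF a] B.int_pow_eq[OF b] ord by (simp add: dvd_diff_commute)
  qed
  have gen: "generate A {a} = range (\<lambda>k::int. a [^]\<^bsub>A\<^esub> k)" "generate B {b} = range (\<lambda>k::int. b [^]\<^bsub>B\<^esub> k)"
    unfolding A.generate_pow[OF a] B.generate_pow[OF b] by auto
  have "f \<in> iso (A\<lparr>carrier := generate A {a}\<rparr>) (B\<lparr>carrier := generate B {b}\<rparr>)"
  proof (rule isoI)
    show "f \<in> hom (A\<lparr>carrier := generate A {a}\<rparr>) (B\<lparr>carrier := generate B {b}\<rparr>)"
      by (auto simp: hom_def gen f A.int_pow_mult[OF a, symmetric] B.int_pow_mult[OF b, symmetric])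
    show "bij_betw f (carrier (A\<lparr>carrier := generate A {a}\<rparr>)) (carrier (B\<lparr>carrier := generate B {b}\<rparr>))"
      by (auto simp: bij_betw_def inj_on_def gen f A.int_pow_eq[OF a] B.int_pow_eq[OF b] ord image_image)
  qed
  then show ?thesis by (rule is_isoI)
qed

lemma (in comm_group) comm_group_subgroup:
  assumes H: "subgroup H G"
  shows "comm_group (G\<lparr>carrier := H\<rparr>)"
  by (rule group.group_comm_groupI[OF subgroup_imp_group[OF H]])
    (use subgroup.mem_carrier[OF H] m_comm in simp)

text \<open>
  A cyclic subgroup of maximal order splits off: take \<open>C\<close> maximal among the subgroups that meet
  \<open>\<langle>a\<rangle>\<close> trivially. If \<open>C\<langle>a\<rangle>\<close> were a proper subgroup, there would be \<open>y\<close> outside of it with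
  \<open>y\<^sup>p\<close> inside. Changing \<open>y\<close> by a power of \<open>a\<close> one gets \<open>z\<close> with \<open>z\<^sup>p \<in> C\<close>, and then \<open>C\<langle>z\<rangle>\<close> still
  meets \<open>\<langle>a\<rangle>\<close> trivially, against the maximality of \<open>C\<close>.
\<close>

lemma (in comm_group) cyclic_subgroup_complement:
  assumes ord: "order G = p ^ k" and p: "Factorial_Ring.prime p"
    and a: "a \<in> carrier G" and ord_a: "ord a = p ^ Suc e"
    and exponent: "\<And>x. x \<in> carrier G \<Longrightarrow> x [^] (p ^ Suc e) = \<one>"
  obtains C where "subgroup C G" "C \<inter> generate G {a} = {\<one>}" "C <#> generate G {a} = carrier G"
proof -
  let ?P = "generate G {a}"
  have fin: "finite (carrier G)"
    using ord prime_gt_0_nat[OF p] order_gt_0_iff_finite by auto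
  have P: "subgroup ?P G" using a by (intro generate_is_subgroup) simp
  let ?F = "{C. subgroup C G \<and> C \<inter> ?P = {\<one>}}"
  have "?F \<subseteq> Pow (carrier G)" using subgroup.subset by blast
  then have "finite ?F" using fin finite_subset by blast
  moreover have "{\<one>} \<in> ?F"
    using subgroup.one_closed[OF P] triv_subgroup by auto
  then have "?F \<noteq> {}" by (metis empty_iff)
  ultimately have "\<exists>C\<in>?F. \<forall>D\<in>?F. C \<subseteq> D \<longrightarrow> C = D"
    by (rule finite_has_maximal)
  then obtain C where C: "C \<in> ?F" and maximal: "\<forall>D\<in>?F. C \<subseteq> D \<longrightarrow> C = D"
    by (elim bexE)
  have C: "subgroup C G" and CP: "C \<inter> ?P = {\<one>}" using C by auto
  let ?S = "C <#> ?P"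
  have S: "subgroup ?S G" by (rule mult_subgroups[OF C P])
  have CS: "C \<subseteq> ?S"
  proof
    fix c assume c: "c \<in> C"
    then have "c = c \<otimes> \<one>" using subgroup.mem_carrier[OF C] by simp
    then show "c \<in> ?S" using c subgroup.one_closed[OF P] unfolding set_mult_def by blast
  qed
  have PS: "?P \<subseteq> ?S"
  proof
    fix s assume s: "s \<in> ?P"
    then have "s = \<one> \<otimes> s" using subgroup.mem_carrier[OF P] by simp
    then show "s \<in> ?S" using s subgroup.one_closed[OF C] unfolding set_mult_def by blast
  qed
  have pow_mem: "x [^] (j::nat) \<in> D" if "subgroup D G" "x \<in> D" for D x j
    using subgroup_int_pow_closed[OF that, of "int j"] by (simp add: int_pow_int)
  have "?S = carrier G"
  proof (rule ccontr)
    assume "?S \<noteq> carrier G"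
    then obtain x where x: "x \<in> carrier G" "x \<notin> ?S" using subgroup.subset[OF S] by blast
    have "x [^] (p ^ Suc e) \<in> ?S" using exponent[OF x(1)] subgroup.one_closed[OF S] by simp
    then obtain j where j: "x [^] (p ^ j) \<in> ?S" and least: "\<And>i. i < j \<Longrightarrow> x [^] (p ^ i) \<notin> ?S"
      using exists_least_iff[of "\<lambda>i. x [^] (p ^ i) \<in> ?S"] by blast
    have "j \<noteq> 0" using j x by (intro notI) simp
    then obtain i where i: "j = Suc i" using not0_implies_Suc by blast
    define y where "y = x [^] (p ^ i)"
    have y: "y \<in> carrier G" "y \<notin> ?S" using x(1) least[of i] i by (auto simp: y_def)
    have "y [^] p \<in> ?S" using j x(1) unfolding i y_def by (simp add: nat_pow_pow mult.commute)
    then obtain c s where c: "c \<in> C" and s: "s \<in> ?P" and yp: "y [^] p = c \<otimes> s"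
      unfolding set_mult_def by blast
    have cG: "c \<in> carrier G" and sG: "s \<in> carrier G"
      using subgroup.mem_carrier[OF C c] subgroup.mem_carrier[OF P s] .
    obtain r where r: "s = a [^] (r::nat)"
      using s unfolding generate_pow_on_finite_carrier[OF fin a] by blast
    \<comment> \<open>The order of \<open>a\<close> being maximal, \<open>s\<close> is a \<open>p\<close>-th power in the cyclic group.\<close>
    have "c [^] (p ^ e) \<otimes> s [^] (p ^ e) = (y [^] p) [^] (p ^ e)"
      unfolding yp using cG sG by (simp add: nat_pow_distrib)
    also have "\<dots> = \<one>" using exponent[OF y(1)] y(1) by (simp add: nat_pow_pow)
    finally have "s [^] (p ^ e) = inv (c [^] (p ^ e))"
      using cG sG by (intro inv_equality[symmetric]) (simp_all add: m_comm)
    then have "s [^] (p ^ e) \<in> C"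
      using subgroup.m_inv_closed[OF C pow_mem[OF C c]] by simp
    then have "s [^] (p ^ e) \<in> C \<inter> ?P"
      using pow_mem[OF P s] by (rule IntI)
    then have "a [^] (r * p ^ e) = \<one>" unfolding CP r using a by (simp add: nat_pow_pow)
    then have "p ^ Suc e dvd r * p ^ e" using pow_eq_id[OF a] ord_a by simp
    then have "p dvd r" using prime_gt_0_nat[OF p] by simp
    then obtain t where t: "r = p * t" by blast
    define z where "z = y \<otimes> inv (a [^] t)"
    have aP: "a [^] t \<in> ?P" by (rule pow_mem[OF P]) (simp add: generate.incl)
    have atG: "a [^] t \<in> carrier G" using a by simp
    have z: "z \<in> carrier G" using y atG by (simp add: z_def)
    have "z \<notin> ?S"
    proof
      assume "z \<in> ?S"
      then have "z \<otimes> a [^] t \<in> ?S" using subgroup.m_closed[OF S] aP PS by blast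
      then show False using y atG by (simp add: z_def m_assoc)
    qed
    have "z [^] p = y [^] p \<otimes> inv (a [^] (t * p))"
      unfolding z_def using y atG a by (simp add: nat_pow_distrib nat_pow_inv nat_pow_pow)
    also have "a [^] (t * p) = s" unfolding r t by (simp add: mult.commute)
    also have "y [^] p \<otimes> inv s = c" unfolding yp using cG sG by (simp add: m_assoc)
    finally have zp: "z [^] p = c" .
    let ?D = "C <#> generate G {z}"
    have gz: "subgroup (generate G {z}) G" using z by (intro generate_is_subgroup) simp
    have D: "subgroup ?D G" by (rule mult_subgroups[OF C gz])
    have "w = \<one>" if w: "w \<in> ?D" "w \<in> ?P" for w
    proof -
      obtain d u where d: "d \<in> C" and u: "u \<in> generate G {z}" and wdu: "w = d \<otimes> u"
        using w(1) unfolding set_mult_def by blast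
      obtain i where i: "u = z [^] (i::nat)"
        using u unfolding generate_pow_on_finite_carrier[OF fin z] by blast
      have dG: "d \<in> carrier G" and uG: "u \<in> carrier G"
        using subgroup.mem_carrier[OF C d] subgroup.mem_carrier[OF gz u] .
      show ?thesis
      proof (cases "p dvd i")
        case True
        then obtain l where "i = p * l" by blast
        then have "u = c [^] l" unfolding i zp[symmetric] using z by (simp add: nat_pow_pow)
        then have "w \<in> C" unfolding wdu using subgroup.m_closed[OF C d] pow_mem[OF C c] by simp
        then show ?thesis using w(2) CP by blast
      next
        case False
        then have "i \<noteq> 0" by (intro notI) simp
        moreover have "gcd i p = 1"
          using prime_imp_coprime[OF p False] by (simp add: coprime_iff_gcd_eq_1 gcd.commute)
        ultimately obtain g h where gh: "i * g = p * h + 1"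
          using bezout_nat[of i p] by auto
        have "u = inv d \<otimes> w" unfolding wdu using dG uG by (simp add: m_assoc[symmetric])
        then have "u \<in> ?S"
          using subgroup.m_closed[OF S] subgroup.m_inv_closed[OF S] CS PS d w(2) by blast
        then have 1: "u [^] g \<in> ?S" by (rule pow_mem[OF S])
        have "z [^] p \<in> ?S" using zp c CS by blast
        then have 2: "(z [^] p) [^] h \<in> ?S" by (rule pow_mem[OF S])
        have "u [^] g = (z [^] p) [^] h \<otimes> z"
          unfolding i using z by (simp only: nat_pow_pow gh nat_pow_mult[symmetric] nat_pow_eone)
        then have "z = inv ((z [^] p) [^] h) \<otimes> u [^] g"
          using z by (simp add: m_assoc[symmetric])
        then have "z \<in> ?S"
          using subgroup.m_closed[OF S subgroup.m_inv_closed[OF S 2] 1] by simp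
        then show ?thesis using \<open>z \<notin> ?S\<close> by simp
      qed
    qed
    then have "?D \<inter> ?P = {\<one>}"
      using subgroup.one_closed[OF D] subgroup.one_closed[OF P] by blast
    moreover have CD: "C \<subseteq> ?D"
    proof
      fix d assume d: "d \<in> C"
      then have "d = d \<otimes> \<one>" using subgroup.mem_carrier[OF C] by simp
      then show "d \<in> ?D" using d subgroup.one_closed[OF gz] unfolding set_mult_def by blast
    qed
    ultimately have "C = ?D" using maximal D by blast
    moreover have "\<one> \<otimes> z \<in> ?D"
      using subgroup.one_closed[OF C] generate.incl[of z "{z}" G] unfolding set_mult_def by blast
    ultimately show False using CS z \<open>z \<notin> ?S\<close> by auto
  qed
  then show ?thesis using that C CP by blast
qed

lemma (in comm_group) iso_complement_product:
  assumes C: "subgroup C G" and P: "subgroup P G" and "C \<inter> P = {\<one>}" "C <#> P = carrier G"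
  shows "G\<lparr>carrier := C\<rparr> \<times>\<times> G\<lparr>carrier := P\<rparr> \<cong> G"
proof -
  interpret group_disjoint_sum G C P
    by (intro group_disjoint_sum.intro is_group C P)
  have eq: "subgroup_generated G D = G\<lparr>carrier := D\<rparr>" if D: "subgroup D G" for D
  proof -
    have "carrier G \<inter> D = D" using subgroup.subset[OF D] by blast
    moreover have "generate G D = D"
      using generate_subgroup_incl[OF subset_refl D] generate.incl[of _ D G] by blast
    ultimately show ?thesis by (simp add: subgroup_generated_def)
  qed
  have "(\<lambda>(x,y). x \<otimes> y) \<in> iso (subgroup_generated G C \<times>\<times> subgroup_generated G P) G"
    using iso_group_mul[OF comm_group_axioms] assms by simp
  then show ?thesis unfolding eq[OF C] eq[OF P] by (rule is_isoI)
qed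

lemma card_pow_kernel_DirProd:
  "card (pow_kernel q (A \<times>\<times> B)) = card (pow_kernel q A) * card (pow_kernel q B)"
proof -
  have "(x, y) [^]\<^bsub>A \<times>\<times> B\<^esub> j = (x [^]\<^bsub>A\<^esub> j, y [^]\<^bsub>B\<^esub> j)" for x y and j :: nat
    by (induction j) (simp_all add: nat_pow_def)
  then have "pow_kernel q (A \<times>\<times> B) = pow_kernel q A \<times> pow_kernel q B"
    by (auto simp: pow_kernel_def)
  then show ?thesis by (simp add: card_cartesian_product)
qed

lemma exponent_element:
  fixes G (structure)
  assumes "group G" and ord: "order G = p ^ k" and p: "Factorial_Ring.prime p" and nontriv: "order G \<noteq> 1"
  obtains e a where "a \<in> carrier G" "group.ord G a = p ^ Suc e"
    "\<And>x. x \<in> carrier G \<Longrightarrow> x [^]\<^bsub>G\<^esub> (p ^ Suc e) = \<one>\<^bsub>G\<^esub>"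
proof -
  interpret group G by fact
  have "\<forall>x\<in>carrier G. x [^] (p ^ k) = \<one>" using pow_order_eq_1 ord by simp
  then obtain j where j: "\<forall>x\<in>carrier G. x [^] (p ^ j) = \<one>"
      and least: "\<And>i. i < j \<Longrightarrow> \<not> (\<forall>x\<in>carrier G. x [^] (p ^ i) = \<one>)"
    using exists_least_iff[of "\<lambda>j. \<forall>x\<in>carrier G. x [^] (p ^ j) = \<one>"] by blast
  have "j \<noteq> 0"
  proof
    assume "j = 0"
    then have "carrier G = {\<one>}" using j by auto
    then show False using nontriv by (simp add: order_def)
  qed
  then obtain e where e: "j = Suc e" using not0_implies_Suc by blast
  obtain a where a: "a \<in> carrier G" "a [^] (p ^ e) \<noteq> \<one>" using least[of e] e by auto
  have "ord a dvd p ^ Suc e" using j a e pow_eq_id by blast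
  then obtain i where i: "i \<le> Suc e" "ord a = p ^ i"
    using divides_primepow_nat[OF p] by blast
  have "\<not> i \<le> e" using a pow_eq_id[OF a(1), of "p ^ e"] i(2) le_imp_power_dvd by metis
  then have "ord a = p ^ Suc e" using i by (simp add: le_Suc_eq)
  then show ?thesis using that a(1) j e by blast
qed

text \<open>
  The numbers determine the order and the exponent. Splitting off cyclic subgroups of maximal order
  from both groups divides corresponding numbers by the same factor, and the complements
  are isomorphic by induction.
\<close>

theorem comm_p_group_iso_if_card_pow_kernel_eq:
  fixes A :: "('a, 'm) monoid_scheme" and B :: "('b, 'n) monoid_scheme"
  assumes "comm_group A" "comm_group B" and "order A = p ^ k" "order B = p ^ l"
    and p: "Factorial_Ring.prime p"
    and "\<And>m. card (pow_kernel (p ^ m) A) = card (pow_kernel (p ^ m) B)"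
  shows "A \<cong> B"
  using assms(1-4,6)
proof (induction "order A" arbitrary: A B k l rule: less_induct)
  case less
  interpret A: comm_group A by (rule less.prems)
  interpret B: comm_group B by (rule less.prems)
  note ordA = less.prems(3) and ordB = less.prems(4) and cards = less.prems(5)
  have fin: "finite (carrier A)" "finite (carrier B)"
    using ordA ordB prime_gt_0_nat[OF p] A.order_gt_0_iff_finite B.order_gt_0_iff_finite by auto
  have full: "pow_kernel (p ^ (k + l)) A = carrier A" "pow_kernel (p ^ (k + l)) B = carrier B"
  proof -
    have "x [^]\<^bsub>A\<^esub> (p ^ (k + l)) = \<one>\<^bsub>A\<^esub>" if "x \<in> carrier A" for x
      using A.pow_order_eq_1[OF that] that by (simp add: ordA power_add A.nat_pow_pow[symmetric])
    then show "pow_kernel (p ^ (k + l)) A = carrier A" by (auto simp: pow_kernel_def)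
    have "x [^]\<^bsub>B\<^esub> (p ^ (l + k)) = \<one>\<^bsub>B\<^esub>" if "x \<in> carrier B" for x
      using B.pow_order_eq_1[OF that] that by (simp add: ordB power_add B.nat_pow_pow[symmetric])
    then show "pow_kernel (p ^ (k + l)) B = carrier B" by (auto simp: pow_kernel_def add.commute)
  qed
  then have same: "card (carrier A) = card (carrier B)" using cards[of "k + l"] by simp
  have full_iff: "(\<forall>x\<in>carrier A. x [^]\<^bsub>A\<^esub> (p ^ e) = \<one>\<^bsub>A\<^esub>) \<longleftrightarrow> (\<forall>x\<in>carrier B. x [^]\<^bsub>B\<^esub> (p ^ e) = \<one>\<^bsub>B\<^esub>)" for e
  proof -
    have "(\<forall>x\<in>carrier A. x [^]\<^bsub>A\<^esub> (p ^ e) = \<one>\<^bsub>A\<^esub>) \<longleftrightarrow> pow_kernel (p ^ e) A = carrier A"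
      by (auto simp: pow_kernel_def)
    also have "\<dots> \<longleftrightarrow> card (pow_kernel (p ^ e) A) = card (carrier A)"
      using card_subset_eq[OF fin(1), of "pow_kernel (p ^ e) A"] by (auto simp: pow_kernel_def)
    also have "\<dots> \<longleftrightarrow> card (pow_kernel (p ^ e) B) = card (carrier B)"
      using cards same by simp
    also have "\<dots> \<longleftrightarrow> pow_kernel (p ^ e) B = carrier B"
      using card_subset_eq[OF fin(2), of "pow_kernel (p ^ e) B"] by (auto simp: pow_kernel_def)
    also have "\<dots> \<longleftrightarrow> (\<forall>x\<in>carrier B. x [^]\<^bsub>B\<^esub> (p ^ e) = \<one>\<^bsub>B\<^esub>)"
      by (auto simp: pow_kernel_def)
    finally show ?thesis .
  qed
  show ?case
  proof (cases "order A = 1")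
    case True
    then have "carrier A = {\<one>\<^bsub>A\<^esub>}" "carrier B = {\<one>\<^bsub>B\<^esub>}"
      using same A.order_one_triv_iff B.order_one_triv_iff by (simp_all add: order_def)
    then have "(\<lambda>x. \<one>\<^bsub>B\<^esub>) \<in> iso A B" by (auto simp: iso_def hom_def bij_betw_def)
    then show ?thesis by (rule is_isoI)
  next
    case False
    then have False': "order B \<noteq> 1" using same by (simp add: order_def)
    obtain e a where a: "a \<in> carrier A" "A.ord a = p ^ Suc e"
        and expA: "\<And>x. x \<in> carrier A \<Longrightarrow> x [^]\<^bsub>A\<^esub> (p ^ Suc e) = \<one>\<^bsub>A\<^esub>"
      by (rule exponent_element[OF A.is_group ordA p False]) (rule that)
    obtain f b where b: "b \<in> carrier B" "B.ord b = p ^ Suc f"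
        and expB: "\<And>x. x \<in> carrier B \<Longrightarrow> x [^]\<^bsub>B\<^esub> (p ^ Suc f) = \<one>\<^bsub>B\<^esub>"
      by (rule exponent_element[OF B.is_group ordB p False']) (rule that)
    have "\<forall>x\<in>carrier A. x [^]\<^bsub>A\<^esub> (p ^ Suc f) = \<one>\<^bsub>A\<^esub>"
      unfolding full_iff by (intro ballI expB)
    then have "A.ord a dvd p ^ Suc f"
      unfolding A.pow_eq_id[OF a(1), symmetric] by (rule bspec[OF _ a(1)])
    moreover have "\<forall>x\<in>carrier B. x [^]\<^bsub>B\<^esub> (p ^ Suc e) = \<one>\<^bsub>B\<^esub>"
      unfolding full_iff[symmetric] by (intro ballI expA)
    then have "B.ord b dvd p ^ Suc e"
      unfolding B.pow_eq_id[OF b(1), symmetric] by (rule bspec[OF _ b(1)])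
    ultimately have "p ^ Suc e dvd p ^ Suc f" "p ^ Suc f dvd p ^ Suc e"
      by (simp_all only: a(2) b(2))
    then have pef: "p ^ Suc e = p ^ Suc f" by (rule dvd_antisym)
    let ?P = "generate A {a}" and ?Q = "generate B {b}"
    obtain C where C: "subgroup C A" "C \<inter> ?P = {\<one>\<^bsub>A\<^esub>}" "C <#>\<^bsub>A\<^esub> ?P = carrier A"
      by (rule A.cyclic_subgroup_complement[OF ordA p a expA])
    obtain D where D: "subgroup D B" "D \<inter> ?Q = {\<one>\<^bsub>B\<^esub>}" "D <#>\<^bsub>B\<^esub> ?Q = carrier B"
      by (rule B.cyclic_subgroup_complement[OF ordB p b expB])
    have P: "subgroup ?P A" and Q: "subgroup ?Q B"
      using a b A.generate_is_subgroup[of "{a}"] B.generate_is_subgroup[of "{b}"] by auto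
    let ?AC = "A\<lparr>carrier := C\<rparr>" and ?AP = "A\<lparr>carrier := ?P\<rparr>"
      and ?BD = "B\<lparr>carrier := D\<rparr>" and ?BQ = "B\<lparr>carrier := ?Q\<rparr>"
    have groups: "group ?AC" "group ?AP" "group ?BD" "group ?BQ"
      using A.subgroup_imp_group B.subgroup_imp_group C(1) D(1) P Q by auto
    have isoA: "?AC \<times>\<times> ?AP \<cong> A" by (rule A.iso_complement_product[OF C(1) P C(2,3)])
    have isoB: "?BD \<times>\<times> ?BQ \<cong> B" by (rule B.iso_complement_product[OF D(1) Q D(2,3)])
    have isoPQ: "?AP \<cong> ?BQ"
      using a b pef by (intro iso_cyclic_subgroups A.is_group B.is_group) simp_all
    have "card C * card ?P = card (carrier A)"
      using iso_same_card[OF isoA] by (simp add: card_cartesian_product)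
    moreover have cardP: "card ?P = p ^ Suc e"
      using A.generate_pow_card[OF a(1)] a(2) by simp
    ultimately have cardC: "card C * p ^ Suc e = card (carrier A)" by simp
    have "card C > 0"
      using finite_subset[OF subgroup.subset[OF C(1)] fin(1)] subgroup.one_closed[OF C(1)] card_gt_0_iff by blast
    moreover have "p ^ Suc e > 1" using prime_gt_1_nat[OF p] by (rule one_less_power) simp
    ultimately have smaller: "card C < card (carrier A)"
      unfolding cardC[symmetric] by simp
    have "card C dvd p ^ k" using cardC ordA unfolding order_def by (metis dvd_triv_left)
    then obtain k' where k': "card C = p ^ k'" using divides_primepow_nat[OF p] by blast
    have "card D * card ?Q = card (carrier B)"
      using iso_same_card[OF isoB] by (simp add: card_cartesian_product)
    then have "card D dvd p ^ l" using ordB unfolding order_def by (metis dvd_triv_left)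
    then obtain l' where l': "card D = p ^ l'" using divides_primepow_nat[OF p] by blast
    have cards': "card (pow_kernel (p ^ m) ?AC) = card (pow_kernel (p ^ m) ?BD)" for m
    proof -
      have "card (pow_kernel (p ^ m) ?AC) * card (pow_kernel (p ^ m) ?AP) = card (pow_kernel (p ^ m) A)"
        unfolding card_pow_kernel_DirProd[symmetric]
        by (intro card_pow_kernel_iso DirProd_group groups A.is_group isoA)
      also have "\<dots> = card (pow_kernel (p ^ m) B)" by (rule cards)
      also have "\<dots> = card (pow_kernel (p ^ m) ?BD) * card (pow_kernel (p ^ m) ?BQ)"
        unfolding card_pow_kernel_DirProd[symmetric]
        by (intro card_pow_kernel_iso[symmetric] DirProd_group groups B.is_group isoB)
      also have "card (pow_kernel (p ^ m) ?BQ) = card (pow_kernel (p ^ m) ?AP)"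
        by (intro card_pow_kernel_iso[symmetric] groups isoPQ)
      finally have "card (pow_kernel (p ^ m) ?AC) * card (pow_kernel (p ^ m) ?AP)
          = card (pow_kernel (p ^ m) ?BD) * card (pow_kernel (p ^ m) ?AP)" .
      moreover have "card (pow_kernel (p ^ m) ?AP) > 0"
      proof -
        have "\<one>\<^bsub>A\<^esub> \<in> pow_kernel (p ^ m) ?AP"
          using subgroup.one_closed[OF P] by (simp add: pow_kernel_def A.nat_pow_consistent[symmetric])
        moreover have "finite (pow_kernel (p ^ m) ?AP)"
          using finite_subset[OF subgroup.subset[OF P] fin(1)] by (simp add: pow_kernel_def)
        ultimately show ?thesis using card_gt_0_iff by blast
      qed
      ultimately show ?thesis by simp
    qed
    have "?AC \<cong> ?BD"
    proof (rule less.hyps)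
      show "order ?AC < order A" using smaller by (simp add: order_def)
      show "comm_group ?AC" "comm_group ?BD"
        using A.comm_group_subgroup[OF C(1)] B.comm_group_subgroup[OF D(1)] .
      show "order ?AC = p ^ k'" "order ?BD = p ^ l'" using k' l' by (simp_all add: order_def)
      show "card (pow_kernel (p ^ m) ?AC) = card (pow_kernel (p ^ m) ?BD)" for m by (rule cards')
    qed
    then have "?AC \<times>\<times> ?AP \<cong> ?BD \<times>\<times> ?BQ"
      using isoPQ by (rule group.DirProd_iso_trans[OF groups(1)])
    then have "?AC \<times>\<times> ?AP \<cong> B" using isoB by (rule iso_trans)
    with group.iso_sym[OF DirProd_group[OF groups(1,2)] isoA] show ?thesis by (rule iso_trans)
  qed
qed

section \<open>Counting with homomorphisms\<close>

lemma (in group_hom) card_preimage: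
  assumes fin: "finite (carrier G)" and V: "V \<subseteq> h ` carrier G"
  shows "card {x \<in> carrier G. h x \<in> V} = card V * card (kernel G H h)"
proof -
  have fibre: "card {x \<in> carrier G. h x = v} = card (kernel G H h)" if v: "v \<in> V" for v
  proof -
    have "v \<in> h ` carrier G" using v V by (rule subsetD[rotated])
    then obtain a where a: "v = h a" "a \<in> carrier G" by (rule imageE)
    have "bij_betw (\<lambda>x. x \<otimes>\<^bsub>G\<^esub> a) (kernel G H h) {x \<in> carrier G. h x = v}"
      using a by (intro bij_betwI[where g = "\<lambda>x. x \<otimes>\<^bsub>G\<^esub> inv\<^bsub>G\<^esub> a"]) (auto simp: kernel_def G.m_assoc)
    then show ?thesis by (rule bij_betw_same_card[symmetric])
  qed
  have "finite V" using V fin finite_subset by (metis finite_imageI)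
  have "card {x \<in> carrier G. h x \<in> V} = (\<Sum>x\<in>{x \<in> carrier G. h x \<in> V}. 1)" by simp
  also have "\<dots> = (\<Sum>v\<in>V. \<Sum>x\<in>{x \<in> {x \<in> carrier G. h x \<in> V}. h x = v}. 1)"
    using fin \<open>finite V\<close> by (intro sum.group[symmetric]) auto
  also have "\<dots> = (\<Sum>v\<in>V. card (kernel G H h))"
  proof (rule sum.cong[OF refl])
    fix v assume v: "v \<in> V"
    then have "{x \<in> {x \<in> carrier G. h x \<in> V}. h x = v} = {x \<in> carrier G. h x = v}" by auto
    then show "(\<Sum>x\<in>{x \<in> {x \<in> carrier G. h x \<in> V}. h x = v}. 1) = card (kernel G H h)"
      using fibre[OF v] by simp
  qed
  finally show ?thesis by simp
qed

lemma (in comm_group) pow_hom: "group_hom G G (\<lambda>x. x [^] (q::nat))"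
  by unfold_locales (auto simp: hom_def nat_pow_distrib)

lemma (in comm_group) card_pow_kernel_times_image:
  assumes "finite (carrier G)"
  shows "card (pow_kernel q G) * card ((\<lambda>x. x [^] q) ` carrier G) = card (carrier G)"
proof -
  interpret pow: group_hom G G "\<lambda>x. x [^] q" by (rule pow_hom)
  have "{x \<in> carrier G. x [^] q \<in> (\<lambda>x. x [^] q) ` carrier G} = carrier G" by auto
  then show ?thesis
    using pow.card_preimage[OF assms subset_refl]
    by (simp add: pow_kernel_def kernel_def mult.commute)
qed

lemma (in normal) factor_group_hom: "group_hom G (G Mod H) (\<lambda>x. H #> x)"
  by (intro group_hom.intro group_hom_axioms.intro is_group factorgroup_is_group r_coset_hom_Mod)

lemma (in normal) kernel_coset_hom: "kernel G (G Mod H) (\<lambda>x. H #> x) = H"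
proof -
  have "H #> x = H \<longleftrightarrow> x \<in> H" if "x \<in> carrier G" for x
    using that rcos_self[OF that is_subgroup] rcos_const[OF is_group] by metis
  then have "{x \<in> carrier G. H #> x = H} = {x \<in> carrier G. x \<in> H}" by (intro Collect_cong) blast
  also have "\<dots> = H" using subset by blast
  finally show ?thesis by (simp add: kernel_def)
qed

text \<open>
  \<open>M G\<^bsup>q\<^esup>\<close> is the preimage of the group of \<open>q\<close>-th powers of the abelian group \<open>G/M\<close>, and an abelian group
  has as many solutions of \<open>x\<^sup>q = 1\<close> as its group of \<open>q\<close>-th powers has cosets.
\<close>

lemma (in group) subgroup_set_mult_powers:
  assumes M: "subgroup M G" and der: "derived G (carrier G) \<subseteq> M" and fin: "finite (carrier G)"
  shows "subgroup (M <#> (\<lambda>x. x [^] (q::nat)) ` carrier G) G"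
    and "card (pow_kernel q (G Mod M)) * card (M <#> (\<lambda>x. x [^] q) ` carrier G) = card (carrier G)"
proof -
  interpret M: normal M G by (rule normal_if_derived_subset[OF M der])
  interpret Q: comm_group "G Mod M" by (rule comm_group_factor_derived[OF M der])
  interpret f: group_hom G "G Mod M" "\<lambda>x. M #> x" by (rule M.factor_group_hom)
  interpret pow: group_hom "G Mod M" "G Mod M" "\<lambda>x. x [^]\<^bsub>G Mod M\<^esub> q" by (rule Q.pow_hom)
  let ?V = "(\<lambda>x. x [^]\<^bsub>G Mod M\<^esub> q) ` carrier (G Mod M)"
  have onto: "carrier (G Mod M) = (\<lambda>x. M #> x) ` carrier G" by (rule carrier_FactGroup)
  have V_eq: "?V = (\<lambda>x. M #> (x [^] q)) ` carrier G"
    unfolding onto image_image by (intro image_cong refl) (simp add: M.FactGroup_pow)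
  have "x \<in> M <#> (\<lambda>x. x [^] q) ` carrier G \<longleftrightarrow> x \<in> carrier G \<and> M #> x \<in> ?V" for x
  proof
    assume "x \<in> M <#> (\<lambda>x. x [^] q) ` carrier G"
    then obtain t y where t: "t \<in> M" and y: "y \<in> carrier G" and x: "x = t \<otimes> y [^] q"
      unfolding set_mult_def by auto
    have tG: "t \<in> carrier G" using t by (rule M.mem_carrier)
    have "M #> x = (M #> t) #> (y [^] q)"
      unfolding x using tG y by (intro coset_mult_assoc[symmetric] M.subset) auto
    also have "M #> t = M" using t by (rule M.rcos_const[OF is_group])
    finally show "x \<in> carrier G \<and> M #> x \<in> ?V" unfolding V_eq using tG y x by simp
  next
    assume "x \<in> carrier G \<and> M #> x \<in> ?V"
    then have x: "x \<in> carrier G" and "M #> x \<in> (\<lambda>x. M #> (x [^] q)) ` carrier G"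
      unfolding V_eq by auto
    then obtain y where y: "M #> x = M #> (y [^] q)" "y \<in> carrier G" by (elim imageE)
    then have "x \<in> M #> (y [^] q)" using rcos_self[OF x M] by simp
    then show "x \<in> M <#> (\<lambda>x. x [^] q) ` carrier G"
      using y(2) unfolding r_coset_def set_mult_def by blast
  qed
  then have eq: "M <#> (\<lambda>x. x [^] q) ` carrier G = {x \<in> carrier G. M #> x \<in> ?V}" by blast
  have V: "subgroup ?V (G Mod M)" by (rule pow.img_is_subgroup)
  show "subgroup (M <#> (\<lambda>x. x [^] q) ` carrier G) G"
    unfolding eq
  proof (rule subgroupI)
    have "\<one> \<in> {x \<in> carrier G. M #> x \<in> ?V}"
      using subgroup.one_closed[OF V] f.hom_one by simp
    then show "{x \<in> carrier G. M #> x \<in> ?V} \<noteq> {}" by (metis empty_iff)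
  next
    fix a assume "a \<in> {x \<in> carrier G. M #> x \<in> ?V}"
    then show "inv a \<in> {x \<in> carrier G. M #> x \<in> ?V}"
      using subgroup.m_inv_closed[OF V, of "M #> a"] by (simp add: f.hom_inv)
  next
    fix a b assume "a \<in> {x \<in> carrier G. M #> x \<in> ?V}" "b \<in> {x \<in> carrier G. M #> x \<in> ?V}"
    then show "a \<otimes> b \<in> {x \<in> carrier G. M #> x \<in> ?V}"
      using subgroup.m_closed[OF V, of "M #> a" "M #> b"] f.hom_mult[of a b] by simp
  qed auto
  have finQ: "finite (carrier (G Mod M))" unfolding onto using fin by simp
  have "?V \<subseteq> (\<lambda>x. M #> x) ` carrier G" unfolding V_eq by auto
  then have "card (M <#> (\<lambda>x. x [^] q) ` carrier G) = card ?V * card M"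
    using f.card_preimage[OF fin, of ?V] by (simp only: eq M.kernel_coset_hom)
  moreover have "card (carrier (G Mod M)) * card M = card (carrier G)"
    using lagrange[OF M] by (simp add: FactGroup_def order_def)
  ultimately show "card (pow_kernel q (G Mod M)) * card (M <#> (\<lambda>x. x [^] q) ` carrier G) = card (carrier G)"
    using Q.card_pow_kernel_times_image[OF finQ, of q] by (simp only: mult.assoc[symmetric])
qed

lemma (in normal) card_set_mult_times_Int:
  assumes S: "subgroup S G" and fin: "finite (carrier G)"
  shows "card (H <#> S) * card (H \<inter> S) = card H * card S"
proof -
  interpret f: group_hom G "G Mod H" "\<lambda>x. H #> x" by (rule factor_group_hom)
  interpret fS: group_hom "G\<lparr>carrier := S\<rparr>" "G Mod H" "\<lambda>x. H #> x"
    by (intro group_hom.intro group_hom_axioms.intro subgroup_imp_group[OF S] factorgroup_is_group)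
      (simp add: hom_def Pi_def subgroup.mem_carrier[OF S] f.hom_mult f.hom_closed del: mult_FactGroup)
  let ?V = "(\<lambda>x. H #> x) ` S"
  have "x \<in> H <#> S \<longleftrightarrow> x \<in> carrier G \<and> H #> x \<in> ?V" for x
  proof
    assume "x \<in> H <#> S"
    then obtain t s where t: "t \<in> H" and s: "s \<in> S" and x: "x = t \<otimes> s"
      unfolding set_mult_def by auto
    have G: "t \<in> carrier G" "s \<in> carrier G" using t s subgroup.mem_carrier[OF S] by auto
    have "H #> x = (H #> t) #> s"
      unfolding x using G by (intro coset_mult_assoc[symmetric] subset) auto
    also have "H #> t = H" using t by (rule rcos_const[OF is_group])
    finally show "x \<in> carrier G \<and> H #> x \<in> ?V" using G s x by simp
  next
    assume "x \<in> carrier G \<and> H #> x \<in> ?V"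
    then have x: "x \<in> carrier G" and "H #> x \<in> ?V" by auto
    then obtain s where s: "H #> x = H #> s" "s \<in> S" by (elim imageE)
    then have "x \<in> H #> s" using rcos_self[OF x is_subgroup] by simp
    then show "x \<in> H <#> S" using s(2) unfolding r_coset_def set_mult_def by blast
  qed
  then have "H <#> S = {x \<in> carrier G. H #> x \<in> ?V}" by blast
  moreover have "?V \<subseteq> (\<lambda>x. H #> x) ` carrier G" using subgroup.subset[OF S] by (rule image_mono)
  ultimately have 1: "card (H <#> S) = card ?V * card H"
    using f.card_preimage[OF fin, of ?V] by (simp only: kernel_coset_hom)
  have "kernel (G\<lparr>carrier := S\<rparr>) (G Mod H) (\<lambda>x. H #> x) = H \<inter> S"
  proof -
    have "kernel (G\<lparr>carrier := S\<rparr>) (G Mod H) (\<lambda>x. H #> x) = kernel G (G Mod H) (\<lambda>x. H #> x) \<inter> S"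
      using subgroup.subset[OF S] by (auto simp: kernel_def)
    then show ?thesis by (simp only: kernel_coset_hom)
  qed
  moreover have "{x \<in> carrier (G\<lparr>carrier := S\<rparr>). H #> x \<in> ?V} = S" by auto
  moreover have "finite S" using subgroup.subset[OF S] fin by (rule finite_subset)
  ultimately have "card S = card ?V * card (H \<inter> S)"
    using fS.card_preimage[of ?V] by simp
  then show ?thesis unfolding 1 by simp
qed

section \<open>Torsion of the four groups\<close>

lemma order_factor_p_group:
  assumes "group G" "order G = p ^ e" "Factorial_Ring.prime p" "subgroup M G"
  shows "\<exists>k. order (G Mod M) = p ^ k"
proof -
  have "order (G Mod M) dvd p ^ e"
    using group.lagrange[OF assms(1,4)] assms(2) by (metis FactGroup_def dvd_triv_left order_def partial_object.select_convs(1))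
  then show ?thesis using divides_primepow_nat[OF assms(3)] by blast
qed

lemma order_subgroup_p_group:
  assumes "group G" "order G = p ^ e" "Factorial_Ring.prime p" "subgroup S G"
  shows "\<exists>k. order (G\<lparr>carrier := S\<rparr>) = p ^ k"
proof -
  have "card S dvd p ^ e"
    using group.lagrange[OF assms(1,4)] assms(2) by (metis dvd_triv_right)
  then obtain k where "card S = p ^ k" using divides_primepow_nat[OF assms(3)] by blast
  then show ?thesis by (auto simp: order_def)
qed

context group
begin

abbreviation omega_center :: "nat \<Rightarrow> nat \<Rightarrow> 'a set" where
  "omega_center p n \<equiv> pow_kernel (p ^ n) (G\<lparr>carrier := center G\<rparr>)"

lemma in_omega_center: "z \<in> omega_center p n \<longleftrightarrow> z \<in> center G \<and> z [^] (p ^ n) = \<one>"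
  by (simp add: pow_kernel_def nat_pow_consistent[symmetric])

lemma omega_center_closed: "z \<in> omega_center p n \<Longrightarrow> z \<in> carrier G"
  unfolding in_omega_center by (blast intro: center_closed)

lemma omega_center_0: "z \<in> omega_center p 0 \<Longrightarrow> z = \<one>"
proof -
  assume z: "z \<in> omega_center p 0"
  then have "z [^] (p ^ 0) = \<one>" unfolding in_omega_center by (rule conjunct2)
  then show "z = \<one>" using omega_center_closed[OF z] by simp
qed

lemma subgroup_omega_center: "subgroup (omega_center p n) G"
proof (rule subgroupI)
  show "omega_center p n \<subseteq> carrier G" using omega_center_closed by (rule subsetI)
  have "\<one> \<in> omega_center p n"
    unfolding in_omega_center using subgroup.one_closed[OF subgroup_center] by simp
  then show "omega_center p n \<noteq> {}" by (metis empty_iff)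
next
  fix a assume a: "a \<in> omega_center p n"
  then show "inv a \<in> omega_center p n"
    using subgroup.m_inv_closed[OF subgroup_center, of a] omega_center_closed[OF a]
    by (simp add: in_omega_center nat_pow_inv)
next
  fix a b assume a: "a \<in> omega_center p n" and b: "b \<in> omega_center p n"
  have "(a \<otimes> b) [^] (p ^ n) = a [^] (p ^ n) \<otimes> b [^] (p ^ n)"
    using a b omega_center_closed[OF a] omega_center_closed[OF b]
    by (intro pow_mult_distrib center_commute) (simp_all add: in_omega_center)
  then show "a \<otimes> b \<in> omega_center p n"
    using a b subgroup.m_closed[OF subgroup_center, of a b] by (simp add: in_omega_center)
qed

lemma Omega_center: "Omega p n (G\<lparr>carrier := center G\<rparr>) = omega_center p n"
proof -
  have "omega_center p n \<subseteq> center G" unfolding in_omega_center subset_iff by simp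
  moreover have "generate G (omega_center p n) = omega_center p n"
    using generate_subgroup_incl[OF subset_refl subgroup_omega_center] generate.incl by (metis subsetI subset_antisym)
  ultimately show ?thesis
    unfolding Omega_def pow_kernel_def[symmetric] by (simp add: generate_consistent subgroup_center)
qed

lemma mixed_power_subgroup_minimal:
  assumes S: "subgroup S G" and "derived G (carrier G) \<subseteq> S"
    and "\<And>z. z \<in> omega_center p n \<Longrightarrow> z [^] (p ^ m) \<in> S"
    and "\<And>x. x \<in> carrier G \<Longrightarrow> x [^] (p ^ k) \<in> S"
  shows "mixed_power_subgroup p n m k G \<subseteq> S"
  unfolding mixed_power_subgroup_def
  using assms(2-4) by (intro generate_subgroup_incl[OF _ S]) (auto simp: in_omega_center)

lemma omega_center_pow_mem:
  "z \<in> omega_center p n \<Longrightarrow> z [^] (p ^ m) \<in> mixed_power_subgroup p n m k G"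
  unfolding in_omega_center by (intro center_pow_in_mixed_power_subgroup) simp_all

lemma normal_mixed_power_subgroup: "mixed_power_subgroup p n m k G \<lhd> G"
  by (rule normal_if_derived_subset[OF mixed_power_subgroup_subgroup derived_subset_mixed_power_subgroup])

lemma set_mult_subsetI:
  assumes "subgroup S G" "A \<subseteq> S" "B \<subseteq> S"
  shows "A <#> B \<subseteq> S"
  using assms subgroup.m_closed[OF assms(1)] unfolding set_mult_def by blast

lemma subset_set_mult:
  assumes "subgroup A G" "subgroup B G"
  shows "A \<subseteq> A <#> B" "B \<subseteq> A <#> B"
proof -
  show "A \<subseteq> A <#> B"
  proof
    fix a assume a: "a \<in> A"
    then have "a = a \<otimes> \<one>" using subgroup.mem_carrier[OF assms(1)] by simp
    then show "a \<in> A <#> B" using a subgroup.one_closed[OF assms(2)] unfolding set_mult_def by blast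
  qed
  show "B \<subseteq> A <#> B"
  proof
    fix b assume b: "b \<in> B"
    then have "b = \<one> \<otimes> b" using subgroup.mem_carrier[OF assms(2)] by simp
    then show "b \<in> A <#> B" using b subgroup.one_closed[OF assms(1)] unfolding set_mult_def by blast
  qed
qed

lemma subgroup_normal_set_mult:
  assumes "N \<lhd> G" "subgroup S G"
  shows "subgroup (N <#> S) G"
proof -
  interpret second_isomorphism_grp N G S
    by (intro second_isomorphism_grp.intro second_isomorphism_grp_axioms.intro assms)
  show ?thesis by (rule normal_set_mult_subgroup)
qed

context
  \<comment> \<open>As \<open>p\<^sup>e\<close> kills \<open>G\<close>, the value \<open>e\<close> of the index \<open>k\<close> removes the factor \<open>G\<^bsup>p^k\<^esup>\<close> from
    \<open>N(n,m,k)\<close>, and the value \<open>e\<close> of \<open>n\<close> turns \<open>\<Omega>\<^sub>n(Z(G))\<close> into \<open>Z(G)\<close>.\<close>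
  fixes p e :: nat
  assumes ord: "order G = p ^ e" and prime: "Factorial_Ring.prime p"
begin

abbreviation N :: "nat \<Rightarrow> nat \<Rightarrow> nat \<Rightarrow> 'a set" where
  "N n m k \<equiv> mixed_power_subgroup p n m k G"

lemma fin: "finite (carrier G)"
  using ord prime_gt_0_nat[OF prime] order_gt_0_iff_finite by auto

lemma exponent: "x \<in> carrier G \<Longrightarrow> x [^] (p ^ e) = \<one>"
  using pow_order_eq_1 ord by simp

lemma derived_N: "derived G (carrier G) \<subseteq> N n m k"
  by (rule derived_subset_mixed_power_subgroup)

lemma subgroup_N: "subgroup (N n m k) G"
  by (rule mixed_power_subgroup_subgroup)

lemma omega_center_e: "omega_center p e = center G"
  using exponent center_closed[of _ G] by (auto simp: in_omega_center)

lemma commutator_Omega_center_eq: "commutator_Omega_center p n G = N n 0 e"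
proof
  have D: "subgroup (derived G (carrier G)) G" by (rule derived_is_subgroup[OF subset_refl])
  have eq: "commutator_Omega_center p n G = derived G (carrier G) <#> omega_center p n"
    unfolding commutator_Omega_center_def Omega_center ..
  have "z \<in> N n 0 e" if "z \<in> omega_center p n" for z
    using omega_center_pow_mem[OF that, of 0 e] omega_center_closed[OF that] by simp
  then show "commutator_Omega_center p n G \<subseteq> N n 0 e"
    unfolding eq by (intro set_mult_subsetI subgroup_N derived_N) (rule subsetI)
  have S: "subgroup (derived G (carrier G) <#> omega_center p n) G"
    by (rule subgroup_normal_set_mult[OF derived_self_is_normal subgroup_omega_center])
  show "N n 0 e \<subseteq> commutator_Omega_center p n G"
    unfolding eq
  proof (rule mixed_power_subgroup_minimal[OF S])
    show "derived G (carrier G) \<subseteq> derived G (carrier G) <#> omega_center p n"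
      by (rule subset_set_mult(1)[OF D subgroup_omega_center])
    show "z [^] (p ^ 0) \<in> derived G (carrier G) <#> omega_center p n" if "z \<in> omega_center p n" for z
      using subsetD[OF subset_set_mult(2)[OF D subgroup_omega_center] that] omega_center_closed[OF that] by simp
    show "x [^] (p ^ e) \<in> derived G (carrier G) <#> omega_center p n" if "x \<in> carrier G" for x
      using exponent[OF that] subgroup.one_closed[OF S] by simp
  qed
qed

lemma center_Agemo_commutator_eq: "center_Agemo_commutator p n G = center G \<inter> N 0 0 n"
proof -
  have D: "subgroup (derived G (carrier G)) G" by (rule derived_is_subgroup[OF subset_refl])
  have A: "subgroup (Agemo p n G) G"
    unfolding Agemo_def by (intro generate_is_subgroup) auto
  have eq: "Agemo p n G <#> derived G (carrier G) = derived G (carrier G) <#> Agemo p n G"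
    by (rule commut_normal[OF A derived_self_is_normal])
  have S: "subgroup (derived G (carrier G) <#> Agemo p n G) G"
    by (rule subgroup_normal_set_mult[OF derived_self_is_normal A])
  have "Agemo p n G \<subseteq> N 0 0 n"
    unfolding Agemo_def using pow_in_mixed_power_subgroup
    by (intro generate_subgroup_incl[OF _ subgroup_N]) auto
  then have "derived G (carrier G) <#> Agemo p n G \<subseteq> N 0 0 n"
    by (intro set_mult_subsetI subgroup_N derived_N)
  moreover have "N 0 0 n \<subseteq> derived G (carrier G) <#> Agemo p n G"
  proof (rule mixed_power_subgroup_minimal[OF S])
    show "derived G (carrier G) \<subseteq> derived G (carrier G) <#> Agemo p n G"
      by (rule subset_set_mult(1)[OF D A])
    show "z [^] (p ^ 0) \<in> derived G (carrier G) <#> Agemo p n G" if "z \<in> omega_center p 0" for z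
    proof -
      have "z = \<one>" using that by (rule omega_center_0)
      then show ?thesis using subgroup.one_closed[OF S] by simp
    qed
    show "x [^] (p ^ n) \<in> derived G (carrier G) <#> Agemo p n G" if "x \<in> carrier G" for x
    proof -
      have "x [^] (p ^ n) \<in> Agemo p n G"
        unfolding Agemo_def using that by (intro generate.incl) auto
      then show ?thesis by (rule subsetD[OF subset_set_mult(2)[OF D A]])
    qed
  qed
  ultimately show ?thesis unfolding center_Agemo_commutator_def eq by blast
qed

lemma N_powers_subset: "N 0 0 k \<subseteq> N n m k"
proof (rule mixed_power_subgroup_minimal[OF subgroup_N derived_N])
  show "z [^] (p ^ 0) \<in> N n m k" if "z \<in> omega_center p 0" for z
  proof -
    have "z = \<one>" using that by (rule omega_center_0)
    then show ?thesis using subgroup.one_closed[OF subgroup_N] by simp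
  qed
  show "x [^] (p ^ k) \<in> N n m k" if "x \<in> carrier G" for x
    using that by (rule pow_in_mixed_power_subgroup)
qed

lemma N_exponent_subset: "N n m e \<subseteq> N n m k"
proof (rule mixed_power_subgroup_minimal[OF subgroup_N derived_N])
  show "z [^] (p ^ m) \<in> N n m k" if "z \<in> omega_center p n" for z
    using that by (rule omega_center_pow_mem)
  show "x [^] (p ^ e) \<in> N n m k" if "x \<in> carrier G" for x
    using exponent[OF that] subgroup.one_closed[OF subgroup_N] by simp
qed

text \<open>
  With \<open>M = N(n,0,e)\<close> one has \<open>M G\<^bsup>p^k\<^esup> = N(n,0,k)\<close>.
\<close>

lemma card_pow_kernel_factor_commutator_Omega:
  "comm_group (G Mod N n 0 e)"
  "\<exists>k. order (G Mod N n 0 e) = p ^ k"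
  "card (pow_kernel (p ^ k) (G Mod N n 0 e)) * card (N n 0 k) = card (carrier G)"
proof -
  show "comm_group (G Mod N n 0 e)" by (rule comm_group_factor_derived[OF subgroup_N derived_N])
  show "\<exists>k. order (G Mod N n 0 e) = p ^ k" by (rule order_factor_p_group[OF is_group ord prime subgroup_N])
  let ?S = "N n 0 e <#> (\<lambda>x. x [^] (p ^ k)) ` carrier G"
  note S = subgroup_set_mult_powers[OF subgroup_N[where n = n and m = 0 and k = e] derived_N fin, where q = "p ^ k"]
  have left: "N n 0 e \<subseteq> ?S"
  proof
    fix x assume x: "x \<in> N n 0 e"
    then have "x = x \<otimes> \<one> [^] (p ^ k)" using subgroup.mem_carrier[OF subgroup_N] by simp
    then show "x \<in> ?S" using x unfolding set_mult_def by blast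
  qed
  have "?S = N n 0 k"
  proof
    show "?S \<subseteq> N n 0 k"
      using pow_in_mixed_power_subgroup by (intro set_mult_subsetI subgroup_N N_exponent_subset) auto
    show "N n 0 k \<subseteq> ?S"
    proof (rule mixed_power_subgroup_minimal[OF S(1)])
      show "derived G (carrier G) \<subseteq> ?S" using derived_N left by (rule subset_trans)
      show "z [^] (p ^ 0) \<in> ?S" if "z \<in> omega_center p n" for z
        using left omega_center_pow_mem[OF that] by (rule subsetD)
      show "x [^] (p ^ k) \<in> ?S" if x: "x \<in> carrier G" for x
      proof -
        have "x [^] (p ^ k) = \<one> \<otimes> x [^] (p ^ k)" using x by simp
        then show ?thesis using x subgroup.one_closed[OF subgroup_N] unfolding set_mult_def by blast
      qed
    qed
  qed
  then show "card (pow_kernel (p ^ k) (G Mod N n 0 e)) * card (N n 0 k) = card (carrier G)"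
    using S(2) by simp
qed

text \<open>
  With \<open>K = \<gamma>(G) \<Omega>\<^sub>n(Z(G))\<close> one has \<open>\<gamma>(G) K\<^bsup>p^m\<^esup> = N(n,m,e)\<close>. One inclusion needs that taking
  \<open>p\<^sup>m\<close>-th powers is a homomorphism modulo \<open>N(n,m,e)\<close>.
\<close>

lemma card_pow_kernel_commutator_Omega_factor_derived:
  "comm_group (G\<lparr>carrier := N n 0 e\<rparr> Mod derived G (carrier G))"
  "\<exists>k. order (G\<lparr>carrier := N n 0 e\<rparr> Mod derived G (carrier G)) = p ^ k"
  "card (pow_kernel (p ^ m) (G\<lparr>carrier := N n 0 e\<rparr> Mod derived G (carrier G))) * card (N n m e) = card (N n 0 e)"
proof -
  let ?D = "derived G (carrier G)"
  let ?K = "G\<lparr>carrier := N n 0 e\<rparr>"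
  have D: "subgroup ?D G" by (rule derived_is_subgroup[OF subset_refl])
  interpret K: group ?K by (rule subgroup_imp_group[OF subgroup_N])
  have DK: "subgroup ?D ?K"
    by (rule subgroup_incl[OF D subgroup_N derived_N])
  have der: "derived ?K (carrier ?K) \<subseteq> ?D"
    using derived_consistent[OF subset_refl subgroup_N, of n 0 e] mono_derived[OF subgroup.subset[OF subgroup_N]] by simp
  show "comm_group (?K Mod ?D)" by (rule K.comm_group_factor_derived[OF DK der])
  obtain j where "order ?K = p ^ j" using order_subgroup_p_group[OF is_group ord prime subgroup_N] by blast
  then show "\<exists>k. order (?K Mod ?D) = p ^ k" by (rule order_factor_p_group[OF K.is_group _ prime DK])
  have finK: "finite (carrier ?K)" using finite_subset[OF subgroup.subset[OF subgroup_N] fin] by simp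
  let ?S = "?D <#> (\<lambda>x. x [^] (p ^ m)) ` N n 0 e"
  have S: "subgroup ?S ?K" "card (pow_kernel (p ^ m) (?K Mod ?D)) * card ?S = card (N n 0 e)"
    using K.subgroup_set_mult_powers[OF DK der finK, of "p ^ m"] by (simp_all add: nat_pow_consistent[symmetric])
  have SG: "subgroup ?S G" using incl_subgroup[OF subgroup_N S(1)] .
  have "?S = N n m e"
  proof
    interpret Q: comm_group "G Mod N n m e"
      by (rule comm_group_factor_derived[OF subgroup_N derived_N])
    interpret NN: normal "N n m e" G by (rule normal_mixed_power_subgroup)
    interpret f: group_hom G "G Mod N n m e" "\<lambda>x. N n m e #> x" by (rule NN.factor_group_hom)
    interpret pow: group_hom "G Mod N n m e" "G Mod N n m e" "\<lambda>x. x [^]\<^bsub>G Mod N n m e\<^esub> (p ^ m)" by (rule Q.pow_hom)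
    interpret g: group_hom G "G Mod N n m e" "\<lambda>x. N n m e #> (x [^] (p ^ m))"
    proof (intro group_hom.intro group_hom_axioms.intro is_group Q.is_group)
      show "(\<lambda>x. N n m e #> (x [^] (p ^ m))) \<in> hom G (G Mod N n m e)"
      proof (rule homI)
        fix x y assume x: "x \<in> carrier G" and y: "y \<in> carrier G"
        show "N n m e #> (x [^] (p ^ m)) \<in> carrier (G Mod N n m e)"
          using x by (intro f.hom_closed nat_pow_closed)
        show "N n m e #> ((x \<otimes> y) [^] (p ^ m))
            = (N n m e #> (x [^] (p ^ m))) \<otimes>\<^bsub>G Mod N n m e\<^esub> (N n m e #> (y [^] (p ^ m)))"
          by (simp only: NN.FactGroup_pow[symmetric] x y m_closed f.hom_mult pow.hom_mult f.hom_closed)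
      qed
    qed
    let ?T = "kernel G (G Mod N n m e) (\<lambda>x. N n m e #> (x [^] (p ^ m)))"
    have T_iff: "x \<in> ?T \<longleftrightarrow> x [^] (p ^ m) \<in> N n m e" if x: "x \<in> carrier G" for x
    proof -
      have "x [^] (p ^ m) \<in> kernel G (G Mod N n m e) (\<lambda>x. N n m e #> x) \<longleftrightarrow> x \<in> ?T"
        using x by (simp add: kernel_def)
      then show ?thesis unfolding NN.kernel_coset_hom by simp
    qed
    have "N n 0 e \<subseteq> ?T"
    proof (rule mixed_power_subgroup_minimal[OF g.subgroup_kernel])
      show "?D \<subseteq> ?T"
      proof
        fix x assume x: "x \<in> ?D"
        then have "x [^] (p ^ m) \<in> ?D"
          using subgroup_int_pow_closed[OF D, of x "int (p ^ m)"] by (simp only: int_pow_int)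
        then show "x \<in> ?T" using T_iff[OF subgroup.mem_carrier[OF D x]] derived_N by blast
      qed
      show "z [^] (p ^ 0) \<in> ?T" if "z \<in> omega_center p n" for z
        using T_iff[OF omega_center_closed[OF that]] omega_center_pow_mem[OF that] omega_center_closed[OF that] by simp
      show "x [^] (p ^ e) \<in> ?T" if "x \<in> carrier G" for x
        using exponent[OF that] subgroup.one_closed[OF g.subgroup_kernel] by simp
    qed
    then have "(\<lambda>x. x [^] (p ^ m)) ` N n 0 e \<subseteq> N n m e"
      by (intro image_subsetI T_iff[THEN iffD1] subgroup.mem_carrier[OF subgroup_N, of _ n 0 e])
        (assumption, erule subsetD, assumption)
    then show "?S \<subseteq> N n m e" by (intro set_mult_subsetI subgroup_N derived_N)
    show "N n m e \<subseteq> ?S"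
    proof (rule mixed_power_subgroup_minimal[OF SG])
      have one: "\<one> \<in> N n 0 e" by (rule subgroup.one_closed[OF subgroup_N])
      show "?D \<subseteq> ?S"
      proof
        fix x assume x: "x \<in> ?D"
        then have "x = x \<otimes> \<one> [^] (p ^ m)" using subgroup.mem_carrier[OF D] by simp
        then show "x \<in> ?S" using x one unfolding set_mult_def by blast
      qed
      show "z [^] (p ^ m) \<in> ?S" if z: "z \<in> omega_center p n" for z
      proof -
        have zN: "z \<in> N n 0 e"
          using omega_center_pow_mem[OF z, of 0 e] omega_center_closed[OF z] by simp
        have "z [^] (p ^ m) = \<one> \<otimes> z [^] (p ^ m)" using omega_center_closed[OF z] by simp
        then show ?thesis using zN subgroup.one_closed[OF D] unfolding set_mult_def by blast
      qed
      show "x [^] (p ^ e) \<in> ?S" if "x \<in> carrier G" for x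
        using exponent[OF that] subgroup.one_closed[OF SG] by simp
    qed
  qed
  then show "card (pow_kernel (p ^ m) (?K Mod ?D)) * card (N n m e) = card (N n 0 e)"
    using S(2) by simp
qed

text \<open>
  The solutions of \<open>x\<^bsup>p^m\<^esup> = 1\<close> form the intersection of \<open>N(0,0,n)\<close> and \<open>\<Omega>\<^sub>m(Z(G))\<close>, whose product is
  \<open>N(m,0,n)\<close>.
\<close>

lemma card_pow_kernel_center_Agemo:
  "comm_group (G\<lparr>carrier := center G \<inter> N 0 0 n\<rparr>)"
  "\<exists>k. order (G\<lparr>carrier := center G \<inter> N 0 0 n\<rparr>) = p ^ k"
  "card (pow_kernel (p ^ m) (G\<lparr>carrier := center G \<inter> N 0 0 n\<rparr>)) * card (N m 0 n) = card (N 0 0 n) * card (omega_center p m)"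
proof -
  have I: "subgroup (center G \<inter> N 0 0 n) G"
    by (rule subgroups_Inter_pair[OF subgroup_center subgroup_N])
  interpret K: group "G\<lparr>carrier := center G \<inter> N 0 0 n\<rparr>" by (rule subgroup_imp_group[OF I])
  show "comm_group (G\<lparr>carrier := center G \<inter> N 0 0 n\<rparr>)"
    by (rule K.group_comm_groupI) (simp add: center_commute center_closed)
  show "\<exists>k. order (G\<lparr>carrier := center G \<inter> N 0 0 n\<rparr>) = p ^ k"
    by (rule order_subgroup_p_group[OF is_group ord prime I])
  have "pow_kernel (p ^ m) (G\<lparr>carrier := center G \<inter> N 0 0 n\<rparr>) = N 0 0 n \<inter> omega_center p m"
    by (auto simp: pow_kernel_def nat_pow_consistent[symmetric])
  moreover have "N 0 0 n <#> omega_center p m = N m 0 n"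
  proof
    have "z \<in> N m 0 n" if "z \<in> omega_center p m" for z
      using omega_center_pow_mem[OF that, of 0 n] omega_center_closed[OF that] by simp
    then show "N 0 0 n <#> omega_center p m \<subseteq> N m 0 n"
      by (intro set_mult_subsetI subgroup_N N_powers_subset subsetI)
    have S: "subgroup (N 0 0 n <#> omega_center p m) G"
      by (rule subgroup_normal_set_mult[OF normal_mixed_power_subgroup subgroup_omega_center])
    note sub = subset_set_mult[OF subgroup_N subgroup_omega_center]
    show "N m 0 n \<subseteq> N 0 0 n <#> omega_center p m"
    proof (rule mixed_power_subgroup_minimal[OF S])
      show "derived G (carrier G) \<subseteq> N 0 0 n <#> omega_center p m"
        using derived_N sub(1) by (rule subset_trans)
      show "z [^] (p ^ 0) \<in> N 0 0 n <#> omega_center p m" if "z \<in> omega_center p m" for z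
        using subsetD[OF sub(2) that] omega_center_closed[OF that] by simp
      show "x [^] (p ^ n) \<in> N 0 0 n <#> omega_center p m" if "x \<in> carrier G" for x
        using sub(1) pow_in_mixed_power_subgroup[OF that] by (rule subsetD)
    qed
  qed
  ultimately show "card (pow_kernel (p ^ m) (G\<lparr>carrier := center G \<inter> N 0 0 n\<rparr>)) * card (N m 0 n) = card (N 0 0 n) * card (omega_center p m)"
    using normal.card_set_mult_times_Int[OF normal_mixed_power_subgroup subgroup_omega_center fin, of p 0 0 n p m]
    by (simp add: mult.commute)
qed

text \<open>
  Write \<open>D = Z(G) \<inter> N(0,0,n)\<close> and \<open>P = Z(G)\<^bsup>p^m\<^esup>\<close>. The number of solutions in \<open>Z(G)/D\<close> is the index of
  \<open>DP\<close> in \<open>Z(G)\<close>. As \<open>N(e,m,n) = N(0,0,n) P\<close>, the modular law gives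
  \<open>DP = N(e,m,n) \<inter> Z(G)\<close>, and \<open>N(e,m,n) Z(G) = N(e,0,n)\<close>, so
  this is the index of \<open>N(e,m,n)\<close> in \<open>N(e,0,n)\<close>.
\<close>

lemma card_pow_kernel_center_factor_Agemo:
  "comm_group (G\<lparr>carrier := center G\<rparr> Mod (center G \<inter> N 0 0 n))"
  "\<exists>k. order (G\<lparr>carrier := center G\<rparr> Mod (center G \<inter> N 0 0 n)) = p ^ k"
  "card (pow_kernel (p ^ m) (G\<lparr>carrier := center G\<rparr> Mod (center G \<inter> N 0 0 n))) * card (N e m n) = card (N e 0 n)"
proof -
  let ?Z = "G\<lparr>carrier := center G\<rparr>" and ?D = "center G \<inter> N 0 0 n"
  interpret Z: comm_group ?Z by (rule comm_group_center)
  have I: "subgroup ?D G"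
    by (rule subgroups_Inter_pair[OF subgroup_center subgroup_N])
  have DZ: "subgroup ?D ?Z" by (rule subgroup_incl[OF I subgroup_center]) simp
  show "comm_group (?Z Mod ?D)" by (rule Z.abelian_FactGroup[OF DZ])
  obtain j where "order ?Z = p ^ j" using order_subgroup_p_group[OF is_group ord prime subgroup_center] by blast
  then show "\<exists>k. order (?Z Mod ?D) = p ^ k" by (rule order_factor_p_group[OF Z.is_group _ prime DZ])
  have finZ: "finite (center G)" using subgroup.subset[OF subgroup_center] fin by (rule finite_subset)
  have der: "derived ?Z (carrier ?Z) \<subseteq> ?D"
    using Z.derived_eq_singleton[of "carrier ?Z"] subgroup.one_closed[OF DZ] by simp
  let ?P = "(\<lambda>x. x [^] (p ^ m)) ` center G"
  have S: "card (pow_kernel (p ^ m) (?Z Mod ?D)) * card (?D <#> ?P) = card (center G)"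
    using Z.subgroup_set_mult_powers(2)[OF DZ der, of "p ^ m"] finZ by (simp add: nat_pow_consistent[symmetric])
  have P: "subgroup ?P G"
  proof -
    interpret pow: group_hom ?Z ?Z "\<lambda>x. x [^]\<^bsub>?Z\<^esub> (p ^ m)" by (rule Z.pow_hom)
    have "subgroup ?P ?Z" using pow.img_is_subgroup by (simp add: nat_pow_consistent[symmetric])
    then show ?thesis by (rule incl_subgroup[OF subgroup_center])
  qed
  have PZ: "?P \<subseteq> center G" using pow_central by auto
  have Pe: "?P \<subseteq> N e m n"
    using omega_center_pow_mem[of _ p e m n] by (auto simp: omega_center_e)
  have factor: "N 0 0 n <#> ?P = N e m n"
  proof
    show "N 0 0 n <#> ?P \<subseteq> N e m n" by (intro set_mult_subsetI subgroup_N N_powers_subset Pe)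
    have S: "subgroup (N 0 0 n <#> ?P) G"
      by (rule subgroup_normal_set_mult[OF normal_mixed_power_subgroup P])
    note sub = subset_set_mult[OF subgroup_N P]
    show "N e m n \<subseteq> N 0 0 n <#> ?P"
    proof (rule mixed_power_subgroup_minimal[OF S])
      show "derived G (carrier G) \<subseteq> N 0 0 n <#> ?P"
        using derived_N sub(1) by (rule subset_trans)
      show "z [^] (p ^ m) \<in> N 0 0 n <#> ?P" if "z \<in> omega_center p e" for z
        using sub(2) that unfolding omega_center_e by blast
      show "x [^] (p ^ n) \<in> N 0 0 n <#> ?P" if "x \<in> carrier G" for x
        using sub(1) pow_in_mixed_power_subgroup[OF that] by (rule subsetD)
    qed
  qed
  have "?D <#> ?P = N e m n \<inter> center G"
  proof
    have "?D \<subseteq> N e m n" using N_powers_subset by blast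
    then show "?D <#> ?P \<subseteq> N e m n \<inter> center G"
      using set_mult_subsetI[OF subgroup_N _ Pe] set_mult_subsetI[OF subgroup_center _ PZ, of ?D] by blast
    show "N e m n \<inter> center G \<subseteq> ?D <#> ?P"
    proof
      fix x assume "x \<in> N e m n \<inter> center G"
      then have x: "x \<in> N 0 0 n <#> ?P" and xZ: "x \<in> center G" unfolding factor by simp_all
      then obtain t y where t: "t \<in> N 0 0 n" and y: "y \<in> ?P" and eq: "x = t \<otimes> y"
        unfolding set_mult_def by auto
      have yZ: "y \<in> center G" using PZ y by (rule subsetD)
      have tG: "t \<in> carrier G" using t by (rule subgroup.mem_carrier[OF subgroup_N])
      have "t = x \<otimes> inv y" unfolding eq using tG center_closed[OF yZ] by (simp add: m_assoc)
      then have "t \<in> center G"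
        using subgroup.m_closed[OF subgroup_center xZ subgroup.m_inv_closed[OF subgroup_center yZ]] by simp
      then show "x \<in> ?D <#> ?P" using t y eq unfolding set_mult_def by blast
    qed
  qed
  moreover have "N e m n <#> center G = N e 0 n"
  proof
    have Z_sub: "center G \<subseteq> N e 0 n"
    proof
      fix z assume z: "z \<in> center G"
      then show "z \<in> N e 0 n"
        using omega_center_pow_mem[of z p e 0 n] center_closed[OF z] by (simp add: omega_center_e)
    qed
    have "N e m n \<subseteq> N e 0 n"
    proof (rule mixed_power_subgroup_minimal[OF subgroup_N derived_N])
      show "z [^] (p ^ m) \<in> N e 0 n" if "z \<in> omega_center p e" for z
        using that pow_central Z_sub unfolding omega_center_e by blast
    qed (rule pow_in_mixed_power_subgroup)
    then show "N e m n <#> center G \<subseteq> N e 0 n" by (intro set_mult_subsetI subgroup_N Z_sub)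
    have S: "subgroup (N e m n <#> center G) G"
      by (rule subgroup_normal_set_mult[OF normal_mixed_power_subgroup subgroup_center])
    note sub = subset_set_mult[OF subgroup_N subgroup_center]
    show "N e 0 n \<subseteq> N e m n <#> center G"
    proof (rule mixed_power_subgroup_minimal[OF S])
      show "derived G (carrier G) \<subseteq> N e m n <#> center G"
        using derived_N sub(1) by (rule subset_trans)
      show "z [^] (p ^ 0) \<in> N e m n <#> center G" if "z \<in> omega_center p e" for z
        using sub(2) that omega_center_closed[OF that] unfolding omega_center_e by auto
      show "x [^] (p ^ n) \<in> N e m n <#> center G" if "x \<in> carrier G" for x
        using sub(1) pow_in_mixed_power_subgroup[OF that] by (rule subsetD)
    qed
  qed
  ultimately have product: "card (N e 0 n) * card (?D <#> ?P) = card (N e m n) * card (center G)"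
    using normal.card_set_mult_times_Int[OF normal_mixed_power_subgroup subgroup_center fin, of p e m n] by simp
  have "card (pow_kernel (p ^ m) (?Z Mod ?D)) * card (N e m n) * card (?D <#> ?P)
      = card (N e m n) * (card (pow_kernel (p ^ m) (?Z Mod ?D)) * card (?D <#> ?P))"
    by (simp only: mult_ac)
  then have "card (pow_kernel (p ^ m) (?Z Mod ?D)) * card (N e m n) * card (?D <#> ?P)
      = card (N e 0 n) * card (?D <#> ?P)"
    by (simp only: S product)
  moreover have "card (center G) > 0"
    using subgroup.one_closed[OF subgroup_center] finZ card_gt_0_iff by blast
  then have "card (?D <#> ?P) \<noteq> 0" unfolding S[symmetric] by (intro notI) simp
  ultimately show "card (pow_kernel (p ^ m) (?Z Mod ?D)) * card (N e m n) = card (N e 0 n)"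
    using mult_right_cancel by blast
qed

lemma card_omega_center:
  "card (omega_center p m) * card ((\<lambda>z. z [^] (p ^ m)) ` center G) = card (center G)"
proof -
  interpret Z: comm_group "G\<lparr>carrier := center G\<rparr>" by (rule comm_group_center)
  have "finite (center G)" using subgroup.subset[OF subgroup_center] fin by (rule finite_subset)
  then show ?thesis
    using Z.card_pow_kernel_times_image[of "p ^ m"] by (simp add: nat_pow_consistent[symmetric])
qed

lemma card_quotient_N: "card (carrier (G Mod N n m k)) * card (N n m k) = card (carrier G)"
  using lagrange[OF subgroup_N] by (simp add: FactGroup_def order_def)

lemma card_N_pos: "card (N n m k) > 0"
  using subgroup.one_closed[OF subgroup_N] finite_subset[OF subgroup.subset[OF subgroup_N] fin]
  by (metis card_gt_0_iff empty_iff)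

end

end

section \<open>The invariants\<close>

lemma inv_into_algebra_iso_group_algebra:
  fixes G :: "('g, 'm) monoid_scheme" and H :: "('h, 'n) monoid_scheme" and F :: "'f::field itself"
  assumes G: "group G" "finite (carrier G)"
    and iso: "h \<in> algebra_iso (group_algebra F G) (group_algebra F H)"
  shows "inv_into (carrier (group_algebra F G)) h \<in> algebra_iso (group_algebra F H) (group_algebra F G)"
proof -
  let ?A = "group_algebra F G" and ?B = "group_algebra F H"
  let ?g = "inv_into (carrier ?A) h"
  have h: "h \<in> ring_iso ?A ?B" and smult: "\<And>c a. a \<in> carrier ?A \<Longrightarrow> h (c \<odot>\<^bsub>?A\<^esub> a) = c \<odot>\<^bsub>?B\<^esub> h a"
    using iso by (auto simp: algebra_iso_def)
  have "?g \<in> ring_iso ?B ?A"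
    by (rule ring_iso_set_sym[OF group.ring_group_algebra[OF G] h])
  moreover have "?g (c \<odot>\<^bsub>?B\<^esub> b) = c \<odot>\<^bsub>?A\<^esub> ?g b" if b: "b \<in> carrier ?B" for c b
  proof -
    have bij: "bij_betw h (carrier ?A) (carrier ?B)" using h by (simp add: ring_iso_def)
    have a: "?g b \<in> carrier ?A" and hb: "h (?g b) = b"
      using b bij by (auto simp: bij_betw_def inv_into_into f_inv_into_f)
    have "c \<odot>\<^bsub>?A\<^esub> ?g b \<in> carrier ?A"
      using a by (auto simp: carrier_group_algebra coef_group_algebra_smult)
    then have "?g (h (c \<odot>\<^bsub>?A\<^esub> ?g b)) = c \<odot>\<^bsub>?A\<^esub> ?g b"
      using bij by (intro inv_into_f_f) (auto simp: bij_betw_def)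
    then show ?thesis by (simp only: smult[OF a] hb)
  qed
  ultimately show ?thesis by (simp add: algebra_iso_def)
qed

lemma nat_mult_cancel:
  fixes a b c d x y :: nat
  assumes "a * c = x" "b * d = y" "c = d" "x = y" "d \<noteq> 0"
  shows "a = b"
  using assms by (metis mult_right_cancel)

theorem theorem2:
  fixes G :: "'g monoid" and H :: "'h monoid" and p n :: nat
  assumes "p = CHAR('f::field)" and "p > 0"
    and "finite_p_group p G"
    and "finite_p_group p H"
    and "algebra_isomorphic (group_algebra TYPE('f) G) (group_algebra TYPE('f) H)"
  shows "G Mod commutator_Omega_center p n G
           \<cong> H Mod commutator_Omega_center p n H
       \<and> G\<lparr>carrier := commutator_Omega_center p n G\<rparr> Mod commutator_subgroup G
           \<cong> H\<lparr>carrier := commutator_Omega_center p n H\<rparr> Mod commutator_subgroup H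
       \<and> G\<lparr>carrier := center_Agemo_commutator p n G\<rparr>
           \<cong> H\<lparr>carrier := center_Agemo_commutator p n H\<rparr>
       \<and> G\<lparr>carrier := center G\<rparr> Mod center_Agemo_commutator p n G
           \<cong> H\<lparr>carrier := center H\<rparr> Mod center_Agemo_commutator p n H"
proof -
  have prime: "Factorial_Ring.prime p" using assms(1,2) prime_CHAR_semidom by blast
  interpret G: group G using assms(3) by (simp add: finite_p_group_def)
  interpret H: group H using assms(4) by (simp add: finite_p_group_def)
  obtain h where h: "h \<in> algebra_iso (group_algebra TYPE('f) G) (group_algebra TYPE('f) H)"
    using assms(5) by (auto simp: algebra_isomorphic_def)
  have finG: "finite (carrier G)" using assms(3) by (simp add: finite_p_group_def)
  interpret GH: group_algebra_isomorphism G H p h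
    by unfold_locales (use assms h in auto)
  interpret HG: group_algebra_isomorphism H G p "inv_into (carrier (group_algebra TYPE('f) G)) h"
    by unfold_locales (use assms inv_into_algebra_iso_group_algebra[OF G.is_group finG h] in auto)
  have same_card: "card (carrier G) = card (carrier H)"
    using GH.card_carrier_le HG.card_carrier_le by (rule antisym[rotated])
  obtain e where ordG: "order G = p ^ e" using assms(3) by (auto simp: finite_p_group_def)
  then have ordH: "order H = p ^ e" using same_card by (simp add: order_def)
  let ?N = "mixed_power_subgroup p"
  have N: "card (?N n m k G) = card (?N n m k H)" for n m k
  proof -
    have "card (carrier (G Mod ?N n m k G)) = card (carrier (H Mod ?N n m k H))"
      using GH.card_mixed_power_quotient_le HG.card_mixed_power_quotient_le by (rule antisym[rotated])
    then have "card (carrier (G Mod ?N n m k G)) * card (?N n m k G) = card (carrier (G Mod ?N n m k G)) * card (?N n m k H)"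
      using G.card_quotient_N[OF ordG prime, of n m k] H.card_quotient_N[OF ordH prime, of n m k] same_card by simp
    moreover have "card (carrier (G Mod ?N n m k G)) \<noteq> 0"
      using G.card_quotient_N[OF ordG prime, of n m k] finG by (intro notI) auto
    ultimately show ?thesis by simp
  qed
  have powers: "card ((\<lambda>z. z [^]\<^bsub>G\<^esub> (p ^ m)) ` center G) = card ((\<lambda>z. z [^]\<^bsub>H\<^esub> (p ^ m)) ` center H)" for m
    using GH.card_center_powers_le HG.card_center_powers_le by (rule antisym[rotated])
  have omega: "card (G.omega_center p m) = card (H.omega_center p m)" for m
  proof -
    have "card (center G) = card (center H)"
      using powers[of 0] center_closed[of _ G] center_closed[of _ H] by simp
    then have "card (G.omega_center p m) * card ((\<lambda>z. z [^]\<^bsub>G\<^esub> (p ^ m)) ` center G)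
        = card (H.omega_center p m) * card ((\<lambda>z. z [^]\<^bsub>G\<^esub> (p ^ m)) ` center G)"
      using G.card_omega_center[OF ordG prime, of m] H.card_omega_center[OF ordH prime, of m] powers[of m] by simp
    moreover have "card ((\<lambda>z. z [^]\<^bsub>G\<^esub> (p ^ m)) ` center G) \<noteq> 0"
      using finite_subset[OF subgroup.subset[OF G.subgroup_center] finG] subgroup.one_closed[OF G.subgroup_center] by auto
    ultimately show ?thesis by simp
  qed
  have pos: "card (?N n m k H) \<noteq> 0" for n m k
    using H.card_N_pos[OF ordH prime, of n m k] by simp
  note NG = G.commutator_Omega_center_eq[OF ordG prime] G.center_Agemo_commutator_eq[OF ordG prime]
  note NH = H.commutator_Omega_center_eq[OF ordH prime] H.center_Agemo_commutator_eq[OF ordH prime]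
  have 1: "G Mod ?N n 0 e G \<cong> H Mod ?N n 0 e H"
  proof -
    note g = G.card_pow_kernel_factor_commutator_Omega[OF ordG prime] and h = H.card_pow_kernel_factor_commutator_Omega[OF ordH prime]
    obtain i where i: "order (G Mod ?N n 0 e G) = p ^ i" using g(2) by blast
    obtain j where j: "order (H Mod ?N n 0 e H) = p ^ j" using h(2) by blast
    have "card (pow_kernel (p ^ m) (G Mod ?N n 0 e G)) = card (pow_kernel (p ^ m) (H Mod ?N n 0 e H))" for m
      by (rule nat_mult_cancel[OF g(3) h(3) N same_card pos])
    then show ?thesis by (rule comm_p_group_iso_if_card_pow_kernel_eq[OF g(1) h(1) i j prime])
  qed
  have 2: "G\<lparr>carrier := ?N n 0 e G\<rparr> Mod commutator_subgroup G \<cong> H\<lparr>carrier := ?N n 0 e H\<rparr> Mod commutator_subgroup H"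
    (is "?A \<cong> ?B")
  proof -
    note g = G.card_pow_kernel_commutator_Omega_factor_derived[OF ordG prime, where n = n] and h = H.card_pow_kernel_commutator_Omega_factor_derived[OF ordH prime, where n = n]
    obtain i where i: "order ?A = p ^ i" using g(2) by blast
    obtain j where j: "order ?B = p ^ j" using h(2) by blast
    have "card (pow_kernel (p ^ m) ?A) = card (pow_kernel (p ^ m) ?B)" for m
      by (rule nat_mult_cancel[OF g(3) h(3) N N pos])
    then show ?thesis by (rule comm_p_group_iso_if_card_pow_kernel_eq[OF g(1) h(1) i j prime])
  qed
  have 3: "G\<lparr>carrier := center G \<inter> ?N 0 0 n G\<rparr> \<cong> H\<lparr>carrier := center H \<inter> ?N 0 0 n H\<rparr>"
    (is "?A \<cong> ?B")
  proof -
    note g = G.card_pow_kernel_center_Agemo[OF ordG prime, where n = n] and h = H.card_pow_kernel_center_Agemo[OF ordH prime, where n = n]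
    obtain i where i: "order ?A = p ^ i" using g(2) by blast
    obtain j where j: "order ?B = p ^ j" using h(2) by blast
    have "card (pow_kernel (p ^ m) ?A) = card (pow_kernel (p ^ m) ?B)" for m
      by (rule nat_mult_cancel[OF g(3) h(3) N _ pos]) (simp only: N omega)
    then show ?thesis by (rule comm_p_group_iso_if_card_pow_kernel_eq[OF g(1) h(1) i j prime])
  qed
  have 4: "G\<lparr>carrier := center G\<rparr> Mod (center G \<inter> ?N 0 0 n G) \<cong> H\<lparr>carrier := center H\<rparr> Mod (center H \<inter> ?N 0 0 n H)"
    (is "?A \<cong> ?B")
  proof -
    note g = G.card_pow_kernel_center_factor_Agemo[OF ordG prime, where n = n] and h = H.card_pow_kernel_center_factor_Agemo[OF ordH prime, where n = n]
    obtain i where i: "order ?A = p ^ i" using g(2) by blast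
    obtain j where j: "order ?B = p ^ j" using h(2) by blast
    have "card (pow_kernel (p ^ m) ?A) = card (pow_kernel (p ^ m) ?B)" for m
      by (rule nat_mult_cancel[OF g(3) h(3) N N pos])
    then show ?thesis by (rule comm_p_group_iso_if_card_pow_kernel_eq[OF g(1) h(1) i j prime])
  qed
  show ?thesis
    unfolding NG NH using 1 2 3 4 by (intro conjI)
qed

end
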